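(* Let $(\mathcal{A},m)$ be a multiarrangement in $V=\mathbb{K}^\ell$ with a hyperplane $H_0\in\mathcal{A}$, and put $m_0=m(H_0)$. Assume $(\mathcal{A},m)$ has a good summand $\theta_0\in D(\mathcal{A},m)$ to $H_0$. Then $(t-m_0)$ divides $\chi(\mathcal{A},m;t)$.
   Context: Let $\mathbb{K}$ be a field and $S=\mathbb{K}[x_1,\dots,x_\ell]$. A multiarrangement $(\mathcal{A},m)$ is a finite set of linear hyperplanes $H=\ker\alpha_H$ of $\mathbb{K}^\ell$ with $m:\mathcal{A}\to\mathbb{Z}_{>0}$. For $p\ge1$, $D^p(\mathcal{A},m)$ is the graded $S$-module of alternating maps $\theta:S^p\to S$ that are $\mathbb{K}$-derivations in each argument with $\theta(\alpha_H,f_2,\dots,f_p)\in\alpha_H^{m(H)}S$ for all $H,f_i$; $D^0(\mathcal{A},m)=S$, and $D(\mathcal{A},m)=D^1(\mathcal{A},m)$. $\psi(\mathcal{A},m;x,t)=\sum_{p=0}^\ell\mathrm{Hilb}(D^p(\mathcal{A},m),x)(t(x-1)-1)^p$, which is a polynomial in $x,t$. The characteristic polynomial is $\chi(\mathcal{A},m;t)=(-1)^\ell\psi(\mathcal{A},m;1,t)$. A good summand to $H_0$ is $\theta_0\in D(\mathcal{A},m)$ with all $\theta_0(x_i)$ zero or homogeneous of degree $m(H_0)$, and $\theta_0(\alpha_{H_0})=\alpha_{H_0}^{m(H_0)}$. *)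

theory Defs
  imports "HOL-Library.Poly_Mapping" "HOL-Library.Function_Algebras"
          "HOL-Computational_Algebra.Formal_Power_Series"
          "HOL-Computational_Algebra.Polynomial"
begin

text \<open>Multivariate polynomials: finitely supported maps from monomials
  (exponent vectors nat =>0 nat) to coefficients.  The ring S of the paper is
  the subset Svars l of polynomials involving only the variables x_i, i < l.\<close>

type_synonym 'k mpoly = "(nat \<Rightarrow>\<^sub>0 nat) \<Rightarrow>\<^sub>0 'k"

definition Svars :: "nat \<Rightarrow> ('k::zero) mpoly set" where
  "Svars l = {f. \<forall>mon \<in> Poly_Mapping.keys f. \<forall>i \<in> Poly_Mapping.keys mon. i < l}"

definition mdeg :: "(nat \<Rightarrow>\<^sub>0 nat) \<Rightarrow> nat" where
  "mdeg mon = (\<Sum>i\<in>Poly_Mapping.keys mon. Poly_Mapping.lookup mon i)"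

definition homog :: "nat \<Rightarrow> ('k::zero) mpoly \<Rightarrow> bool" where
  "homog d f \<longleftrightarrow> (\<forall>mon\<in>Poly_Mapping.keys f. mdeg mon = d)"

definition var :: "nat \<Rightarrow> ('k::{zero,one}) mpoly" where
  "var i = Poly_Mapping.single (Poly_Mapping.single i 1) 1"

definition const :: "('k::zero) \<Rightarrow> 'k mpoly" where
  "const c = Poly_Mapping.single 0 c"

definition mpoly_eval :: "('k::comm_semiring_1) mpoly \<Rightarrow> (nat \<Rightarrow> 'k) \<Rightarrow> 'k" where
  "mpoly_eval f v = (\<Sum>mon\<in>Poly_Mapping.keys f. Poly_Mapping.lookup f mon * (\<Prod>i\<in>Poly_Mapping.keys mon. v i ^ Poly_Mapping.lookup mon i))"

definition Vsp :: "nat \<Rightarrow> (nat \<Rightarrow> 'k::zero) set" where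
  "Vsp l = {v. \<forall>i\<ge>l. v i = 0}"

definition linear_form :: "nat \<Rightarrow> ('k::comm_semiring_1) mpoly \<Rightarrow> bool" where
  "linear_form l a \<longleftrightarrow> a \<in> Svars l \<and> homog 1 a \<and> a \<noteq> 0"

definition kernel :: "nat \<Rightarrow> ('k::comm_semiring_1) mpoly \<Rightarrow> (nat \<Rightarrow> 'k) set" where
  "kernel l a = {v \<in> Vsp l. mpoly_eval a v = 0}"

definition multiarrangement ::
  "nat \<Rightarrow> (nat \<Rightarrow> 'k::field) set set \<Rightarrow> ((nat \<Rightarrow> 'k) set \<Rightarrow> 'k mpoly)
     \<Rightarrow> ((nat \<Rightarrow> 'k) set \<Rightarrow> nat) \<Rightarrow> bool" where
  "multiarrangement l A \<alpha> m \<longleftrightarrow> finite A \<and>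
     (\<forall>H\<in>A. linear_form l (\<alpha> H) \<and> H = kernel l (\<alpha> H) \<and> m H > 0)"

text \<open>Alternating maps S^p -> S which are K-derivations in each argument.
  Arguments are lists of length p; maps are taken extensional (0 outside S^p).
  For p = 0 this is just a choice of an element of S, i.e. D^0 = S.\<close>
definition is_multider :: "nat \<Rightarrow> nat \<Rightarrow> (('k::field) mpoly list \<Rightarrow> 'k mpoly) \<Rightarrow> bool" where
  "is_multider l p \<theta> \<longleftrightarrow>
     (\<forall>fs. \<theta> fs \<in> Svars l) \<and>
     (\<forall>fs. \<not> (length fs = p \<and> set fs \<subseteq> Svars l) \<longrightarrow> \<theta> fs = 0) \<and>
     (\<forall>fs j f g c. length fs = p \<and> set fs \<subseteq> Svars l \<and> j < p \<and> f \<in> Svars l \<and> g \<in> Svars l \<longrightarrow>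
        \<theta> (fs[j := f + g]) = \<theta> (fs[j := f]) + \<theta> (fs[j := g]) \<and>
        \<theta> (fs[j := const c * f]) = const c * \<theta> (fs[j := f]) \<and>
        \<theta> (fs[j := f * g]) = f * \<theta> (fs[j := g]) + g * \<theta> (fs[j := f])) \<and>
     (\<forall>fs i j. length fs = p \<and> set fs \<subseteq> Svars l \<and> i < j \<and> j < p \<and> fs ! i = fs ! j \<longrightarrow> \<theta> fs = 0)"

definition Dp ::
  "nat \<Rightarrow> (nat \<Rightarrow> 'k::field) set set \<Rightarrow> ((nat \<Rightarrow> 'k) set \<Rightarrow> 'k mpoly)
     \<Rightarrow> ((nat \<Rightarrow> 'k) set \<Rightarrow> nat) \<Rightarrow> nat \<Rightarrow> ('k mpoly list \<Rightarrow> 'k mpoly) set" where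
  "Dp l A \<alpha> m p = {\<theta>. is_multider l p \<theta> \<and>
     (1 \<le> p \<longrightarrow> (\<forall>H\<in>A. \<forall>fs. length fs = p \<and> set fs \<subseteq> Svars l \<and> fs ! 0 = \<alpha> H \<longrightarrow>
         (\<exists>q\<in>Svars l. \<theta> fs = \<alpha> H ^ m H * q)))}"

definition Dp_deg ::
  "nat \<Rightarrow> (nat \<Rightarrow> 'k::field) set set \<Rightarrow> ((nat \<Rightarrow> 'k) set \<Rightarrow> 'k mpoly)
     \<Rightarrow> ((nat \<Rightarrow> 'k) set \<Rightarrow> nat) \<Rightarrow> nat \<Rightarrow> nat \<Rightarrow> ('k mpoly list \<Rightarrow> 'k mpoly) set" where
  "Dp_deg l A \<alpha> m p d = {\<theta> \<in> Dp l A \<alpha> m p.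
     \<forall>is. length is = p \<and> (\<forall>i\<in>set is. i < l) \<longrightarrow> homog d (\<theta> (map var is))}"

definition dscale :: "'k::field \<Rightarrow> ('k mpoly list \<Rightarrow> 'k mpoly) \<Rightarrow> ('k mpoly list \<Rightarrow> 'k mpoly)" where
  "dscale c \<theta> = (\<lambda>fs. const c * \<theta> fs)"

definition Hilb ::
  "nat \<Rightarrow> (nat \<Rightarrow> 'k::field) set set \<Rightarrow> ((nat \<Rightarrow> 'k) set \<Rightarrow> 'k mpoly)
     \<Rightarrow> ((nat \<Rightarrow> 'k) set \<Rightarrow> nat) \<Rightarrow> nat \<Rightarrow> int fps" where
  "Hilb l A \<alpha> m p = Abs_fps (\<lambda>d. int (vector_space.dim dscale (Dp_deg l A \<alpha> m p d)))"

text \<open>psi(x,t) as a polynomial in t whose coefficients are power series in x.\<close>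
definition psi ::
  "nat \<Rightarrow> (nat \<Rightarrow> 'k::field) set set \<Rightarrow> ((nat \<Rightarrow> 'k) set \<Rightarrow> 'k mpoly)
     \<Rightarrow> ((nat \<Rightarrow> 'k) set \<Rightarrow> nat) \<Rightarrow> int fps poly" where
  "psi l A \<alpha> m = (\<Sum>p\<le>l. [:Hilb l A \<alpha> m p:] * [:-1, fps_X - 1:] ^ p)"

text \<open>Evaluation at x = 1 of a power series which is a polynomial (finite support).\<close>
definition fps_at_one :: "int fps \<Rightarrow> int" where
  "fps_at_one f = (\<Sum>n\<in>{n. fps_nth f n \<noteq> 0}. fps_nth f n)"

definition chi ::
  "nat \<Rightarrow> (nat \<Rightarrow> 'k::field) set set \<Rightarrow> ((nat \<Rightarrow> 'k) set \<Rightarrow> 'k mpoly)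
     \<Rightarrow> ((nat \<Rightarrow> 'k) set \<Rightarrow> nat) \<Rightarrow> int poly" where
  "chi l A \<alpha> m = smult ((-1) ^ l) (map_poly fps_at_one (psi l A \<alpha> m))"

definition good_summand ::
  "nat \<Rightarrow> (nat \<Rightarrow> 'k::field) set set \<Rightarrow> ((nat \<Rightarrow> 'k) set \<Rightarrow> 'k mpoly)
     \<Rightarrow> ((nat \<Rightarrow> 'k) set \<Rightarrow> nat) \<Rightarrow> (nat \<Rightarrow> 'k) set \<Rightarrow> ('k mpoly list \<Rightarrow> 'k mpoly) \<Rightarrow> bool" where
  "good_summand l A \<alpha> m H0 \<theta>0 \<longleftrightarrow> \<theta>0 \<in> Dp l A \<alpha> m 1 \<and>
     (\<forall>i<l. homog (m H0) (\<theta>0 [var i])) \<and>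
     \<theta>0 [\<alpha> H0] = \<alpha> H0 ^ m H0"

end

theory Submission
  imports Defs "HOL-Computational_Algebra.Polynomial_FPS" "HOL-Library.Multiset_Order" "HOL-Library.Product_Lexorder"
begin

text \<open>
  Contraction with \<open>\<alpha> H0\<close>, divided by its m0-th power, maps D^p to the submodule D0^(p-1) of elements of
  D^(p-1) that vanish on \<open>\<alpha> H0\<close>, with section \<open>\<eta> \<mapsto> \<theta>0 \<and> \<eta>\<close>. Hence Hilb(D^p) = Hilb(D0^p) + x^m0 Hilb(D0^(p-1)), and
  with y = t(x-1) - 1 the series psi is the product of psi' = (x-1) (sum of the Hilb(D0^p) y^p) and
  x^m0 t - (1 + x + ... + x^(m0-1)). At x = 1 the last factor is t - m0, so it remains to see that psi'
  is a polynomial in x, and for this it suffices that psi is one.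

  Polynomiality of psi is proved without generic forms. In the complex of the D^p[xi_1,...,xi_l] with
  contraction by the sum of the xi_i dx_i, wedging with a logarithmic field Q d/du is a homotopy for
  multiplication by Q(x) u(xi). Its homology is therefore supported on the union of the X times the annihilator of X, X a flat,
  and has a Hilbert series that is a sum of terms P(x,s) / ((1-x)^k (1-s)^(l-k)). Taking Euler
  characteristics, the sum of the Hilb(D^p) (-s)^p is the sum of the P(x,s) ((1-s)/(1-x))^k, and
  s = 1 - t(x-1) turns this into a polynomial.
\<close>

section \<open>Power series with polynomial coefficients\<close>

text \<open>The obstacle is evaluation at x = 1. \<open>fps_at_one\<close> sums over the support,
  and a sum over an infinite set is 0, so a factorisation of power series says nothing about
  \<open>chi\<close> until both factors are known to be polynomials in x. As K may be finite, forms
  in general position need not exist; the l variables xi_i are adjoined together instead. The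
  support claim comes from the choice of Q and u. At a point (x, xi) let X be the intersection of
  the hyperplanes through x, let u be any vector of X, and let Q be the product of the forms of the
  other hyperplanes with their multiplicities. Then Q d/du is logarithmic and Q(x) is not 0, so
  u(xi) = 0. The dimensions k of X and l - k of its annihilator are the exponents in the
  denominators; exponents with a sum above l could leave a pole at x = 1 after the substitution for
  s. The weight s^p has its source in the contraction, which lowers p by one and raises the degree
  in xi by one.\<close>

lemma map_poly_fps_of_poly_add:
  "map_poly fps_of_poly (P + Q) = map_poly fps_of_poly P + map_poly fps_of_poly (Q :: 'a::comm_ring_1 poly poly)"
  by (rule poly_eqI) (simp add: coeff_map_poly fps_of_poly_add)

lemma map_poly_fps_of_poly_diff:
  "map_poly fps_of_poly (P - Q) = map_poly fps_of_poly P - map_poly fps_of_poly (Q :: 'a::comm_ring_1 poly poly)"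
  by (rule poly_eqI) (simp add: coeff_map_poly fps_of_poly_diff)

lemma map_poly_fps_of_poly_mult:
  "map_poly fps_of_poly (P * Q) = map_poly fps_of_poly P * map_poly fps_of_poly (Q :: 'a::comm_ring_1 poly poly)"
  by (rule poly_eqI) (simp add: coeff_map_poly coeff_mult fps_of_poly_sum fps_of_poly_mult)

text \<open>The subring Z[x][t] of Z[[x]][t]. On it \<open>fps_at_one\<close> is evaluation at x = 1
  of each coefficient.\<close>

definition poly_coeffs :: "int fps poly \<Rightarrow> bool" where
  "poly_coeffs p \<longleftrightarrow> (\<exists>P :: int poly poly. p = map_poly fps_of_poly P)"

lemma poly_coeffs_add: "poly_coeffs p \<Longrightarrow> poly_coeffs q \<Longrightarrow> poly_coeffs (p + q)"
  unfolding poly_coeffs_def by (metis map_poly_fps_of_poly_add)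

lemma poly_coeffs_diff: "poly_coeffs p \<Longrightarrow> poly_coeffs q \<Longrightarrow> poly_coeffs (p - q)"
  unfolding poly_coeffs_def by (metis map_poly_fps_of_poly_diff)

lemma poly_coeffs_mult: "poly_coeffs p \<Longrightarrow> poly_coeffs q \<Longrightarrow> poly_coeffs (p * q)"
  unfolding poly_coeffs_def by (metis map_poly_fps_of_poly_mult)

lemma poly_coeffs_0 [simp]: "poly_coeffs 0"
  unfolding poly_coeffs_def by (rule exI[of _ 0]) simp

lemma poly_coeffs_const: "poly_coeffs [:fps_of_poly c:]"
  unfolding poly_coeffs_def by (rule exI[of _ "[:c:]"]) (simp add: map_poly_pCons)

lemma poly_coeffs_linear: "poly_coeffs [:fps_of_poly c, fps_of_poly d:]"
  unfolding poly_coeffs_def by (rule exI[of _ "[:c, d:]"]) (simp add: map_poly_pCons)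

lemma poly_coeffs_1 [simp]: "poly_coeffs 1"
  using poly_coeffs_const[of 1] by (simp add: one_pCons)

lemma poly_coeffs_power: "poly_coeffs p \<Longrightarrow> poly_coeffs (p ^ n)"
  by (induction n) (auto intro: poly_coeffs_mult)

lemma poly_coeffs_sum: "(\<And>i. i \<in> I \<Longrightarrow> poly_coeffs (f i)) \<Longrightarrow> poly_coeffs (sum f I)"
  by (induction I rule: infinite_finite_induct) (auto intro: poly_coeffs_add)

lemma poly_coeffs_pcompose:
  assumes "poly_coeffs p" "poly_coeffs q"
  shows "poly_coeffs (pcompose p q)"
proof -
  obtain P where P: "p = map_poly fps_of_poly P"
    using assms(1) unfolding poly_coeffs_def by blast
  have "poly_coeffs (pcompose (map_poly fps_of_poly P) q)"
    by (induction P)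
       (auto simp: map_poly_pCons pcompose_pCons intro!: poly_coeffs_add poly_coeffs_mult poly_coeffs_const assms(2))
  then show ?thesis using P by simp
qed

lemma poly_coeffsI:
  assumes "\<And>i. coeff p i \<in> range fps_of_poly"
  shows "poly_coeffs p"
  using assms
proof (induction p)
  case (pCons a p)
  have "coeff p i \<in> range fps_of_poly" for i
    using pCons.prems[of "Suc i"] by simp
  then have "poly_coeffs p" by (rule pCons.IH)
  moreover obtain c where "a = fps_of_poly c"
    using pCons.prems[of 0] by auto
  moreover have "poly_coeffs [:0, 1:]"
    using poly_coeffs_linear[of 0 1] by simp
  ultimately have "poly_coeffs ([:fps_of_poly c:] + [:0, 1:] * p)" "a = fps_of_poly c"
    by (blast intro: poly_coeffs_add poly_coeffs_mult poly_coeffs_const)+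
  then show ?case by simp
qed simp

lemma poly_coeffsD: "poly_coeffs p \<Longrightarrow> coeff p i \<in> range fps_of_poly"
  unfolding poly_coeffs_def by (auto simp: coeff_map_poly)

lemma fps_at_one_fps_of_poly: "fps_at_one (fps_of_poly p) = poly p 1"
proof -
  have "fps_at_one (fps_of_poly p) = (\<Sum>n\<in>{n. coeff p n \<noteq> 0}. coeff p n)"
    by (simp add: fps_at_one_def)
  also have "\<dots> = (\<Sum>n\<le>degree p. coeff p n)"
    by (rule sum.mono_neutral_left) (auto simp: le_degree)
  finally show ?thesis by (simp add: poly_altdef)
qed

lemma fps_at_one_0: "fps_at_one 0 = 0"
  using fps_at_one_fps_of_poly[of 0] by simp

lemma map_poly_fps_at_one: 
  "map_poly fps_at_one (map_poly fps_of_poly P) = map_poly (\<lambda>p. poly p 1) P"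
  by (rule poly_eqI) (simp add: coeff_map_poly fps_at_one_0 fps_at_one_fps_of_poly)

lemma map_poly_eval_mult:
  "map_poly (\<lambda>p. poly p c) (P * Q) = map_poly (\<lambda>p. poly p c) P * map_poly (\<lambda>p. poly p c) (Q :: 'a::comm_ring_1 poly poly)"
  by (rule poly_eqI) (simp add: coeff_map_poly coeff_mult poly_sum)

text \<open>Multiplicativity is lost outside Z[x][t]: for the constants 1 - x and 1 / (1 - x) the
  right-hand side is 0, the second series having infinite support, while the left-hand side is
  1.\<close>

lemma map_poly_fps_at_one_mult:
  assumes "poly_coeffs p" "poly_coeffs q"
  shows "map_poly fps_at_one (p * q) = map_poly fps_at_one p * map_poly fps_at_one q"
  using assms unfolding poly_coeffs_def
  by (auto simp: map_poly_fps_of_poly_mult[symmetric] map_poly_fps_at_one map_poly_eval_mult)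

text \<open>Comparing coefficients of t from the top down recovers the factor, because a power series f
  is a polynomial as soon as x^n f is one.\<close>
lemma poly_coeffs_of_mult:
  fixes p :: "int fps poly"
  assumes "poly_coeffs (p * [:fps_of_poly c, fps_X ^ n:])"
  shows "poly_coeffs p"
proof (rule poly_coeffsI)
  have shift: "f \<in> range fps_of_poly" if "fps_X ^ n * f = fps_of_poly u" for f :: "int fps" and u
  proof -
    have "f = fps_shift n (fps_X ^ n * f)"
      by (simp add: fps_eq_iff fps_X_power_mult_nth)
    also have "\<dots> = fps_of_poly (poly_shift n u)"
      unfolding that by simp
    finally show ?thesis by (rule range_eqI)
  qed
  have coef: "coeff (p * [:fps_of_poly c, fps_X ^ n:]) (Suc i) = fps_X ^ n * coeff p i + fps_of_poly c * coeff p (Suc i)" for i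
    by (simp add: coeff_pCons mult.commute)
  have main: "coeff p i \<in> range fps_of_poly" if "Suc (degree p) \<le> i + k" for i k
    using that
  proof (induction k arbitrary: i)
    case 0
    then have "coeff p i = 0" by (intro coeff_eq_0) simp
    then show ?case by (metis fps_of_poly_0 rangeI)
  next
    case (Suc k)
    obtain v where v: "coeff p (Suc i) = fps_of_poly v"
      using Suc.IH[of "Suc i"] Suc.prems by auto
    obtain w where w: "coeff (p * [:fps_of_poly c, fps_X ^ n:]) (Suc i) = fps_of_poly w"
      using poly_coeffsD[OF assms] by blast
    have "fps_X ^ n * coeff p i = fps_of_poly (w - c * v)"
      using coef[of i] v w by (simp add: fps_of_poly_diff fps_of_poly_mult algebra_simps)
    then show ?case by (rule shift)
  qed
  show "coeff p i \<in> range fps_of_poly" for i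
    using main[of i "Suc (degree p)"] by simp
qed

text \<open>In \<open>int fps fps\<close> the outer variable is s and the inner one is x:
  \<open>fps_X\<close> stands for s and \<open>fps_const fps_X\<close> for x. The predicate singles
  out Z[x][s].\<close>

definition bipoly :: "int fps fps \<Rightarrow> bool" where
  "bipoly f \<longleftrightarrow> (\<exists>p. poly_coeffs p \<and> f = fps_of_poly p)"

lemma bipoly_add: "bipoly f \<Longrightarrow> bipoly g \<Longrightarrow> bipoly (f + g)"
  unfolding bipoly_def by (metis fps_of_poly_add poly_coeffs_add)

lemma bipoly_diff: "bipoly f \<Longrightarrow> bipoly g \<Longrightarrow> bipoly (f - g)"
  unfolding bipoly_def by (metis fps_of_poly_diff poly_coeffs_diff)

lemma bipoly_mult: "bipoly f \<Longrightarrow> bipoly g \<Longrightarrow> bipoly (f * g)"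
  unfolding bipoly_def by (metis fps_of_poly_mult poly_coeffs_mult)

lemma bipoly_0 [simp]: "bipoly 0"
  unfolding bipoly_def by (rule exI[of _ 0]) simp

lemma bipoly_1 [simp]: "bipoly 1"
  unfolding bipoly_def by (rule exI[of _ 1]) simp

lemma bipoly_X [simp]: "bipoly fps_X"
  unfolding bipoly_def using poly_coeffs_linear[of 0 1]
  by (intro exI[of _ "[:0,1:]"]) (simp add: fps_of_poly_fps_X)

lemma bipoly_const_X [simp]: "bipoly (fps_const fps_X)"
  unfolding bipoly_def using poly_coeffs_const[of "[:0,1:]"]
  by (intro exI[of _ "[:fps_X:]"]) (simp add: fps_of_poly_const)

lemma bipoly_power: "bipoly f \<Longrightarrow> bipoly (f ^ n)"
  by (induction n) (auto intro: bipoly_mult)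

lemma bipoly_sum: "(\<And>i. i \<in> I \<Longrightarrow> bipoly (f i)) \<Longrightarrow> bipoly (sum f I)"
  by (induction I rule: infinite_finite_induct) (auto intro: bipoly_add)

text \<open>Sums of terms P_k(x,s) / ((1-x)^k (1-s)^(l-k)), with denominators cleared termwise. The
  exponents add up to l in each term, which is what the later substitution for s can absorb.\<close>

definition mixed_rational :: "nat \<Rightarrow> int fps fps \<Rightarrow> bool" where
  "mixed_rational l h \<longleftrightarrow> (\<exists>hk. h = (\<Sum>k\<le>l. hk k) \<and>
     (\<forall>k\<le>l. bipoly (fps_const (1 - fps_X) ^ k * (1 - fps_X) ^ (l - k) * hk k)))"

lemma mixed_rational_add:
  assumes "mixed_rational l f" "mixed_rational l g"
  shows "mixed_rational l (f + g)"
proof -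
  obtain u v where u: "f = (\<Sum>k\<le>l. u k)" "\<forall>k\<le>l. bipoly (fps_const (1 - fps_X) ^ k * (1 - fps_X) ^ (l - k) * u k)"
    and v: "g = (\<Sum>k\<le>l. v k)" "\<forall>k\<le>l. bipoly (fps_const (1 - fps_X) ^ k * (1 - fps_X) ^ (l - k) * v k)"
    using assms unfolding mixed_rational_def by blast
  show ?thesis unfolding mixed_rational_def
    by (rule exI[of _ "\<lambda>k. u k + v k"]) (use u v in \<open>auto simp: sum.distrib distrib_left intro!: bipoly_add\<close>)
qed

lemma mixed_rationalI:
  assumes "k \<le> l" "bipoly (fps_const (1 - fps_X) ^ k * (1 - fps_X) ^ (l - k) * h)"
  shows "mixed_rational l h"
  unfolding mixed_rational_def
proof (intro exI[of _ "\<lambda>j. if j = k then h else 0"] conjI)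
  show "h = (\<Sum>j\<le>l. if j = k then h else 0)"
    using assms(1) by simp
qed (use assms in auto)

lemma mixed_rational_0 [simp]: "mixed_rational l 0"
  using mixed_rationalI[of 0 l 0] by simp

lemma bipoly_neg_X: "bipoly (- fps_X)"
  using bipoly_diff[OF bipoly_0 bipoly_X] by simp

lemma mixed_rational_mult:
  assumes "bipoly c" "mixed_rational l h"
  shows "mixed_rational l (c * h)"
proof -
  obtain u where u: "h = (\<Sum>k\<le>l. u k)" "\<forall>k\<le>l. bipoly (fps_const (1 - fps_X) ^ k * (1 - fps_X) ^ (l - k) * u k)"
    using assms unfolding mixed_rational_def by blast
  have "bipoly (fps_const (1 - fps_X) ^ k * (1 - fps_X) ^ (l - k) * (c * u k))" if "k \<le> l" for k
    using bipoly_mult[OF assms(1), of "fps_const (1 - fps_X) ^ k * (1 - fps_X) ^ (l - k) * u k"] u(2) that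
    by (simp add: algebra_simps)
  then show ?thesis unfolding mixed_rational_def
    by (intro exI[of _ "\<lambda>k. c * u k"]) (use u in \<open>auto simp: sum_distrib_left\<close>)
qed

text \<open>The substitution s = 1 - t(x - 1) turns (1 - s)/(1 - x) into -t, which clears all denominators.\<close>
lemma poly_coeffs_of_mixed_rational:
  fixes H :: "nat \<Rightarrow> int fps"
  assumes h: "mixed_rational l h"
    and eq: "(\<Sum>p\<le>l. (- fps_X) ^ p * fps_const (H p)) = (1 - fps_X) ^ l * h"
  shows "poly_coeffs (\<Sum>p\<le>l. [:H p:] * [:-1, fps_X - 1:] ^ p)"
proof -
  define g :: "int fps" where "g = Abs_fps (\<lambda>_. 1)"
  have g: "g * (1 - fps_X) = 1"
    by (simp add: fps_eq_iff g_def algebra_simps)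
  obtain u where u: "h = (\<Sum>k\<le>l. u k)" "\<forall>k\<le>l. bipoly (fps_const (1 - fps_X) ^ k * (1 - fps_X) ^ (l - k) * u k)"
    using h unfolding mixed_rational_def by blast
  obtain P where P: "\<And>k. k \<le> l \<Longrightarrow> poly_coeffs (P k) \<and> fps_const (1 - fps_X) ^ k * (1 - fps_X) ^ (l - k) * u k = fps_of_poly (P k)"
    using u(2) unfolding bipoly_def by metis
  \<comment> \<open>The factor (1-s)^l cancels (1-s)^(l-k) and leaves P_k ((1-s)/(1-x))^k, where
    \<open>g\<close> is 1 / (1-x).\<close>
  have A: "(1 - fps_X) ^ l * u k = fps_of_poly ([:g:] ^ k * [:1, -1:] ^ k * P k)" if "k \<le> l" for k
  proof -
    have one: "fps_const g ^ k * fps_const (1 - fps_X) ^ k = 1"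
      by (simp add: power_mult_distrib[symmetric] g)
    have "(1 - fps_X) ^ l * u k = (fps_const g ^ k * fps_const (1 - fps_X) ^ k) * ((1 - fps_X) ^ (k + (l - k)) * u k)"
      using that one by simp
    also have "\<dots> = fps_const g ^ k * (1 - fps_X) ^ k * (fps_const (1 - fps_X) ^ k * (1 - fps_X) ^ (l - k) * u k)"
      by (simp only: power_add mult_ac)
    also have "\<dots> = fps_const g ^ k * (1 - fps_X) ^ k * fps_of_poly (P k)"
      using P[OF that] by simp
    also have "\<dots> = fps_of_poly ([:g:] ^ k * [:1, -1:] ^ k * P k)"
    proof -
      have "fps_of_poly [:1, -1 :: int fps:] = 1 - fps_X"
        by (simp add: fps_of_poly_pCons)
      then show ?thesis by (simp add: fps_of_poly_mult fps_of_poly_power fps_of_poly_const)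
    qed
    finally show ?thesis .
  qed
  have mX: "fps_of_poly [:0, -1 :: int fps:] = - fps_X"
    by (simp add: fps_of_poly_pCons)
  have "fps_of_poly (\<Sum>p\<le>l. [:H p:] * [:0, -1:] ^ p) = (\<Sum>p\<le>l. (- fps_X) ^ p * fps_const (H p))"
    by (simp only: fps_of_poly_sum fps_of_poly_mult fps_of_poly_power fps_of_poly_const mX mult.commute)
  also have "\<dots> = (\<Sum>k\<le>l. (1 - fps_X) ^ l * u k)"
    unfolding eq u(1) by (simp add: sum_distrib_left)
  also have "\<dots> = fps_of_poly (\<Sum>k\<le>l. [:g:] ^ k * [:1, -1:] ^ k * P k)"
    by (simp add: A fps_of_poly_sum)
  \<comment> \<open>The identity is moved from power series in s back to polynomials in s over
    Z[[x]]: the \<open>q\<close> below has constant term 1, so it can be substituted only into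
    polynomials.\<close>
  finally have E: "(\<Sum>p\<le>l. [:H p:] * [:0, -1:] ^ p) = (\<Sum>k\<le>l. [:g:] ^ k * [:1, -1:] ^ k * P k)"
    by (simp only: fps_of_poly_eq_iff)
  define q :: "int fps poly" where "q = [:1, 1 - fps_X:]"
  have q: "poly_coeffs q"
    unfolding q_def using poly_coeffs_linear[of 1 "1 - [:0,1:]"] by (simp add: fps_of_poly_diff fps_of_poly_fps_X del: diff_pCons)
  have pow: "pcompose (a ^ n) q = pcompose a q ^ n" for a n
    by (induction n) (simp_all add: pcompose_mult pcompose_1)
  \<comment> \<open>For s = \<open>q\<close>, the term -s becomes t(x-1) - 1, the base of the powers
    in \<open>psi\<close>, and 1 - s becomes t(x-1).\<close>
  have q1: "pcompose [:0, -1:] q = [:-1, fps_X - 1:]" "pcompose [:1, -1:] q = [:0, fps_X - 1:]"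
    by (simp_all add: pcompose_pCons q_def)
  have q2: "[:g:] * [:0, fps_X - 1:] = [:0, -1:]"
    using g by (simp add: algebra_simps)
  have "(\<Sum>p\<le>l. [:H p:] * [:-1, fps_X - 1:] ^ p) = pcompose (\<Sum>p\<le>l. [:H p:] * [:0, -1:] ^ p) q"
    by (simp only: pcompose_sum pcompose_mult pow q1 pcompose_const)
  also have "\<dots> = (\<Sum>k\<le>l. ([:g:] * [:0, fps_X - 1:]) ^ k * pcompose (P k) q)"
    unfolding E by (simp only: pcompose_sum pcompose_mult pow q1 pcompose_const power_mult_distrib)
  also have "\<dots> = (\<Sum>k\<le>l. [:0, -1:] ^ k * pcompose (P k) q)"
    by (simp only: q2)
  finally have F: "(\<Sum>p\<le>l. [:H p:] * [:-1, fps_X - 1:] ^ p) = (\<Sum>k\<le>l. [:0, -1:] ^ k * pcompose (P k) q)" .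
  have "poly_coeffs [:0, -1:]"
    using poly_coeffs_linear[of 0 "-1"] by (simp add: fps_of_poly_uminus)
  then show ?thesis unfolding F
    using P q by (auto intro!: poly_coeffs_sum poly_coeffs_mult poly_coeffs_power poly_coeffs_pcompose)
qed

section \<open>Multisets of variables\<close>

text \<open>Dickson's lemma, by induction on the set of variables. A finite set that works for L
  after deleting x takes care of every U in which x is frequent. The remaining U have one of
  finitely many multiplicities of x, and for a fixed multiplicity only the other variables
  matter.\<close>

lemma multiset_finite_basis:
  assumes "finite I" "\<forall>U\<in>L. set_mset U \<subseteq> I"
  shows "\<exists>F. finite F \<and> F \<subseteq> L \<and> (\<forall>U\<in>L. \<exists>V\<in>F. V \<subseteq># U)"
  using assms
proof (induction I arbitrary: L rule: finite_induct)
  case empty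
  show ?case
  proof (cases "L = {}")
    case False
    with empty have "L = {{#}}" by auto
    then show ?thesis by (intro exI[of _ "{{#}}"]) auto
  qed auto
next
  case (insert x I)
  define pr where "pr U = filter_mset (\<lambda>y. y \<noteq> x) U" for U :: "'a multiset"
  have dec: "U = pr U + replicate_mset (count U x) x" for U
    unfolding pr_def by (rule multiset_eqI) auto
  have pr_set: "set_mset (pr U) \<subseteq> I" if "U \<in> L" for U
    using insert.prems that unfolding pr_def by auto
  have "\<exists>F. finite F \<and> F \<subseteq> pr ` L \<and> (\<forall>U\<in>pr ` L. \<exists>V\<in>F. V \<subseteq># U)"
    by (rule insert.IH) (use pr_set in auto)
  then obtain F0 where F0: "finite F0" "F0 \<subseteq> pr ` L" "\<forall>U\<in>pr ` L. \<exists>V\<in>F0. V \<subseteq># U"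
    by blast
  obtain F where F: "F \<subseteq> L" "finite F" "F0 = pr ` F"
    using finite_subset_image[OF F0(1,2)] by blast
  \<comment> \<open>No multiset of \<open>F\<close> contains x more than \<open>K\<close> times, so
    comparing the other variables suffices once U contains x at least \<open>K\<close>
    times.\<close>
  define K where "K = Max (insert 0 ((\<lambda>U. count U x) ` F))"
  have K: "count U x \<le> K" if "U \<in> F" for U
    unfolding K_def using F(2) that by (intro Max_ge) auto
  define S where "S k = {U\<in>L. count U x = k}" for k
  have "\<exists>G. finite G \<and> G \<subseteq> S k \<and> (\<forall>U\<in>S k. \<exists>V\<in>G. V \<subseteq># U)" for k
  proof -
    have "\<exists>G. finite G \<and> G \<subseteq> pr ` S k \<and> (\<forall>U\<in>pr ` S k. \<exists>V\<in>G. V \<subseteq># U)"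
      by (rule insert.IH) (use pr_set in \<open>auto simp: S_def\<close>)
    then obtain G0 where G0: "finite G0" "G0 \<subseteq> pr ` S k" "\<forall>U\<in>pr ` S k. \<exists>V\<in>G0. V \<subseteq># U"
      by blast
    obtain G where G: "G \<subseteq> S k" "finite G" "G0 = pr ` G"
      using finite_subset_image[OF G0(1,2)] by blast
    have "\<exists>V\<in>G. V \<subseteq># U" if U: "U \<in> S k" for U
    proof -
      obtain V where V: "V \<in> G" "pr V \<subseteq># pr U"
        using G0(3) G(3) U by auto
      have "count U x = count V x" using U V(1) G(1) by (auto simp: S_def)
      then have "V \<subseteq># U"
        using V(2) dec[of U] dec[of V] by (metis mset_subset_eq_mono_add_right_cancel)
      then show ?thesis using V(1) by blast
    qed
    then show ?thesis using G(1,2) by blast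
  qed
  then obtain G where G: "\<And>k. finite (G k)" "\<And>k. G k \<subseteq> S k" "\<And>k U. U \<in> S k \<Longrightarrow> \<exists>V\<in>G k. V \<subseteq># U"
    by metis
  show ?case
  proof (intro exI[of _ "F \<union> (\<Union>k<K. G k)"] conjI ballI)
    show "finite (F \<union> (\<Union>k<K. G k))" using F(2) G(1) by auto
    show "F \<union> (\<Union>k<K. G k) \<subseteq> L" using F(1) G(2) by (auto simp: S_def)
    fix U assume U: "U \<in> L"
    show "\<exists>V\<in>F \<union> (\<Union>k<K. G k). V \<subseteq># U"
    proof (cases "count U x < K")
      case True
      then show ?thesis using G(3)[of U "count U x"] U by (auto simp: S_def)
    next
      case False
      obtain V where V: "V \<in> F" "pr V \<subseteq># pr U"
        using F0(3) F(3) U by auto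
      have "count V x \<le> count U x" using K[OF V(1)] False by simp
      then have "pr V + replicate_mset (count V x) x \<subseteq># pr U + replicate_mset (count U x) x"
        using V(2) by (intro subset_mset.add_mono) (auto simp: subseteq_mset_def)
      then show ?thesis using V(1) dec[of U] dec[of V] by auto
    qed
  qed
qed

text \<open>Order ideals of monomials, that is, complements of monomial ideals in the variables
  I.\<close>

definition down_closed :: "'a set \<Rightarrow> 'a multiset set \<Rightarrow> bool" where
  "down_closed I D \<longleftrightarrow> (\<forall>U\<in>D. set_mset U \<subseteq> I \<and> (\<forall>V. V \<subseteq># U \<longrightarrow> V \<in> D))"

text \<open>The complements form an ascending chain of monomial ideals. Their union has a finite
  Dickson basis, which lies in a single member of the chain; that member is then the whole
  union.\<close>

lemma down_closed_chain_stops: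
  assumes "finite I" "\<And>k :: nat. down_closed I (D k)" "\<And>k. D (Suc k) \<subseteq> D k"
  shows "\<exists>K. D (Suc K) = D K"
proof -
  have anti: "D j \<subseteq> D i" if "i \<le> j" for i j
    using that
  proof (induction j rule: dec_induct)
    case (step n)
    then show ?case using assms(3)[of n] by blast
  qed simp
  define E where "E k = {U. set_mset U \<subseteq> I \<and> U \<notin> D k}" for k
  define W where "W = (\<Union>k. E k)"
  have "\<forall>U\<in>W. set_mset U \<subseteq> I"
    by (auto simp: E_def W_def)
  then obtain F where F: "finite F" "F \<subseteq> W" "\<forall>U\<in>W. \<exists>V\<in>F. V \<subseteq># U"
    using multiset_finite_basis[OF assms(1)] by metis
  have "\<exists>K. F \<subseteq> E K"
    using F(1,2)
  proof (induction F rule: finite_induct)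
    case (insert x F)
    then obtain i j where "x \<in> E i" "F \<subseteq> E j" by (auto simp: W_def)
    moreover have "E i \<subseteq> E (max i j)" "E j \<subseteq> E (max i j)"
      using anti[of i "max i j"] anti[of j "max i j"] by (auto simp: E_def)
    ultimately show ?case by (intro exI[of _ "max i j"]) auto
  qed auto
  then obtain K where K: "F \<subseteq> E K" by blast
  have "E k \<subseteq> E K" for k
  proof
    fix U assume U: "U \<in> E k"
    then obtain V where V: "V \<in> F" "V \<subseteq># U" using F(3) by (auto simp: W_def)
    then have "V \<notin> D K" using K by (auto simp: E_def)
    then have "U \<notin> D K" using assms(2)[of K] V(2) by (auto simp: down_closed_def)
    then show "U \<in> E K" using U by (auto simp: E_def)
  qed
  moreover have "set_mset U \<subseteq> I" if "U \<in> D K" for U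
    using assms(2)[of K] that unfolding down_closed_def by blast
  ultimately have "D K \<subseteq> D (Suc K)"
    by (auto simp: E_def)
  then show ?thesis using assms(3)[of K] by blast
qed

section \<open>Bigraded generating functions of sets of monomials\<close>

definition xdeg :: "('a \<Rightarrow> bool) \<Rightarrow> 'a multiset \<Rightarrow> nat" where
  "xdeg \<tau> U = size (filter_mset \<tau> U)"

definition sdeg :: "('a \<Rightarrow> bool) \<Rightarrow> 'a multiset \<Rightarrow> nat" where
  "sdeg \<tau> U = size (filter_mset (\<lambda>i. \<not> \<tau> i) U)"

definition hseries :: "(nat \<Rightarrow> nat \<Rightarrow> int) \<Rightarrow> int fps fps" where
  "hseries h = Abs_fps (\<lambda>b. Abs_fps (\<lambda>a. h a b))"

definition zvar :: "('a \<Rightarrow> bool) \<Rightarrow> 'a \<Rightarrow> int fps fps" where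
  "zvar \<tau> i = (if \<tau> i then fps_const fps_X else fps_X)"

lemma hseries_nth [simp]: "fps_nth (fps_nth (hseries h) b) a = h a b"
  by (simp add: hseries_def)

lemma hseries_add: "hseries (\<lambda>a b. f a b + g a b) = hseries f + hseries g"
  by (simp add: fps_eq_iff)

lemma hseries_diff: "hseries (\<lambda>a b. f a b - g a b) = hseries f - hseries g"
  by (simp add: fps_eq_iff)

lemma hseries_sum: "hseries (\<lambda>a b. \<Sum>i\<in>I. f i a b) = (\<Sum>i\<in>I. hseries (f i))"
  by (simp add: fps_eq_iff fps_sum_nth)

lemma hseries_shift_x:
  "fps_const fps_X * hseries h = hseries (\<lambda>a b. if a = 0 then 0 else h (a - 1) b)"
  by (simp add: fps_eq_iff)

lemma hseries_shift_s:
  "fps_X * hseries h = hseries (\<lambda>a b. if b = 0 then 0 else h a (b - 1))"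
  by (simp add: fps_eq_iff)

lemma bipoly_zvar: "bipoly (zvar \<tau> i)"
  by (simp add: zvar_def)

definition count_series :: "('a \<Rightarrow> bool) \<Rightarrow> 'a multiset set \<Rightarrow> int fps fps" where
  "count_series \<tau> D = hseries (\<lambda>a b. int (card {U\<in>D. xdeg \<tau> U = a \<and> sdeg \<tau> U = b}))"

lemma finite_multisets_of_degree:
  assumes "finite I"
  shows "finite {U. set_mset U \<subseteq> I \<and> xdeg \<tau> U = a \<and> sdeg \<tau> U = b}"
proof (rule finite_subset)
  have sz: "size U = xdeg \<tau> U + sdeg \<tau> U" for U
    unfolding xdeg_def sdeg_def by (metis multiset_partition size_union)
  show "{U. set_mset U \<subseteq> I \<and> xdeg \<tau> U = a \<and> sdeg \<tau> U = b} \<subseteq> mset ` {xs. set xs \<subseteq> I \<and> length xs = a + b}"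
  proof -
    have "U \<in> mset ` {xs. set xs \<subseteq> I \<and> length xs = xdeg \<tau> U + sdeg \<tau> U}" if "set_mset U \<subseteq> I" for U
    proof -
      obtain xs where "mset xs = U" using ex_mset by blast
      then show ?thesis using that sz[of U] by (auto simp: image_iff intro!: exI[of _ xs])
    qed
    then show ?thesis by auto
  qed
  show "finite (mset ` {xs. set xs \<subseteq> I \<and> length xs = a + b})"
    using finite_lists_length_eq[OF assms] by auto
qed

text \<open>A monomial of D either avoids i or is i times a unique monomial of the colon set; the
  factor \<open>zvar \<tau> i\<close> accounts for the removed variable.\<close>

lemma count_series_split:
  assumes I: "finite I" and D: "down_closed I D"
  shows "count_series \<tau> D = count_series \<tau> {U\<in>D. i \<notin># U} + zvar \<tau> i * count_series \<tau> {U. add_mset i U \<in> D}"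
proof -
  have fin: "finite {U\<in>D. xdeg \<tau> U = a \<and> sdeg \<tau> U = b}" for a b
    by (rule finite_subset[OF _ finite_multisets_of_degree[OF I, of \<tau> a b]])
       (use D in \<open>auto simp: down_closed_def\<close>)
  define c where "c a b = card {U\<in>{U. add_mset i U \<in> D}. xdeg \<tau> U = a \<and> sdeg \<tau> U = b}" for a b
  have card_eq: "card {U\<in>D. xdeg \<tau> U = a \<and> sdeg \<tau> U = b} =
      card {U\<in>{U\<in>D. i \<notin># U}. xdeg \<tau> U = a \<and> sdeg \<tau> U = b} +
      card {U. add_mset i U \<in> D \<and> xdeg \<tau> (add_mset i U) = a \<and> sdeg \<tau> (add_mset i U) = b}" for a b
  proof -
    have "{U\<in>D. xdeg \<tau> U = a \<and> sdeg \<tau> U = b} = {U\<in>{U\<in>D. i \<notin># U}. xdeg \<tau> U = a \<and> sdeg \<tau> U = b} \<union>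
      add_mset i ` {U. add_mset i U \<in> D \<and> xdeg \<tau> (add_mset i U) = a \<and> sdeg \<tau> (add_mset i U) = b}"
      by (auto simp: image_iff dest!: multi_member_split)
    moreover have "{U\<in>{U\<in>D. i \<notin># U}. xdeg \<tau> U = a \<and> sdeg \<tau> U = b} \<inter>
      add_mset i ` {U. add_mset i U \<in> D \<and> xdeg \<tau> (add_mset i U) = a \<and> sdeg \<tau> (add_mset i U) = b} = {}"
      by auto
    moreover have "inj (add_mset i)" by (auto intro: injI)
    ultimately show ?thesis
      using fin[of a b] by (simp add: card_Un_disjoint card_image inj_on_subset)
  qed
  have shift: "card {U. add_mset i U \<in> D \<and> xdeg \<tau> (add_mset i U) = a \<and> sdeg \<tau> (add_mset i U) = b} =
     (if \<tau> i then if a = 0 then 0 else c (a - 1) b else if b = 0 then 0 else c a (b - 1))" for a b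
    by (auto simp: c_def xdeg_def sdeg_def intro!: arg_cong[where f = card])
  show ?thesis
    unfolding count_series_def zvar_def
    by (auto simp: hseries_shift_x hseries_shift_s hseries_add[symmetric] card_eq shift c_def
        intro!: arg_cong[where f = hseries] ext)
qed

text \<open>Hilbert's rationality theorem for order ideals. The sets \<open>E k\<close> of monomials
  U with i^k U in D decrease and stabilise at some \<open>K\<close>. There the splitting recursion
  has the same series on both sides and can be solved at the cost of one factor 1 - z. Below
  \<open>K\<close> it is a finite recursion whose inhomogeneous terms avoid i.\<close>

lemma count_series_rational:
  assumes "finite I" "down_closed I D"
  shows "bipoly ((\<Prod>i\<in>I. 1 - zvar \<tau> i) * count_series \<tau> D)"
  using assms
proof (induction I arbitrary: D rule: finite_induct)
  case empty
  have "D = {} \<or> D = {{#}}"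
    using empty by (auto simp: down_closed_def)
  then have "count_series \<tau> D = 0 \<or> count_series \<tau> D = 1"
  proof
    assume "D = {{#}}"
    then have "{U\<in>D. xdeg \<tau> U = a \<and> sdeg \<tau> U = b} = (if a = 0 \<and> b = 0 then {{#}} else {})" for a b
      by (auto simp: xdeg_def sdeg_def)
    then show ?thesis by (auto simp: count_series_def fps_eq_iff)
  qed (auto simp: count_series_def fps_eq_iff)
  then show ?case by auto
next
  case (insert i I)
  define E where "E k = {U. U + replicate_mset k i \<in> D}" for k
  have E0: "E 0 = D" by (simp add: E_def)
  have ES: "E (Suc k) = {U. add_mset i U \<in> E k}" for k
    by (auto simp: E_def)
  have Edc: "down_closed (insert i I) (E k)" for k
  proof -
    have "V + replicate_mset k i \<in> D" if "U + replicate_mset k i \<in> D" "V \<subseteq># U" for U V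
      using insert.prems that unfolding down_closed_def by (meson subset_mset.add_right_mono)
    moreover have "set_mset U \<subseteq> insert i I" if "U + replicate_mset k i \<in> D" for U
      using insert.prems that unfolding down_closed_def by (metis Un_subset_iff set_mset_union)
    ultimately show ?thesis unfolding down_closed_def E_def by blast
  qed
  have Edec: "E (Suc k) \<subseteq> E k" for k
  proof
    fix U assume "U \<in> E (Suc k)"
    then have "add_mset i U \<in> E k" by (simp add: ES)
    moreover have "U \<subseteq># add_mset i U" by simp
    ultimately show "U \<in> E k" using Edc[of k] unfolding down_closed_def by blast
  qed
  obtain K where K: "E (Suc K) = E K"
    using down_closed_chain_stops[of "insert i I" E] insert.hyps Edc Edec by auto
  define z where "z = zvar \<tau> i"
  define Q where "Q = (\<Prod>i\<in>I. 1 - zvar \<tau> i)"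
  have base: "bipoly (Q * count_series \<tau> {U\<in>E k. i \<notin># U})" for k
    unfolding Q_def by (rule insert.IH) (use Edc[of k] in \<open>auto simp: down_closed_def dest: mset_subset_eqD\<close>)
  have split: "count_series \<tau> (E k) = count_series \<tau> {U\<in>E k. i \<notin># U} + z * count_series \<tau> (E (Suc k))" for k
    unfolding z_def ES by (rule count_series_split[OF _ Edc]) (use insert.hyps in auto)
  have z: "bipoly z" by (simp add: z_def bipoly_zvar)
  \<comment> \<open>The recursion is run from the stable index \<open>K\<close> down to 0, where
    \<open>E 0 = D\<close>.\<close>
  have main: "bipoly ((1 - z) * Q * count_series \<tau> (E (K - j)))" if "j \<le> K" for j
    using that
  proof (induction j)
    case 0
    have "(1 - z) * count_series \<tau> (E K) = count_series \<tau> {U\<in>E K. i \<notin># U}"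
      using split[of K] unfolding K by (simp add: algebra_simps)
    then have "(1 - z) * Q * count_series \<tau> (E K) = Q * count_series \<tau> {U\<in>E K. i \<notin># U}"
      by (metis mult.assoc mult.commute)
    then show ?case using base[of K] by (simp only: diff_zero)
  next
    case (Suc j)
    then have "Suc (K - Suc j) = K - j" by simp
    then have "(1 - z) * Q * count_series \<tau> (E (K - Suc j)) =
       (1 - z) * (Q * count_series \<tau> {U\<in>E (K - Suc j). i \<notin># U}) + z * ((1 - z) * Q * count_series \<tau> (E (K - j)))"
      using split[of "K - Suc j"] by (simp add: algebra_simps)
    then show ?case
      using Suc by (auto intro!: bipoly_add bipoly_mult bipoly_diff z base)
  qed
  have "(\<Prod>i\<in>insert i I. 1 - zvar \<tau> i) = (1 - z) * Q"
    using insert.hyps by (simp add: z_def Q_def)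
  then show ?case using main[of K] by (simp add: E0)
qed

section \<open>Finite-dimensional subspaces\<close>

locale kspace = vector_space
begin

text \<open>\<open>dim\<close> is a cardinality and is 0 in infinite dimension, so the dimension
  counts below carry this condition.\<close>

definition findim :: "'b set \<Rightarrow> bool" where
  "findim V \<longleftrightarrow> (\<exists>B. finite B \<and> V \<subseteq> span B)"

lemma findim_subset: "findim W \<Longrightarrow> V \<subseteq> W \<Longrightarrow> findim V"
  unfolding findim_def by blast

lemma findim_finite_basis:
  assumes "findim V"
  obtains B where "B \<subseteq> V" "finite B" "\<not> dependent B" "V \<subseteq> span B" "card B = dim V"
proof -
  obtain B where B: "B \<subseteq> V" "\<not> dependent B" "V \<subseteq> span B" "card B = dim V"
    using basis_exists[of V] by blast
  obtain C where C: "finite C" "V \<subseteq> span C" using assms unfolding findim_def by blast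
  have "finite B" using independent_span_bound[OF C(1) B(2)] B(1) C(2) by auto
  then show ?thesis using that B by blast
qed

lemma dim_span_insert:
  assumes "findim S"
  shows "dim (span (insert x S)) = (if x \<in> span S then dim (span S) else Suc (dim (span S)))"
proof (cases "x \<in> span S")
  case True
  then show ?thesis by (simp add: span_redundant)
next
  case False
  obtain B where B: "B \<subseteq> S" "finite B" "\<not> dependent B" "S \<subseteq> span B" "card B = dim S"
    using findim_finite_basis[OF assms] by blast
  have eq: "span B = span S" using B by (simp add: span_eq span_superset subset_trans)
  have ind: "\<not> dependent (insert x B)"
    using B(3) False eq by (intro independent_insertI) auto
  have "span (insert x B) = span (insert x S)"
  proof -
    have "span (insert x B) \<subseteq> span (insert x S)" using B(1) by (intro span_mono) auto
    moreover have "insert x S \<subseteq> span (insert x B)"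
      using B(4) span_mono[of B "insert x B"] by (auto intro: span_base)
    ultimately show ?thesis by (metis span_span span_mono subset_antisym)
  qed
  then have "dim (span (insert x S)) = card (insert x B)"
    using ind dim_span_eq_card_independent by metis
  moreover have "x \<notin> B" using False eq by (metis span_base)
  ultimately show ?thesis using False B by simp
qed

end

locale kspace_pair = vs1: kspace s1 + vs2: kspace s2
  for s1 :: "'a::field \<Rightarrow> 'b::ab_group_add \<Rightarrow> 'b" and s2 :: "'a::field \<Rightarrow> 'c::ab_group_add \<Rightarrow> 'c"
begin

text \<open>Rank and nullity for f restricted to V: a basis B of the kernel is extended to a basis C
  of V, and f sends C - B bijectively to a basis of the image.\<close>

lemma dim_kernel_image:
  assumes f: "Vector_Spaces.linear s1 s2 f" and V: "vs1.subspace V" "vs1.findim V"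
  shows "vs1.dim V = vs1.dim {v\<in>V. f v = 0} + vs2.dim (f ` V)"
proof -
  interpret lf: Vector_Spaces.linear s1 s2 f by (rule f)
  define K where "K = {v\<in>V. f v = 0}"
  have Ksub: "vs1.subspace K"
    using V(1) unfolding vs1.subspace_def K_def
    by (auto simp: lf.add lf.scale lf.zero)
  have "vs1.findim K" using vs1.findim_subset[OF V(2)] by (auto simp: K_def)
  then obtain B where B: "B \<subseteq> K" "finite B" "\<not> vs1.dependent B" "K \<subseteq> vs1.span B" "card B = vs1.dim K"
    using vs1.findim_finite_basis by blast
  obtain C where C: "B \<subseteq> C" "C \<subseteq> V" "\<not> vs1.dependent C" "V \<subseteq> vs1.span C"
    using vs1.maximal_independent_subset_extend[of B V] B(1,3) by (auto simp: K_def)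
  obtain D where D: "finite D" "V \<subseteq> vs1.span D" using V(2) unfolding vs1.findim_def by blast
  have finC: "finite C" using vs1.independent_span_bound[OF D(1) C(3)] C(2) D(2) by auto
  have spanC: "vs1.span C = V" using C V(1) by (metis subset_antisym vs1.span_minimal)
  have spanB: "vs1.span B = K" using B Ksub by (metis subset_antisym vs1.span_minimal)
  have inj_span: "inj_on f (vs1.span (C - B))"
    unfolding lf.inj_on_iff_eq_0[OF vs1.subspace_span]
  proof (intro ballI impI)
    fix x assume x: "x \<in> vs1.span (C - B)" "f x = 0"
    have "x \<in> V" using x(1) spanC vs1.span_mono[of "C - B" C] by auto
    then have "x \<in> vs1.span B" using x(2) spanB by (auto simp: K_def)
    \<comment> \<open>The coordinates of x over C are supported in B and also in C - B, hence they
      all vanish.\<close>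
    have "vs1.representation C x = vs1.representation B x" "vs1.representation C x = vs1.representation (C - B) x"
      by (rule vs1.representation_extend; use C \<open>x \<in> vs1.span B\<close> x(1) in auto)+
    then have "vs1.representation C x b = 0" for b
      using vs1.representation_ne_zero[of B x b] vs1.representation_ne_zero[of "C - B" x b] by auto
    moreover have "x \<in> vs1.span C" using x(1) vs1.span_mono[of "C - B" C] by auto
    ultimately show "x = 0"
      using vs1.sum_nonzero_representation_eq[of C x] C(3) by simp
  qed
  have ind: "\<not> vs2.dependent (f ` (C - B))"
    by (rule lf.independent_injective_image) (use C(3) inj_span vs1.independent_mono[of C "C - B"] in auto)
  have "f ` V = vs2.span (f ` C)"
    using spanC by (metis lf.span_image)
  also have "\<dots> = vs2.span (f ` (C - B))"
  proof (rule antisym)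
    have "f c \<in> vs2.span (f ` (C - B))" if "c \<in> C" for c
    proof (cases "c \<in> B")
      case True
      then have "f c = 0" using B(1) by (auto simp: K_def)
      then show ?thesis by (simp add: vs2.span_zero)
    next
      case False
      then show ?thesis using that by (intro vs2.span_base) auto
    qed
    then show "vs2.span (f ` C) \<subseteq> vs2.span (f ` (C - B))"
      by (intro vs2.span_minimal) auto
  qed (intro vs2.span_mono, auto)
  finally have "vs2.dim (f ` V) = card (f ` (C - B))"
    using ind vs2.dim_span_eq_card_independent by metis
  also have "\<dots> = card (C - B)"
    by (intro card_image inj_on_subset[OF inj_span]) (auto intro: vs1.span_base)
  finally have "vs2.dim (f ` V) = card C - card B"
    using C(1) finC B(2) by (simp add: card_Diff_subset)
  moreover have "vs1.dim V = card C"
    using spanC C(3) vs1.dim_span_eq_card_independent by metis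
  moreover have "card B \<le> card C" using C(1) finC by (rule card_mono[rotated])
  ultimately show ?thesis using B(5) by (simp add: K_def)
qed

lemma dim_injective_image:
  assumes "Vector_Spaces.linear s1 s2 f" "vs1.subspace V" "vs1.findim V" "\<And>v. v \<in> V \<Longrightarrow> f v = 0 \<Longrightarrow> v = 0"
  shows "vs2.dim (f ` V) = vs1.dim V"
proof -
  interpret lf: Vector_Spaces.linear s1 s2 f by (rule assms)
  have "{v\<in>V. f v = 0} = {0}"
    using assms vs1.subspace_0[OF assms(2)] by (auto simp: lf.zero)
  moreover have "vs1.dim {0} = 0"
    using vs1.dim_eq_card[of "{}" "{0}"] by (simp add: vs1.independent_empty)
  ultimately show ?thesis using dim_kernel_image[OF assms(1-3)] by simp
qed

lemma findim_image:
  assumes "Vector_Spaces.linear s1 s2 f" "vs1.findim V"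
  shows "vs2.findim (f ` V)"
proof -
  interpret lf: Vector_Spaces.linear s1 s2 f by (rule assms)
  obtain B where "finite B" "V \<subseteq> vs1.span B" using assms(2) by (auto simp: vs1.findim_def)
  then show ?thesis unfolding vs2.findim_def
    by (intro exI[of _ "f ` B"]) (auto simp: lf.span_image)
qed

text \<open>Finitely many preimages of a spanning set of the image span V: v and the matching
  combination w of these preimages differ by an element that f kills.\<close>

lemma findim_of_injective_image:
  assumes "Vector_Spaces.linear s1 s2 f" "vs1.subspace V" "vs2.findim (f ` V)" "\<And>v. v \<in> V \<Longrightarrow> f v = 0 \<Longrightarrow> v = 0"
  shows "vs1.findim V"
proof -
  interpret lf: Vector_Spaces.linear s1 s2 f by (rule assms)
  obtain B where B: "B \<subseteq> f ` V" "finite B" "f ` V \<subseteq> vs2.span B"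
    using vs2.findim_finite_basis[OF assms(3)] by metis
  obtain P where P: "P \<subseteq> V" "finite P" "B = f ` P"
    using finite_subset_image[OF B(2,1)] by blast
  have "V \<subseteq> vs1.span P"
  proof
    fix v assume v: "v \<in> V"
    then have "f v \<in> f ` vs1.span P" using B(3) P(3) by (auto simp: lf.span_image)
    then obtain w where w: "w \<in> vs1.span P" "f v = f w" by blast
    have "w \<in> V" using w(1) P(1) assms(2) vs1.span_minimal by blast
    have "v - w \<in> V" by (rule vs1.subspace_diff[OF assms(2) v \<open>w \<in> V\<close>])
    then have "v - w = 0" by (rule assms(4)) (simp add: lf.diff w(2))
    then show "v \<in> vs1.span P" using w(1) by simp
  qed
  then show ?thesis using P(2) by (auto simp: vs1.findim_def)
qed

end

section \<open>Standard monomials\<close>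

type_synonym 'v family = "nat \<Rightarrow> nat \<Rightarrow> 'v set"

text \<open>Bigraded modules are families of subspaces of one ambient space on which the commuting operators
  T_i act, and a subquotient is a pair of such families. T_i has bidegree (1,0) if \<open>\<tau> i\<close> and (0,1) otherwise.\<close>
locale operators = kspace scale
  for scale :: "'a::field \<Rightarrow> 'v::ab_group_add \<Rightarrow> 'v" +
  fixes T :: "nat \<Rightarrow> 'v \<Rightarrow> 'v" and \<tau> :: "nat \<Rightarrow> bool" and n :: nat
  assumes T_linear: "Vector_Spaces.linear scale scale (T i)"
    and T_commute: "T i (T j v) = T j (T i v)"
begin

definition subspaces :: "'v family \<Rightarrow> bool" where
  "subspaces N \<longleftrightarrow> (\<forall>a b. subspace (N a b))"

definition stable :: "'v family \<Rightarrow> bool" where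
  "stable N \<longleftrightarrow> subspaces N \<and> (\<forall>i<n. \<forall>a b. \<forall>v\<in>N a b.
      T i v \<in> N (a + of_bool (\<tau> i)) (b + of_bool (\<not> \<tau> i)))"

definition contains :: "'v family \<Rightarrow> ('v \<times> nat \<times> nat) set \<Rightarrow> bool" where
  "contains N G \<longleftrightarrow> (\<forall>(g, a, b)\<in>G. g \<in> N a b)"

text \<open>N1 / N2 is generated by the homogeneous elements G, each recorded with its bidegree.
  Stated by minimality among submodules, without linear combinations, the property can be
  transferred by exhibiting one suitable submodule W.\<close>

definition generated :: "('v \<times> nat \<times> nat) set \<Rightarrow> 'v family \<Rightarrow> 'v family \<Rightarrow> bool" where
  "generated G N1 N2 \<longleftrightarrow> contains N1 G \<and> (\<forall>a b. N2 a b \<subseteq> N1 a b) \<and>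
     (\<forall>W. stable W \<and> contains W G \<and> (\<forall>a b. N2 a b \<subseteq> W a b) \<longrightarrow> (\<forall>a b. N1 a b \<subseteq> W a b))"

lemma T_zero [simp]: "T i 0 = 0"
  by (rule module_hom.zero[OF module_hom_iff_linear[THEN iffD2, OF T_linear]])

lemma stable_zero: "stable (\<lambda>_ _. {0})"
  unfolding stable_def subspaces_def by (auto simp: subspace_single_0)

lemma generated_leastD:
  assumes "generated G N1 N2" "stable W" "contains W G" "\<And>a b. N2 a b \<subseteq> W a b"
  shows "N1 a b \<subseteq> W a b"
  using assms unfolding generated_def by simp

lemma generated_supset: "generated G N1 N2 \<Longrightarrow> N2 a b \<subseteq> N1 a b"
  by (simp add: generated_def)

lemma generated_contains: "generated G N1 N2 \<Longrightarrow> contains N1 G"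
  by (simp add: generated_def)

definition mon :: "nat multiset \<Rightarrow> 'v \<Rightarrow> 'v" where
  "mon U v = fold_mset T v U"

lemma mon_empty [simp]: "mon {#} v = v"
  by (simp add: mon_def)

lemma mon_add [simp]: "mon (add_mset i U) v = T i (mon U v)"
proof -
  interpret comp_fun_commute T
    by standard (simp add: fun_eq_iff T_commute)
  show ?thesis by (simp add: mon_def)
qed

lemma mon_union: "mon (U + V) v = mon U (mon V v)"
  by (induction U) simp_all

lemma mon_linear: "Vector_Spaces.linear scale scale (mon U)"
proof (induction U)
  case empty
  show ?case
    unfolding Vector_Spaces.linear_iff using vector_space_axioms by simp
next
  case (add x U)
  have "mon (add_mset x U) = T x \<circ> mon U" by (simp add: fun_eq_iff)
  then show ?case
    using add T_linear by (metis Vector_Spaces.linear_compose)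
qed

lemma stable_mon:
  assumes "stable N" "v \<in> N a b" "set_mset U \<subseteq> {..<n}"
  shows "mon U v \<in> N (a + xdeg \<tau> U) (b + sdeg \<tau> U)"
  using assms(3)
proof (induction U)
  case (add i U)
  then have "mon U v \<in> N (a + xdeg \<tau> U) (b + sdeg \<tau> U)" "i < n" by auto
  then have "T i (mon U v) \<in> N (a + xdeg \<tau> U + of_bool (\<tau> i)) (b + sdeg \<tau> U + of_bool (\<not> \<tau> i))"
    using assms(1) unfolding stable_def by blast
  then show ?case by (auto simp: xdeg_def sdeg_def)
qed (use assms in \<open>auto simp: xdeg_def sdeg_def\<close>)

lemma image_subset_span:
  assumes f: "Vector_Spaces.linear scale scale f" and "f ` S \<subseteq> span R" "v \<in> span S"
  shows "f v \<in> span R"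
proof -
  interpret Vector_Spaces.linear scale scale f by (rule f)
  have "f v \<in> f ` span S" using assms(3) by blast
  also have "\<dots> = span (f ` S)" by (simp add: span_image)
  also have "\<dots> \<subseteq> span R" using assms(2) by (intro span_minimal) auto
  finally show ?thesis .
qed

end

text \<open>Pairs (U, j) stand for the elements T^U g_j. Their lexicographic well-order is compatible with
  the operators, so the Groebner basis arguments apply to modules without a basis.\<close>
locale monomials = operators scale T \<tau> n
  for scale :: "'a::field \<Rightarrow> 'v::ab_group_add \<Rightarrow> 'v" and T \<tau> n +
  fixes g :: "nat \<Rightarrow> 'v" and ga gb :: "nat \<Rightarrow> nat" and r :: nat
begin

definition idx :: "nat \<Rightarrow> nat \<Rightarrow> (nat multiset \<times> nat) set" where
  "idx a b = {(U, j). set_mset U \<subseteq> {..<n} \<and> j < r \<and> ga j + xdeg \<tau> U = a \<and> gb j + sdeg \<tau> U = b}"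

definition val :: "nat multiset \<times> nat \<Rightarrow> 'v" where
  "val e = mon (fst e) (g (snd e))"

definition gens :: "('v \<times> nat \<times> nat) set" where
  "gens = (\<lambda>j. (g j, ga j, gb j)) ` {..<r}"

lemma finite_idx: "finite (idx a b)"
proof (rule finite_subset)
  let ?S = "\<lambda>j. {U. set_mset U \<subseteq> {..<n} \<and> xdeg \<tau> U = a - ga j \<and> sdeg \<tau> U = b - gb j}"
  show "idx a b \<subseteq> (\<Union>j<r. ?S j \<times> {j})" by (auto simp: idx_def)
  show "finite (\<Union>j<r. ?S j \<times> {j})"
    by (intro finite_UN_I finite_cartesian_product finite_multisets_of_degree) auto
qed

lemma idx_add:
  assumes "(U, j) \<in> idx a b" "i < n"
  shows "(add_mset i U, j) \<in> idx (a + of_bool (\<tau> i)) (b + of_bool (\<not> \<tau> i))"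
  using assms by (auto simp: idx_def xdeg_def sdeg_def)

lemma val_add: "val (add_mset i U, j) = T i (val (U, j))"
  by (simp add: val_def)

lemma stable_span:
  assumes N2: "stable N2"
  shows "stable (\<lambda>a b. span (N2 a b \<union> val ` idx a b))"
  unfolding stable_def subspaces_def
proof (intro conjI allI impI ballI)
  fix i a b v assume i: "i < n" and v: "v \<in> span (N2 a b \<union> val ` idx a b)"
  show "T i v \<in> span (N2 (a + of_bool (\<tau> i)) (b + of_bool (\<not> \<tau> i)) \<union> val ` idx (a + of_bool (\<tau> i)) (b + of_bool (\<not> \<tau> i)))"
  proof (rule image_subset_span[OF T_linear _ v])
    have "T i v \<in> N2 (a + of_bool (\<tau> i)) (b + of_bool (\<not> \<tau> i))" if "v \<in> N2 a b" for v
      using N2 i that unfolding stable_def by blast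
    moreover have "T i (val e) \<in> val ` idx (a + of_bool (\<tau> i)) (b + of_bool (\<not> \<tau> i))" if "e \<in> idx a b" for e
      using idx_add[of "fst e" "snd e" a b i] that i val_add[of i "fst e" "snd e"] by (metis imageI prod.collapse)
    ultimately show "T i ` (N2 a b \<union> val ` idx a b) \<subseteq>
        span (N2 (a + of_bool (\<tau> i)) (b + of_bool (\<not> \<tau> i)) \<union> val ` idx (a + of_bool (\<tau> i)) (b + of_bool (\<not> \<tau> i)))"
      by (auto intro!: span_base)
  qed
qed auto

lemma val_in_stable:
  assumes "stable W" "contains W gens" "e \<in> idx a b"
  shows "val e \<in> W a b"
proof -
  obtain U j where e: "e = (U, j)" by (cases e)
  have "g j \<in> W (ga j) (gb j)"
    using assms(2,3) by (auto simp: e idx_def contains_def gens_def)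
  then show ?thesis
    using stable_mon[OF assms(1), of "g j" "ga j" "gb j" U] assms(3) by (auto simp: e idx_def val_def)
qed

lemma contains_span: "contains (\<lambda>a b. span (N2 a b \<union> val ` idx a b)) gens"
proof -
  have "g j \<in> val ` idx (ga j) (gb j)" if "j < r" for j
    using that by (intro image_eqI[of _ _ "({#}, j)"]) (auto simp: val_def idx_def xdeg_def sdeg_def)
  then show ?thesis by (auto simp: contains_def gens_def intro!: span_base)
qed

lemma generated_eq_span:
  assumes "stable N1" "stable N2" "generated gens N1 N2"
  shows "N1 a b = span (N2 a b \<union> val ` idx a b)"
proof
  have sub: "N2 a b \<subseteq> N1 a b" and cont: "contains N1 gens"
    using generated_supset[OF assms(3)] generated_contains[OF assms(3)] by auto
  show "N1 a b \<subseteq> span (N2 a b \<union> val ` idx a b)"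
    by (rule generated_leastD[OF assms(3) stable_span[OF assms(2)] contains_span])
       (auto intro: span_base)
  have "val ` idx a b \<subseteq> N1 a b"
    using val_in_stable[OF assms(1) cont] by blast
  then show "span (N2 a b \<union> val ` idx a b) \<subseteq> N1 a b"
    using sub assms(1) by (intro span_minimal) (auto simp: stable_def subspaces_def)
qed

definition below :: "nat \<Rightarrow> nat \<Rightarrow> nat multiset \<times> nat \<Rightarrow> 'v set" where
  "below a b e = val ` {e'\<in>idx a b. e' < e}"

text \<open>Adding i to both multisets preserves the strict order of pairs, so T_i maps combinations
  of smaller monomials to combinations of smaller monomials.\<close>

lemma T_below:
  assumes "i < n" "v \<in> span (S \<union> below a b (U, j))" "T i ` S \<subseteq> S'"
  shows "T i v \<in> span (S' \<union> below (a + of_bool (\<tau> i)) (b + of_bool (\<not> \<tau> i)) (add_mset i U, j))"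
proof (rule image_subset_span[OF T_linear _ assms(2)])
  have "T i (val e) \<in> below (a + of_bool (\<tau> i)) (b + of_bool (\<not> \<tau> i)) (add_mset i U, j)"
    if "e \<in> idx a b" "e < (U, j)" for e
  proof -
    obtain V k where e: "e = (V, k)" by (cases e)
    have "(add_mset i V, k) < (add_mset i U, j)"
      using that(2) by (auto simp: e less_prod_def' less_le_not_le)
    then show ?thesis
      using idx_add[of V k a b i] that(1) assms(1) unfolding below_def e
      by (intro image_eqI[of _ _ "(add_mset i V, k)"]) (auto simp: val_add)
  qed
  then show "T i ` (S \<union> below a b (U, j)) \<subseteq> span (S' \<union> below (a + of_bool (\<tau> i)) (b + of_bool (\<not> \<tau> i)) (add_mset i U, j))"
    using assms(3) by (auto simp: below_def[of a b] intro!: span_base)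
qed

text \<open>Macaulay's standard monomials at the generator g_j: those T^U g_j that do not reduce to
  smaller pairs modulo N2.\<close>

definition standard :: "'v family \<Rightarrow> nat \<Rightarrow> nat multiset set" where
  "standard N2 j = {U. set_mset U \<subseteq> {..<n} \<and>
     val (U, j) \<notin> span (N2 (ga j + xdeg \<tau> U) (gb j + sdeg \<tau> U) \<union> below (ga j + xdeg \<tau> U) (gb j + sdeg \<tau> U) (U, j))}"

text \<open>Applying T_i to a reduction of T^U g_j gives a reduction of T_i T^U g_j, so the
  monomials that are not standard are closed under multiplication.\<close>

lemma standard_down_closed:
  assumes "stable N2"
  shows "down_closed {..<n} (standard N2 j)"
proof -
  have *: "U \<in> standard N2 j" if "U + V \<in> standard N2 j" for U V
    using that
  proof (induction V)
    case (add i V)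
    have "U + V \<in> standard N2 j"
    proof (rule ccontr)
      assume "U + V \<notin> standard N2 j"
      moreover have i: "i < n" and "set_mset (U + V) \<subseteq> {..<n}"
        using add.prems by (auto simp: standard_def)
      ultimately have "val (U + V, j) \<in> span (N2 (ga j + xdeg \<tau> (U + V)) (gb j + sdeg \<tau> (U + V)) \<union>
          below (ga j + xdeg \<tau> (U + V)) (gb j + sdeg \<tau> (U + V)) (U + V, j))"
        by (auto simp: standard_def)
      then have "T i (val (U + V, j)) \<in> span (N2 (ga j + xdeg \<tau> (U + V) + of_bool (\<tau> i)) (gb j + sdeg \<tau> (U + V) + of_bool (\<not> \<tau> i)) \<union>
          below (ga j + xdeg \<tau> (U + V) + of_bool (\<tau> i)) (gb j + sdeg \<tau> (U + V) + of_bool (\<not> \<tau> i)) (add_mset i (U + V), j))"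
        by (rule T_below[OF i]) (use assms i in \<open>auto simp: stable_def\<close>)
      moreover have "xdeg \<tau> (add_mset i W) = xdeg \<tau> W + of_bool (\<tau> i)"
        "sdeg \<tau> (add_mset i W) = sdeg \<tau> W + of_bool (\<not> \<tau> i)" for W
        by (auto simp: xdeg_def sdeg_def)
      ultimately have "add_mset i (U + V) \<notin> standard N2 j"
        unfolding standard_def by (simp add: val_add[symmetric] add.assoc)
      then show False using add.prems by simp
    qed
    then show ?case by (rule add.IH)
  qed simp
  then show ?thesis
    unfolding down_closed_def by (metis (no_types, lifting) mem_Collect_eq standard_def subset_mset.add_diff_inverse)
qed

text \<open>Adjoin the monomials of bidegree (a, b) to N2 in increasing order: the span grows, by
  one dimension, exactly at the standard ones.\<close>

lemma dim_standard:
  assumes "findim (N2 a b)" "subspace (N2 a b)"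
  shows "dim (span (N2 a b \<union> val ` idx a b)) = dim (N2 a b) + (\<Sum>j<r. card {U\<in>standard N2 j. xdeg \<tau> U + ga j = a \<and> sdeg \<tau> U + gb j = b})"
proof -
  define St where "St = {(U, j)\<in>idx a b. U \<in> standard N2 j}"
  \<comment> \<open>The induction runs over initial segments \<open>E\<close>, so that the pairs
    below a newly added maximum are precisely the earlier ones.\<close>
  have main: "E \<subseteq> idx a b \<Longrightarrow> (\<And>e e'. e \<in> E \<Longrightarrow> e' \<in> idx a b \<Longrightarrow> e' < e \<Longrightarrow> e' \<in> E) \<Longrightarrow>
     dim (span (N2 a b \<union> val ` E)) = dim (N2 a b) + card (E \<inter> St)" if "finite E" for E
    using that
  proof (induction E rule: finite_linorder_max_induct)
    case empty
    then show ?case by simp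
  next
    case (insert e E)
    have E: "{e'\<in>idx a b. e' < e} = E"
    proof (intro set_eqI iffI)
      fix e' assume "e' \<in> {e'\<in>idx a b. e' < e}"
      then show "e' \<in> E" using insert.prems(2)[of e e'] by auto
    next
      fix e' assume "e' \<in> E"
      then show "e' \<in> {e'\<in>idx a b. e' < e}" using insert.prems(1) insert.hyps(2) by auto
    qed
    have IH: "dim (span (N2 a b \<union> val ` E)) = dim (N2 a b) + card (E \<inter> St)"
    proof (rule insert.IH)
      show "E \<subseteq> idx a b" using insert.prems(1) by auto
      fix x y assume "x \<in> E" "y \<in> idx a b" "y < x"
      then show "y \<in> E"
        using insert.hyps(2) E by (metis (no_types, lifting) less_trans mem_Collect_eq)
    qed
    obtain U j where e: "e = (U, j)" by (cases e)
    have eid: "(U, j) \<in> idx a b" using insert.prems e by auto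
    have st: "e \<in> St \<longleftrightarrow> val e \<notin> span (N2 a b \<union> val ` E)"
      using eid unfolding St_def standard_def below_def E[symmetric] e
      by (auto simp: idx_def)
    have fd: "findim (N2 a b \<union> val ` E)"
    proof -
      obtain B where B: "finite B" "N2 a b \<subseteq> span B" using assms(1) by (auto simp: findim_def)
      have "span B \<subseteq> span (B \<union> val ` E)" by (rule span_mono) simp
      moreover have "val ` E \<subseteq> span (B \<union> val ` E)" by (auto intro: span_base)
      ultimately have "N2 a b \<union> val ` E \<subseteq> span (B \<union> val ` E)" using B(2) by blast
      moreover have "finite (B \<union> val ` E)" using insert.hyps(1) B(1) by simp
      ultimately show ?thesis unfolding findim_def by (intro exI[of _ "B \<union> val ` E"] conjI)
    qed
    have "dim (span (insert (val e) (N2 a b \<union> val ` E))) =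
       (if e \<in> St then Suc (dim (span (N2 a b \<union> val ` E))) else dim (span (N2 a b \<union> val ` E)))"
      using dim_span_insert[OF fd, of "val e"] st by simp
    moreover have "card (insert e E \<inter> St) = (if e \<in> St then Suc (card (E \<inter> St)) else card (E \<inter> St))"
      using insert.hyps by (auto simp: Int_insert_left)
    ultimately show ?case using IH by simp
  qed
  have "dim (span (N2 a b \<union> val ` idx a b)) = dim (N2 a b) + card (idx a b \<inter> St)"
    by (rule main[OF finite_idx]) auto
  moreover have "idx a b \<inter> St = (\<Union>j<r. (\<lambda>U. (U, j)) ` {U\<in>standard N2 j. xdeg \<tau> U + ga j = a \<and> sdeg \<tau> U + gb j = b})"
    by (auto simp: St_def idx_def standard_def)
  moreover have "card (\<Union>j<r. (\<lambda>U. (U, j)) ` {U\<in>standard N2 j. xdeg \<tau> U + ga j = a \<and> sdeg \<tau> U + gb j = b}) =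
     (\<Sum>j<r. card ((\<lambda>U. (U, j)) ` {U\<in>standard N2 j. xdeg \<tau> U + ga j = a \<and> sdeg \<tau> U + gb j = b}))"
  proof (rule card_UN_disjoint)
    show "\<forall>j\<in>{..<r}. finite ((\<lambda>U. (U, j)) ` {U\<in>standard N2 j. xdeg \<tau> U + ga j = a \<and> sdeg \<tau> U + gb j = b})"
    proof
      fix j assume "j \<in> {..<r}"
      then have "(\<lambda>U. (U, j)) ` {U\<in>standard N2 j. xdeg \<tau> U + ga j = a \<and> sdeg \<tau> U + gb j = b} \<subseteq> idx a b"
        by (auto simp: idx_def standard_def)
      then show "finite ((\<lambda>U. (U, j)) ` {U\<in>standard N2 j. xdeg \<tau> U + ga j = a \<and> sdeg \<tau> U + gb j = b})"
        by (rule finite_subset[OF _ finite_idx])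
    qed
  qed auto
  ultimately show ?thesis
    by (simp add: card_image inj_on_def)
qed

text \<open>The dimension of N1 / N2 counts standard monomials, which form one order ideal for each
  generator; the bidegree of g_j only shifts its series.\<close>

lemma hilbert_rational_monomials:
  assumes "stable N1" "stable N2" "generated gens N1 N2" "\<And>a b. findim (N1 a b)"
  shows "bipoly ((\<Prod>i<n. 1 - zvar \<tau> i) * (hseries (\<lambda>a b. int (dim (N1 a b))) - hseries (\<lambda>a b. int (dim (N2 a b)))))"
proof -
  have fd2: "findim (N2 a b)" for a b
    using findim_subset[OF assms(4) generated_supset[OF assms(3)]] .
  have sub2: "subspace (N2 a b)" for a b
    using assms(2) by (auto simp: stable_def subspaces_def)
  define c where "c j a b = int (card {U\<in>standard N2 j. xdeg \<tau> U + ga j = a \<and> sdeg \<tau> U + gb j = b})" for j a b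
  have dim: "int (dim (N1 a b)) = int (dim (N2 a b)) + (\<Sum>j<r. c j a b)" for a b
    using dim_standard[of N2 a b, OF fd2 sub2] generated_eq_span[OF assms(1-3), of a b] by (simp add: c_def)
  have sh: "hseries (c j) = fps_const fps_X ^ ga j * fps_X ^ gb j * count_series \<tau> (standard N2 j)" for j
  proof -
    have "c j a b = (if a < ga j \<or> b < gb j then 0 else int (card {U\<in>standard N2 j. xdeg \<tau> U = a - ga j \<and> sdeg \<tau> U = b - gb j}))" for a b
    proof (cases "a < ga j \<or> b < gb j")
      case True
      then have "{U\<in>standard N2 j. xdeg \<tau> U + ga j = a \<and> sdeg \<tau> U + gb j = b} = {}" by auto
      then show ?thesis using True unfolding c_def by (simp del: Collect_empty_eq)
    next
      case False
      then have "{U\<in>standard N2 j. xdeg \<tau> U + ga j = a \<and> sdeg \<tau> U + gb j = b} =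
         {U\<in>standard N2 j. xdeg \<tau> U = a - ga j \<and> sdeg \<tau> U = b - gb j}" by auto
      then show ?thesis using False unfolding c_def by simp
    qed
    moreover have "fps_const fps_X ^ ga j * fps_X ^ gb j * hseries f =
      hseries (\<lambda>a b. if a < ga j \<or> b < gb j then 0 else f (a - ga j) (b - gb j))" for f
      by (auto simp: fps_eq_iff fps_const_power mult.assoc fps_X_power_mult_nth)
    ultimately show ?thesis unfolding count_series_def
      by (auto intro!: arg_cong[where f = hseries])
  qed
  have "hseries (\<lambda>a b. int (dim (N1 a b))) - hseries (\<lambda>a b. int (dim (N2 a b))) = (\<Sum>j<r. hseries (c j))"
    by (simp add: hseries_diff[symmetric] hseries_sum[symmetric] dim)
  then have "(\<Prod>i<n. 1 - zvar \<tau> i) * (hseries (\<lambda>a b. int (dim (N1 a b))) - hseries (\<lambda>a b. int (dim (N2 a b)))) =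
    (\<Sum>j<r. fps_const fps_X ^ ga j * fps_X ^ gb j * ((\<Prod>i<n. 1 - zvar \<tau> i) * count_series \<tau> (standard N2 j)))"
    by (simp add: sh sum_distrib_left mult_ac)
  moreover have "bipoly (\<Sum>j<r. fps_const fps_X ^ ga j * fps_X ^ gb j * ((\<Prod>i<n. 1 - zvar \<tau> i) * count_series \<tau> (standard N2 j)))"
    by (intro bipoly_sum bipoly_mult[OF bipoly_mult[OF bipoly_power[OF bipoly_const_X] bipoly_power[OF bipoly_X]]]
        count_series_rational[OF finite_lessThan standard_down_closed[OF assms(2)]])
  ultimately show ?thesis by simp
qed

lemma mon_below:
  assumes "v \<in> span (below a b (V, j))" "set_mset R \<subseteq> {..<n}"
  shows "mon R v \<in> span (below (a + xdeg \<tau> R) (b + sdeg \<tau> R) (V + R, j))"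
  using assms(2)
proof (induction R)
  case (add i R)
  then have i: "i < n" and "mon R v \<in> span ({} \<union> below (a + xdeg \<tau> R) (b + sdeg \<tau> R) (V + R, j))" by auto
  from T_below[OF this(1,2), of "{}"] show ?case
    by (auto simp: xdeg_def sdeg_def)
qed (use assms in \<open>auto simp: xdeg_def sdeg_def\<close>)

text \<open>Hilbert's basis theorem through leading monomials. For each j the leading monomials of
  elements of P have a finite Dickson basis. Elements of P realising these finitely many leading
  pairs generate P, because subtracting a monomial multiple of one of them lowers the leading
  pair.\<close>

lemma noetherian_monomials:
  assumes "stable F" "generated gens F (\<lambda>_ _. {0})" "stable P" "\<And>a b. P a b \<subseteq> F a b"
  shows "\<exists>G'. finite G' \<and> generated G' P (\<lambda>_ _. {0})"
proof -
  \<comment> \<open>The T^U g_j may be linearly dependent, so v has no canonical expansion. A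
    leading pair e of v is one for which v can be written with pairs up to e but not with smaller
    pairs only.\<close>
  define lead where "lead e a b v \<longleftrightarrow> e \<in> idx a b \<and> v \<in> P a b \<and>
    v \<in> span (insert (val e) (below a b e)) \<and> v \<notin> span (below a b e)" for e a b v
  define L where "L j = {U. \<exists>a b v. lead (U, j) a b v}" for j
  have "\<exists>B. finite B \<and> B \<subseteq> L j \<and> (\<forall>U\<in>L j. \<exists>V\<in>B. V \<subseteq># U)" for j
    by (rule multiset_finite_basis[of "{..<n}"]) (auto simp: L_def lead_def idx_def)
  then obtain B where B: "\<And>j. finite (B j)" "\<And>j. B j \<subseteq> L j" "\<And>j U. U \<in> L j \<Longrightarrow> \<exists>V\<in>B j. V \<subseteq># U"
    by metis
  define E where "E = (\<Union>j<r. (\<lambda>V. (V, j)) ` B j)"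
  have finE: "finite E" unfolding E_def using B(1) by auto
  have "\<forall>e\<in>E. \<exists>t. case t of (v, a, b) \<Rightarrow> lead e a b v"
    using B(2) by (fastforce simp: E_def L_def)
  then obtain t where t: "\<And>e. e \<in> E \<Longrightarrow> case t e of (v, a, b) \<Rightarrow> lead e a b v"
    by metis
  have subP: "subspace (P a b)" for a b
    using assms(3) by (auto simp: stable_def subspaces_def)
  have "generated (t ` E) P (\<lambda>_ _. {0})"
    unfolding generated_def
  proof (intro conjI allI impI)
    show "contains P (t ` E)"
      using t by (fastforce simp: contains_def lead_def)
    show "{0} \<subseteq> P a b" for a b using subspace_0[OF subP] by simp
  next
    fix W a b assume "stable W \<and> contains W (t ` E) \<and> (\<forall>a b. {0} \<subseteq> W a b)"
    then have W: "stable W" "contains W (t ` E)" by auto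
    have subW: "subspace (W a b)" for a b
      using W(1) by (auto simp: stable_def subspaces_def)
    have main: "I \<subseteq> idx a b \<Longrightarrow> (\<And>e e'. e \<in> I \<Longrightarrow> e' \<in> idx a b \<Longrightarrow> e' < e \<Longrightarrow> e' \<in> I) \<Longrightarrow>
        v \<in> P a b \<Longrightarrow> v \<in> span (val ` I) \<Longrightarrow> v \<in> W a b" if "finite I" for I v
      using that
    proof (induction I arbitrary: v rule: finite_linorder_max_induct)
      case empty
      then show ?case using subspace_0[OF subW] by simp
    next
      case (insert e I)
      have bel: "val ` I = below a b e"
      proof -
        have "{e'\<in>idx a b. e' < e} = I"
        proof (intro set_eqI iffI)
          fix e' assume "e' \<in> {e'\<in>idx a b. e' < e}"
          then show "e' \<in> I" using insert.prems(2)[of e e'] by auto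
        next
          fix e' assume "e' \<in> I"
          then show "e' \<in> {e'\<in>idx a b. e' < e}" using insert.prems(1) insert.hyps(2) by auto
        qed
        then show ?thesis by (simp add: below_def)
      qed
      have IH: "u \<in> W a b" if "u \<in> P a b" "u \<in> span (val ` I)" for u
      proof (rule insert.IH[OF _ _ that])
        show "I \<subseteq> idx a b" using insert.prems(1) by auto
        fix x y assume xy: "x \<in> I" "y \<in> idx a b" "y < x"
        then have "y < e" using insert.hyps(2) by (auto dest: less_trans)
        then show "y \<in> I" using insert.prems(2)[of e y] xy(2) by auto
      qed
      show ?case
      proof (cases "v \<in> span (val ` I)")
        case True
        then show ?thesis using IH insert.prems(3) by blast
      next
        case False
        obtain U j where e: "e = (U, j)" by (cases e)
        have v: "v \<in> span (insert (val e) (below a b e))" using insert.prems(4) bel by simp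
        have "lead (U, j) a b v"
          using insert.prems False v unfolding lead_def bel e by simp
        then have UL: "U \<in> L j" and eid: "(U, j) \<in> idx a b" by (auto simp: L_def lead_def)
        obtain V where V: "V \<in> B j" "V \<subseteq># U" using B(3)[OF UL] by blast
        define R where "R = U - V"
        have U: "U = V + R" using V(2) by (simp add: R_def)
        have VE: "(V, j) \<in> E" using V(1) eid by (auto simp: E_def idx_def)
        obtain w a' b' where w: "t (V, j) = (w, a', b')" by (cases "t (V, j)")
        have lw: "lead (V, j) a' b' w" using t[OF VE] w by simp
        have ab: "a = a' + xdeg \<tau> R" "b = b' + sdeg \<tau> R" and R: "set_mset R \<subseteq> {..<n}"
          using lw eid unfolding lead_def idx_def U by (auto simp: xdeg_def sdeg_def)
        have "w \<in> W a' b'" using W(2) VE w unfolding contains_def by fastforce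
        then have wW: "mon R w \<in> W a b" using stable_mon[OF W(1) _ R] ab by simp
        have wP: "mon R w \<in> P a b" using stable_mon[OF assms(3) _ R] lw ab by (simp add: lead_def)
        obtain c where c: "w - scale c (val (V, j)) \<in> span (below a' b' (V, j))"
          using lw unfolding lead_def span_insert by blast
        have "c \<noteq> 0" using c lw unfolding lead_def by auto
        obtain d where d: "v - scale d (val e) \<in> span (below a b e)"
          using v unfolding span_insert by blast
        interpret mR: Vector_Spaces.linear scale scale "mon R" by (rule mon_linear)
        have "mon R (w - scale c (val (V, j))) \<in> span (below a b e)"
          using mon_below[OF c R] ab unfolding e U by simp
        moreover have "mon R (val (V, j)) = val e"
          unfolding val_def e U by (simp add: mon_union[symmetric] add.commute)
        ultimately have m: "mon R w - scale c (val e) \<in> span (below a b e)"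
          by (simp add: mR.diff mR.scale)
        \<comment> \<open>Here c and d are the coefficients of the leading pair in w and v, so d / c
          times T^R w cancels the leading term of v.\<close>
        have "scale (d / c) (mon R w - scale c (val e)) \<in> span (below a b e)"
          using m by (rule span_scale)
        then have "scale (d / c) (mon R w) - scale d (val e) \<in> span (below a b e)"
          using \<open>c \<noteq> 0\<close> by (simp add: scale_right_diff_distrib)
        with d have "(v - scale d (val e)) - (scale (d / c) (mon R w) - scale d (val e)) \<in> span (below a b e)"
          by (rule span_diff)
        then have "v - scale (d / c) (mon R w) \<in> span (val ` I)"
          by (simp add: bel)
        moreover have "v - scale (d / c) (mon R w) \<in> P a b"
          using insert.prems(3) wP subP by (intro subspace_diff subspace_scale)
        ultimately have "v - scale (d / c) (mon R w) \<in> W a b" by (rule IH[rotated])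
        then have "(v - scale (d / c) (mon R w)) + scale (d / c) (mon R w) \<in> W a b"
          using wW subW by (intro subspace_add subspace_scale)
        then show ?thesis by simp
      qed
    qed
    show "P a b \<subseteq> W a b"
    proof
      fix v assume v: "v \<in> P a b"
      then have "v \<in> F a b" using assms(4) by blast
      also have "F a b = span ({0} \<union> val ` idx a b)"
        by (rule generated_eq_span[OF assms(1) stable_zero assms(2)])
      finally have sp: "v \<in> span (val ` idx a b)" by simp
      show "v \<in> W a b" by (rule main[OF finite_idx order_refl _ v sp])
    qed
  qed
  then show ?thesis using finE by blast
qed

end

context operators begin

lemma finite_enumerate_gens:
  assumes "finite (G :: ('v \<times> nat \<times> nat) set)"
  obtains g ga gb and r :: nat where "G = (\<lambda>j. (g j, ga j, gb j)) ` {..<r}"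
proof -
  obtain f and r :: nat where f: "G = f ` {i. i < r}"
    using finite_imp_nat_seg_image_inj_on[OF assms] by metis
  have "G = (\<lambda>j. (fst (f j), fst (snd (f j)), snd (snd (f j)))) ` {..<r}"
    using f by (simp add: lessThan_def)
  then show ?thesis by (rule that)
qed

lemma hilbert_rational:
  assumes "finite G" "stable N1" "stable N2" "generated G N1 N2" "\<And>a b. findim (N1 a b)"
  shows "bipoly ((\<Prod>i<n. 1 - zvar \<tau> i) * (hseries (\<lambda>a b. int (dim (N1 a b))) - hseries (\<lambda>a b. int (dim (N2 a b)))))"
proof -
  obtain g ga gb and r :: nat where G: "G = (\<lambda>j. (g j, ga j, gb j)) ` {..<r}"
    using finite_enumerate_gens[OF assms(1)] by blast
  interpret monomials scale T \<tau> n g ga gb r by unfold_locales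
  show ?thesis
    by (rule hilbert_rational_monomials) (use assms G in \<open>auto simp: gens_def\<close>)
qed

lemma noetherian:
  assumes "finite G" "stable F" "generated G F (\<lambda>_ _. {0})" "stable P" "\<And>a b. P a b \<subseteq> F a b"
  shows "\<exists>G'. finite G' \<and> generated G' P (\<lambda>_ _. {0})"
proof -
  obtain g ga gb and r :: nat where G: "G = (\<lambda>j. (g j, ga j, gb j)) ` {..<r}"
    using finite_enumerate_gens[OF assms(1)] by blast
  interpret monomials scale T \<tau> n g ga gb r by unfold_locales
  show ?thesis
    by (rule noetherian_monomials[of F]) (use assms G in \<open>auto simp: gens_def\<close>)
qed

lemma generated_findim:
  assumes "finite G" "stable F" "generated G F (\<lambda>_ _. {0})"
  shows "findim (F a b)"
proof -
  obtain g ga gb and r :: nat where G: "G = (\<lambda>j. (g j, ga j, gb j)) ` {..<r}"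
    using finite_enumerate_gens[OF assms(1)] by blast
  interpret monomials scale T \<tau> n g ga gb r by unfold_locales
  have "F a b = span ({0} \<union> val ` idx a b)"
    by (intro generated_eq_span) (use assms G stable_zero in \<open>auto simp: gens_def\<close>)
  then show ?thesis
    unfolding findim_def using finite_idx[of a b] by (intro exI[of _ "{0} \<union> val ` idx a b"] conjI) auto
qed

end

section \<open>Devissage along an arrangement\<close>

locale bigraded = kspace scale
  for scale :: "'a::field \<Rightarrow> 'v::ab_group_add \<Rightarrow> 'v" +
  fixes X Y :: "nat \<Rightarrow> 'v \<Rightarrow> 'v" and l :: nat
  assumes X_linear: "Vector_Spaces.linear scale scale (X i)"
    and Y_linear: "Vector_Spaces.linear scale scale (Y i)"
    and XX_commute: "X i (X j v) = X j (X i v)"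
    and YY_commute: "Y i (Y j v) = Y j (Y i v)"
    and XY_commute: "X i (Y j v) = Y j (X i v)"
begin

sublocale full: operators scale "\<lambda>i. if i < l then X i else Y (i - l)" "\<lambda>i. i < l" "2 * l"
  by (intro operators.intro operators_axioms.intro kspace_axioms) (auto simp: X_linear Y_linear XX_commute YY_commute XY_commute)

lemma full_stable_iff:
  "full.stable N \<longleftrightarrow> full.subspaces N \<and> (\<forall>i<l. \<forall>a b. \<forall>v\<in>N a b. X i v \<in> N (Suc a) b \<and> Y i v \<in> N a (Suc b))"
proof -
  have "(\<forall>i<2 * l. P i) \<longleftrightarrow> (\<forall>i<l. P i \<and> P (l + i))" for P
  proof (intro iffI allI impI)
    fix i assume A: "\<forall>i<l. P i \<and> P (l + i)" "i < 2 * l"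
    show "P i"
    proof (cases "i < l")
      case False
      then have "i - l < l" "l + (i - l) = i" using A(2) by auto
      then show ?thesis using A(1) by metis
    qed (use A in auto)
  qed auto
  then show ?thesis unfolding full.stable_def by auto
qed

text \<open>The action of the linear form with coefficient vector f through the x-variables.
  Likewise \<open>Yf u\<close> is the action of a vector u, read as a linear form in the dual
  variables xi.\<close>

definition Xf :: "(nat \<Rightarrow> 'a) \<Rightarrow> 'v \<Rightarrow> 'v" where
  "Xf f v = (\<Sum>i<l. scale (f i) (X i v))"

definition Yf :: "(nat \<Rightarrow> 'a) \<Rightarrow> 'v \<Rightarrow> 'v" where
  "Yf f v = (\<Sum>i<l. scale (f i) (Y i v))"

lemma linear_add: "Vector_Spaces.linear scale scale f \<Longrightarrow> f (v + w) = f v + f w"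
  and linear_scale: "Vector_Spaces.linear scale scale f \<Longrightarrow> f (scale c v) = scale c (f v)"
  by (auto simp: Vector_Spaces.linear_iff)

lemma linear_sum: "Vector_Spaces.linear scale scale f \<Longrightarrow> f (\<Sum>i\<in>I. g i) = (\<Sum>i\<in>I. f (g i))"
  by (metis module_hom.sum module_hom_iff_linear)

lemma linearI: "(\<And>v w. f (v + w) = f v + f w) \<Longrightarrow> (\<And>c v. f (scale c v) = scale c (f v)) \<Longrightarrow> Vector_Spaces.linear scale scale f"
  by (auto simp: Vector_Spaces.linear_iff vector_space_axioms)

lemma Xf_linear: "Vector_Spaces.linear scale scale (Xf f)"
  by (rule linearI)
     (auto simp: Xf_def linear_add[OF X_linear] linear_scale[OF X_linear] scale_right_distrib sum.distrib
        scale_sum_right mult.commute)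

lemma Yf_linear: "Vector_Spaces.linear scale scale (Yf f)"
  by (rule linearI)
     (auto simp: Yf_def linear_add[OF Y_linear] linear_scale[OF Y_linear] scale_right_distrib sum.distrib
        scale_sum_right mult.commute)

lemma Xf_Xf_commute: "Xf f (Xf g v) = Xf g (Xf f v)"
  unfolding Xf_def
  by (simp add: linear_sum[OF X_linear] linear_scale[OF X_linear] scale_sum_right)
     (subst sum.swap, simp add: XX_commute mult.commute)

lemma Yf_Yf_commute: "Yf f (Yf g v) = Yf g (Yf f v)"
  unfolding Yf_def
  by (simp add: linear_sum[OF Y_linear] linear_scale[OF Y_linear] scale_sum_right)
     (subst sum.swap, simp add: YY_commute mult.commute)

lemma Xf_Yf_commute: "Xf f (Yf g v) = Yf g (Xf f v)"
  unfolding Xf_def Yf_def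
  by (simp add: linear_sum[OF X_linear] linear_sum[OF Y_linear] linear_scale[OF X_linear] linear_scale[OF Y_linear] scale_sum_right)
     (subst sum.swap, simp add: XY_commute mult.commute)

lemma stable_subspace: "full.stable N \<Longrightarrow> subspace (N a b)"
  by (auto simp: full.stable_def full.subspaces_def)

lemma stable_Xf: "full.stable N \<Longrightarrow> v \<in> N a b \<Longrightarrow> Xf f v \<in> N (Suc a) b"
  unfolding Xf_def by (intro subspace_sum subspace_scale stable_subspace) (auto simp: full_stable_iff)

lemma stable_Yf: "full.stable N \<Longrightarrow> v \<in> N a b \<Longrightarrow> Yf f v \<in> N a (Suc b)"
  unfolding Yf_def by (intro subspace_sum subspace_scale stable_subspace) (auto simp: full_stable_iff)

lemma stableI_forms:
  assumes "full.subspaces N" "\<And>i a b v. i < l \<Longrightarrow> v \<in> N a b \<Longrightarrow> X i v \<in> N (Suc a) b"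
    "\<And>i a b v. i < l \<Longrightarrow> v \<in> N a b \<Longrightarrow> Y i v \<in> N a (Suc b)"
  shows "full.stable N"
  using assms by (auto simp: full_stable_iff)

text \<open>The completeness relation of dual bases f_i of the linear forms and u_i of the vectors.\<close>
definition dual :: "(nat \<Rightarrow> nat \<Rightarrow> 'a) \<Rightarrow> (nat \<Rightarrow> nat \<Rightarrow> 'a) \<Rightarrow> bool" where
  "dual f u \<longleftrightarrow> (\<forall>a<l. \<forall>b<l. (\<Sum>i<l. u i a * f i b) = of_bool (a = b))"

lemma dual_X: 
  assumes "dual f u" "a < l"
  shows "X a v = (\<Sum>i<l. scale (u i a) (Xf (f i) v))"
proof -
  have "(\<Sum>i<l. scale (u i a) (Xf (f i) v)) = (\<Sum>b<l. scale (\<Sum>i<l. u i a * f i b) (X b v))"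
    unfolding Xf_def scale_sum_left scale_sum_right by (subst sum.swap) simp
  also have "\<dots> = (\<Sum>b<l. if b = a then X b v else 0)"
    using assms by (intro sum.cong) (auto simp: dual_def)
  finally show ?thesis using assms(2) by simp
qed

lemma dual_Y: 
  assumes "dual f u" "a < l"
  shows "Y a v = (\<Sum>i<l. scale (f i a) (Yf (u i) v))"
proof -
  have "(\<Sum>i<l. scale (f i a) (Yf (u i) v)) = (\<Sum>b<l. scale (\<Sum>i<l. u i b * f i a) (Y b v))"
    unfolding Yf_def scale_sum_left scale_sum_right by (subst sum.swap) (simp add: mult.commute)
  also have "\<dots> = (\<Sum>b<l. if b = a then Y b v else 0)"
    using assms by (intro sum.cong) (auto simp: dual_def)
  finally show ?thesis using assms(2) by simp
qed

text \<open>Steinitz exchange in dual bases. As \<alpha> takes the place of f_j, the vector u_j is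
  rescaled to have \<alpha>(u_j) = 1, and every other u_i is moved along u_j until \<alpha> vanishes
  on it. The check rests on the expansion of \<alpha> as the sum of the \<alpha>(u_i) f_i.\<close>

lemma dual_exchange:
  assumes d: "dual f u" and j: "j < l" and c: "c = (\<Sum>i<l. \<alpha> i * u j i)" "c \<noteq> 0"
  shows "dual (f(j := \<alpha>)) (\<lambda>i a. if i = j then u j a / c else u i a - (\<Sum>k<l. \<alpha> k * u i k) / c * u j a)"
  unfolding dual_def
proof (intro allI impI)
  fix a b assume ab: "a < l" "b < l"
  let ?p = "\<lambda>i. \<Sum>k<l. \<alpha> k * u i k"
  let ?S = "{..<l} - {j}"
  have alpha: "\<alpha> b = (\<Sum>i<l. ?p i * f i b)"
  proof -
    have "(\<Sum>i<l. ?p i * f i b) = (\<Sum>k<l. \<alpha> k * (\<Sum>i<l. u i k * f i b))"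
      unfolding sum_distrib_left sum_distrib_right by (subst sum.swap) (simp add: mult.assoc)
    also have "\<dots> = (\<Sum>k<l. if k = b then \<alpha> k else 0)"
      using d ab by (intro sum.cong) (auto simp: dual_def)
    finally show ?thesis using ab by simp
  qed
  have split: "(\<Sum>i<l. g i) = g j + (\<Sum>i\<in>?S. g i)" for g :: "nat \<Rightarrow> 'a"
    using j by (simp add: sum.remove)
  have "(\<Sum>i<l. (if i = j then u j a / c else u i a - ?p i / c * u j a) * (f(j := \<alpha>)) i b) =
     u j a / c * \<alpha> b + (\<Sum>i\<in>?S. (u i a - ?p i / c * u j a) * f i b)"
    by (subst split) (auto intro!: arg_cong2[where f = "(+)"] sum.cong)
  also have "\<dots> = u j a / c * (\<alpha> b - (\<Sum>i\<in>?S. ?p i * f i b)) + (\<Sum>i\<in>?S. u i a * f i b)"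
    by (simp add: algebra_simps sum_subtractf sum_distrib_left sum_divide_distrib)
  also have "\<alpha> b - (\<Sum>i\<in>?S. ?p i * f i b) = c * f j b"
    using alpha split[of "\<lambda>i. ?p i * f i b"] by (simp add: c(1))
  also have "u j a / c * (c * f j b) + (\<Sum>i\<in>?S. u i a * f i b) = (\<Sum>i<l. u i a * f i b)"
    using c(2) by (subst split) simp
  also have "\<dots> = of_bool (a = b)" using d ab by (simp add: dual_def)
  finally show "(\<Sum>i<l. (if i = j then u j a / c else u i a - ?p i / c * u j a) * (f(j := \<alpha>)) i b) = of_bool (a = b)" .
qed

abbreviation hs :: "'v family \<Rightarrow> int fps fps" where
  "hs N \<equiv> hseries (\<lambda>a b. int (dim (N a b)))"

lemma linear_span_into:
  assumes "Vector_Spaces.linear scale scale f" "subspace S" "\<And>w. w \<in> R \<Longrightarrow> f w \<in> S" "v \<in> span R"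
  shows "f v \<in> S"
  using full.image_subset_span[OF assms(1), of R S v] assms(2,3,4) by (auto simp: span_eq_iff[THEN iffD2] span_base)

text \<open>If the f_i with i in I and the u_i with i outside I act as zero on N1 / N2, then one
  form survives for each index: l - card I of them in x and card I in s. The rationality theorem for
  these l operators yields l denominators instead of 2 l.\<close>

lemma hilbert_killed:
  assumes G: "finite G" "full.generated G N1 N2" "full.stable N1" "full.stable N2" "\<And>a b. findim (N1 a b)"
    and I: "I \<subseteq> {..<l}" and d: "dual f u"
    and kf: "\<And>i a b v. i \<in> I \<Longrightarrow> v \<in> N1 a b \<Longrightarrow> Xf (f i) v \<in> N2 (Suc a) b"
    and ku: "\<And>i a b v. i < l \<Longrightarrow> i \<notin> I \<Longrightarrow> v \<in> N1 a b \<Longrightarrow> Yf (u i) v \<in> N2 a (Suc b)"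
  shows "mixed_rational l (hs N1 - hs N2)"
proof -
  interpret op: operators scale "\<lambda>i. if i \<in> I then Yf (u i) else Xf (f i)" "\<lambda>i. i \<notin> I" l
    by (intro operators.intro operators_axioms.intro kspace_axioms) (auto simp: Xf_linear Yf_linear Xf_Xf_commute Yf_Yf_commute Xf_Yf_commute)
  have st: "op.stable N" if "full.stable N" for N
    unfolding op.stable_def using stable_Xf[OF that] stable_Yf[OF that] that
    by (auto simp: full.stable_def full.subspaces_def op.subspaces_def)
  have sub: "N2 a b \<subseteq> N1 a b" for a b by (rule full.generated_supset[OF G(2)])
  have "op.generated G N1 N2"
    unfolding op.generated_def
  proof (intro conjI allI impI)
    show "op.contains N1 G"
      using full.generated_contains[OF G(2)] by (simp add: op.contains_def full.contains_def)
    show "N2 a b \<subseteq> N1 a b" for a b by (rule sub)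
    fix W a b assume W: "op.stable W \<and> op.contains W G \<and> (\<forall>a b. N2 a b \<subseteq> W a b)"
    \<comment> \<open>\<open>W\<close> is closed only under the surviving forms. The killed forms
      send N1 into N2, which lies in \<open>W\<close>, so the intersection with N1 is stable under
      all 2 l operators.\<close>
    define W' where "W' a b = W a b \<inter> N1 a b" for a b
    have subW: "subspace (W a b)" for a b
      using W by (auto simp: op.stable_def op.subspaces_def)
    have Xw: "Xf (f i) v \<in> W (Suc a) b" if "i < l" "v \<in> W' a b" for i v a b
    proof (cases "i \<in> I")
      case False
      then show ?thesis using W that unfolding op.stable_def W'_def by fastforce
    next
      case True
      then have "Xf (f i) v \<in> N2 (Suc a) b" using kf that(2) by (auto simp: W'_def)
      then show ?thesis using W by blast
    qed
    have Yw: "Yf (u i) v \<in> W a (Suc b)" if "i < l" "v \<in> W' a b" for i v a b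
    proof (cases "i \<in> I")
      case True
      then show ?thesis using W that unfolding op.stable_def W'_def by fastforce
    next
      case False
      then have "Yf (u i) v \<in> N2 a (Suc b)" using ku that by (auto simp: W'_def)
      then show ?thesis using W by blast
    qed
    have "full.stable W'"
    proof (rule stableI_forms)
      show "full.subspaces W'"
        using subW stable_subspace[OF G(3)] by (auto simp: full.subspaces_def W'_def subspace_inter)
      fix i a b v assume i: "i < l" and v: "v \<in> W' a b"
      have "X i v \<in> W (Suc a) b"
        unfolding dual_X[OF d i] using Xw[OF _ v] by (intro subspace_sum subspace_scale subW) auto
      then show "X i v \<in> W' (Suc a) b"
        using G(3) i v by (auto simp: W'_def full_stable_iff)
      have "Y i v \<in> W a (Suc b)"
        unfolding dual_Y[OF d i] using Yw[OF _ v] by (intro subspace_sum subspace_scale subW) auto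
      then show "Y i v \<in> W' a (Suc b)"
        using G(3) i v by (auto simp: W'_def full_stable_iff)
    qed
    moreover have "full.contains W' G"
      using full.generated_contains[OF G(2)] W by (fastforce simp: op.contains_def full.contains_def W'_def)
    ultimately have "N1 a b \<subseteq> W' a b"
      by (rule full.generated_leastD[OF G(2)]) (use W sub in \<open>auto simp: W'_def\<close>)
    then show "N1 a b \<subseteq> W a b" by (auto simp: W'_def)
  qed
  then have "bipoly ((\<Prod>i<l. 1 - zvar (\<lambda>i. i \<notin> I) i) * (hs N1 - hs N2))"
    using op.hilbert_rational[OF G(1) st[OF G(3)] st[OF G(4)] _ G(5)] by simp
  moreover have "(\<Prod>i<l. 1 - zvar (\<lambda>i. i \<notin> I) i) = fps_const (1 - fps_X) ^ (l - card I) * (1 - fps_X) ^ card I"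
  proof -
    have "(\<Prod>i<l. 1 - zvar (\<lambda>i. i \<notin> I) i) = (\<Prod>i\<in>{..<l} - I. 1 - zvar (\<lambda>i. i \<notin> I) i) * (\<Prod>i\<in>I. 1 - zvar (\<lambda>i. i \<notin> I) i)"
      using I by (simp add: prod.subset_diff)
    also have "(\<Prod>i\<in>I. 1 - zvar (\<lambda>i. i \<notin> I) i) = (\<Prod>i\<in>I. 1 - fps_X)"
      by (intro prod.cong) (auto simp: zvar_def)
    also have "(\<Prod>i\<in>{..<l} - I. 1 - zvar (\<lambda>i. i \<notin> I) i) = (\<Prod>i\<in>{..<l} - I. fps_const (1 - fps_X))"
      by (intro prod.cong) (auto simp: zvar_def fps_eq_iff)
    finally show ?thesis using I by (simp add: card_Diff_subset finite_subset)
  qed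
  moreover have "card I \<le> l" using card_mono[of "{..<l}" I] I by simp
  ultimately show ?thesis
    by (intro mixed_rationalI[of "l - card I"]) auto
qed

end

section \<open>Modules annihilated by the symbols of logarithmic fields\<close>

locale arrangement_operators = bigraded scale X Y l
  for scale :: "'a::field \<Rightarrow> 'v::ab_group_add \<Rightarrow> 'v" and X Y l +
  fixes A :: "'h set" and \<alpha> :: "'h \<Rightarrow> nat \<Rightarrow> 'a" and m :: "'h \<Rightarrow> nat"
  assumes finite_A: "finite A"
begin

definition Xl :: "'h list \<Rightarrow> 'v \<Rightarrow> 'v" where
  "Xl Hs v = fold (\<lambda>H. Xf (\<alpha> H)) Hs v"

text \<open>The product of the forms in Hs times the derivation along u is logarithmic.\<close>
definition admissible :: "'h list \<Rightarrow> (nat \<Rightarrow> 'a) \<Rightarrow> bool" where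
  "admissible Hs u \<longleftrightarrow> set Hs \<subseteq> A \<and> (\<forall>H\<in>A. (\<Sum>i<l. \<alpha> H i * u i) \<noteq> 0 \<longrightarrow> m H \<le> count (mset Hs) H)"

text \<open>The elements Q(x) u(xi) annihilate N1 / N2 whenever Q d/du is logarithmic. This is the
  support condition in a form that passes to submodules and quotients.\<close>

definition killed :: "'v family \<Rightarrow> 'v family \<Rightarrow> bool" where
  "killed N1 N2 \<longleftrightarrow> (\<forall>u Hs. admissible Hs u \<longrightarrow>
     (\<forall>a b. \<forall>v\<in>N1 a b. Xl Hs (Yf u v) \<in> N2 (a + length Hs) (Suc b)))"

lemma Xl_simps [simp]: "Xl [] v = v" "Xl (H # Hs) v = Xl Hs (Xf (\<alpha> H) v)"
  by (simp_all add: Xl_def)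

lemma Xl_linear: "Vector_Spaces.linear scale scale (Xl Hs)"
proof (induction Hs)
  case Nil
  show ?case by (rule linearI) simp_all
next
  case (Cons H Hs)
  show ?case
    by (rule linearI) (simp_all add: linear_add[OF Xf_linear] linear_scale[OF Xf_linear] linear_add[OF Cons] linear_scale[OF Cons])
qed

lemma stable_Xl: "full.stable N \<Longrightarrow> v \<in> N a b \<Longrightarrow> Xl Hs v \<in> N (a + length Hs) b"
proof (induction Hs arbitrary: v a)
  case (Cons H Hs)
  have "Xl Hs (Xf (\<alpha> H) v) \<in> N (Suc a + length Hs) b"
    by (rule Cons.IH) (auto intro: stable_Xf Cons.prems)
  then show ?case by simp
qed simp

text \<open>The submodule f N1 + N2. In x-degree 0 the product contributes nothing, and the case
  distinction keeps the truncated \<open>a - 1\<close> from pointing to degree 0 again.\<close>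

definition image_family :: "(nat \<Rightarrow> 'a) \<Rightarrow> 'v family \<Rightarrow> 'v family \<Rightarrow> 'v family" where
  "image_family f N1 N2 a b = span (N2 a b \<union> (if a = 0 then {} else Xf f ` N1 (a - 1) b))"

lemma image_family_sup: "N2 a b \<subseteq> image_family f N1 N2 a b"
  by (auto simp: image_family_def intro: span_base)

lemma image_family_Xf: "v \<in> N1 a b \<Longrightarrow> Xf f v \<in> image_family f N1 N2 (Suc a) b"
  by (auto simp: image_family_def intro: span_base)

lemma image_family_induct:
  assumes "Vector_Spaces.linear scale scale g" "subspace S" "v \<in> image_family f N1 N2 a b"
    "\<And>w. w \<in> N2 a b \<Longrightarrow> g w \<in> S" "\<And>w a'. a = Suc a' \<Longrightarrow> w \<in> N1 a' b \<Longrightarrow> g (Xf f w) \<in> S"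
  shows "g v \<in> S"
  using assms(3) unfolding image_family_def
  by (rule linear_span_into[OF assms(1,2), rotated]) (use assms(4,5) in \<open>cases a; auto\<close>)

lemma image_family_least:
  assumes "full.stable W" "\<And>a b. N2 a b \<subseteq> W a b" "\<And>a b v. v \<in> N1 a b \<Longrightarrow> Xf f v \<in> W (Suc a) b"
  shows "image_family f N1 N2 a b \<subseteq> W a b"
proof
  fix v assume "v \<in> image_family f N1 N2 a b"
  then have "id v \<in> W a b"
    by (rule image_family_induct[rotated 2]) (use assms in \<open>auto intro!: linearI stable_subspace\<close>)
  then show "v \<in> W a b" by simp
qed

lemma image_family_stable:
  assumes "full.stable N1" "full.stable N2"
  shows "full.stable (image_family f N1 N2)"
proof (rule stableI_forms)
  show "full.subspaces (image_family f N1 N2)" by (simp add: full.subspaces_def image_family_def)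
  have sub: "subspace (image_family f N1 N2 a b)" for a b by (simp add: image_family_def)
  have XXf: "X i (Xf f w) = Xf f (X i w)" "Y i (Xf f w) = Xf f (Y i w)" for i w
    by (simp_all add: Xf_def linear_sum[OF X_linear] linear_sum[OF Y_linear] linear_scale[OF X_linear] linear_scale[OF Y_linear]
        XX_commute XY_commute)
  fix i a b v assume i: "i < l" and v: "v \<in> image_family f N1 N2 a b"
  show "X i v \<in> image_family f N1 N2 (Suc a) b"
  proof (rule image_family_induct[OF X_linear sub v])
    show "X i w \<in> image_family f N1 N2 (Suc a) b" if "w \<in> N2 a b" for w
      by (rule subsetD[OF image_family_sup]) (use assms(2) that i in \<open>auto simp: full_stable_iff\<close>)
    show "X i (Xf f w) \<in> image_family f N1 N2 (Suc a) b" if "a = Suc a'" "w \<in> N1 a' b" for w a'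
      unfolding XXf that(1) using assms(1) i that by (intro image_family_Xf) (auto simp: full_stable_iff)
  qed
  show "Y i v \<in> image_family f N1 N2 a (Suc b)"
  proof (rule image_family_induct[OF Y_linear sub v])
    show "Y i w \<in> image_family f N1 N2 a (Suc b)" if "w \<in> N2 a b" for w
      by (rule subsetD[OF image_family_sup]) (use assms(2) that i in \<open>auto simp: full_stable_iff\<close>)
    show "Y i (Xf f w) \<in> image_family f N1 N2 a (Suc b)" if "a = Suc a'" "w \<in> N1 a' b" for w a'
      unfolding XXf that(1) using assms(1) i that by (intro image_family_Xf) (auto simp: full_stable_iff)
  qed
qed

text \<open>Minimality is pulled back along f: the v with f v in W form a submodule that contains N2
  and the generators G, hence all of N1.\<close>

lemma image_family_generated:
  assumes "full.stable N1" "full.stable N2" "full.generated G N1 N2"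
  shows "full.generated ((\<lambda>(g, a, b). (Xf f g, Suc a, b)) ` G) (image_family f N1 N2) N2"
  unfolding full.generated_def
proof (intro conjI allI impI)
  show "full.contains (image_family f N1 N2) ((\<lambda>(g, a, b). (Xf f g, Suc a, b)) ` G)"
    using full.generated_contains[OF assms(3)] by (auto simp: full.contains_def intro!: image_family_Xf)
  show "N2 a b \<subseteq> image_family f N1 N2 a b" for a b by (rule image_family_sup)
  fix W a b
  assume "full.stable W \<and> full.contains W ((\<lambda>(g, a, b). (Xf f g, Suc a, b)) ` G) \<and> (\<forall>a b. N2 a b \<subseteq> W a b)"
  then have W: "full.stable W" "full.contains W ((\<lambda>(g, a, b). (Xf f g, Suc a, b)) ` G)" "\<And>a b. N2 a b \<subseteq> W a b"
    by auto
  define V where "V a b = {v. Xf f v \<in> W (Suc a) b}" for a b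
  have XXf: "Xf f (X i w) = X i (Xf f w)" "Xf f (Y i w) = Y i (Xf f w)" for i w
    by (simp_all add: Xf_def linear_sum[OF X_linear] linear_sum[OF Y_linear] linear_scale[OF X_linear] linear_scale[OF Y_linear]
        XX_commute XY_commute)
  have zero: "Xf f 0 = 0" using linear_scale[OF Xf_linear, of f 0 0] by simp
  have "full.stable V"
    unfolding full_stable_iff full.subspaces_def
    using W(1) stable_subspace[OF W(1)]
    by (auto simp: V_def XXf full_stable_iff subspace_def linear_add[OF Xf_linear] linear_scale[OF Xf_linear] zero)
  moreover have "full.contains V G"
    using W(2) by (auto simp: full.contains_def V_def)
  moreover have "N2 a b \<subseteq> V a b" for a b
    using stable_Xf[OF assms(2)] W(3) unfolding V_def by blast
  ultimately have "N1 a b \<subseteq> V a b" for a b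
    by (rule full.generated_leastD[OF assms(3)])
  then have "Xf f v \<in> W (Suc a) b" if "v \<in> N1 a b" for v a b
    using that by (auto simp: V_def)
  then show "image_family f N1 N2 a b \<subseteq> W a b"
    by (rule image_family_least[OF W(1,3)])
qed

text \<open>Devissage: multiplying by one linear form after the other, each quotient is killed by one more
  x-form, and the last submodule is killed by the s-forms complementary to the x-forms killing it.\<close>
lemma mixed_rational_killed:
  assumes "finite G" "full.generated G N1 N2" "full.stable N1" "full.stable N2" "\<And>a b. findim (N1 a b)"
    and "I \<subseteq> {..<l}" "dual f u"
    and "\<And>i a b v. i \<in> I \<Longrightarrow> v \<in> N1 a b \<Longrightarrow> Xf (f i) v \<in> N2 (Suc a) b"
    and "killed N1 N2"
  shows "mixed_rational l (hs N1 - hs N2)"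
  using assms
proof (induction "card ({..<l} - I)" arbitrary: G I f u N1 N2 rule: less_induct)
  case less
  note outer = less.hyps
  have I: "I \<subseteq> {..<l}" and d: "dual f u" by fact+
  \<comment> \<open>The hyperplanes whose form is not a combination of the f_i with i in I: the
    coefficient of f_j in a form is its value at u_j.\<close>
  define B where "B = {H\<in>A. \<exists>j<l. j \<notin> I \<and> (\<Sum>i<l. \<alpha> H i * u j i) \<noteq> 0}"
  \<comment> \<open>Induction on a list of forms whose product with each remaining u_j kills N1 /
    N2. For the empty list the u_j themselves kill it, and \<open>hilbert_killed\<close>
    applies.\<close>
  have inner: "mixed_rational l (hs N1 - hs N2)"
    if "set Hs \<subseteq> B" "finite G" "full.generated G N1 N2" "full.stable N1" "full.stable N2" "\<And>a b. findim (N1 a b)"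
      "\<And>i a b v. i \<in> I \<Longrightarrow> v \<in> N1 a b \<Longrightarrow> Xf (f i) v \<in> N2 (Suc a) b" "killed N1 N2"
      "\<And>j a b v. j < l \<Longrightarrow> j \<notin> I \<Longrightarrow> v \<in> N1 a b \<Longrightarrow> Xl Hs (Yf (u j) v) \<in> N2 (a + length Hs) (Suc b)"
    for Hs G N1 and N2 :: "'v family"
    using that
  proof (induction Hs arbitrary: G N1)
    case Nil
    show ?case
      by (rule hilbert_killed[OF Nil(2-6) I d Nil(7)]) (use Nil(9) in auto)
  next
    case (Cons H Hs)
    note G = Cons.prems(2-6) and kf = Cons.prems(7) and kill = Cons.prems(8) and kl = Cons.prems(9)
    obtain j where j: "j < l" "j \<notin> I" "(\<Sum>i<l. \<alpha> H i * u j i) \<noteq> 0"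
      using Cons.prems(1) by (auto simp: B_def)
    define N' where "N' = image_family (\<alpha> H) N1 N2"
    have stN': "full.stable N'" unfolding N'_def by (rule image_family_stable) fact+
    have sup: "N2 a b \<subseteq> N' a b" for a b unfolding N'_def by (rule image_family_sup)
    have sub2: "N2 a b \<subseteq> N1 a b" for a b by (rule full.generated_supset[OF G(2)])
    have sub: "N' a b \<subseteq> N1 a b" for a b
      unfolding N'_def by (rule image_family_least[OF G(3) sub2 stable_Xf[OF G(3)]])
    have gen': "full.generated ((\<lambda>(g, a, b). (Xf (\<alpha> H) g, Suc a, b)) ` G) N' N2"
      unfolding N'_def by (rule image_family_generated) fact+
    have "mixed_rational l (hs N' - hs N2)"
    proof (rule Cons.IH[OF _ _ gen' stN' G(4)])
      show "set Hs \<subseteq> B" "finite ((\<lambda>(g, a, b). (Xf (\<alpha> H) g, Suc a, b)) ` G)"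
        using Cons.prems(1) G(1) by auto
      show "findim (N' a b)" for a b using findim_subset[OF G(5) sub] .
      show "Xf (f i) v \<in> N2 (Suc a) b" if "i \<in> I" "v \<in> N' a b" for i a b v
        using kf that sub by blast
      show "killed N' N2" using kill sub unfolding killed_def by blast
      fix i a b v assume i: "i < l" "i \<notin> I" and v: "v \<in> N' a b"
      have lin: "Vector_Spaces.linear scale scale (\<lambda>v. Xl Hs (Yf (u i) v))"
        by (rule linearI) (simp_all add: linear_add[OF Yf_linear] linear_scale[OF Yf_linear] linear_add[OF Xl_linear] linear_scale[OF Xl_linear])
      show "Xl Hs (Yf (u i) v) \<in> N2 (a + length Hs) (Suc b)"
      proof (rule image_family_induct[OF lin stable_subspace[OF G(4)] v[unfolded N'_def]])
        show "Xl Hs (Yf (u i) w) \<in> N2 (a + length Hs) (Suc b)" if "w \<in> N2 a b" for w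
          by (intro stable_Xl stable_Yf G(4) that)
        show "Xl Hs (Yf (u i) (Xf (\<alpha> H) w)) \<in> N2 (a + length Hs) (Suc b)" if "a = Suc a'" "w \<in> N1 a' b" for w a'
          using kl[OF i that(2)] by (simp add: that(1) Xf_Yf_commute)
      qed
    qed
    \<comment> \<open>The form of H now kills N1 / N' too. Exchanging it for f_j enlarges I and so
      decreases the outer measure.\<close>
    moreover have "mixed_rational l (hs N1 - hs N')"
    proof (rule outer[OF _ G(1) _ G(3) stN' G(5)])
      show "card ({..<l} - insert j I) < card ({..<l} - I)"
        using j by (intro psubset_card_mono) auto
      show "insert j I \<subseteq> {..<l}" using I j by auto
      show "dual (f(j := \<alpha> H)) (\<lambda>i a. if i = j then u j a / (\<Sum>i<l. \<alpha> H i * u j i) else u i a - (\<Sum>k<l. \<alpha> H k * u i k) / (\<Sum>i<l. \<alpha> H i * u j i) * u j a)"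
        by (rule dual_exchange[OF d j(1) refl j(3)])
      show "full.generated G N1 N'"
        unfolding full.generated_def
      proof (intro conjI allI impI)
        show "full.contains N1 G" by (rule full.generated_contains[OF G(2)])
        show "N' a b \<subseteq> N1 a b" for a b by (rule sub)
        fix W a b assume "full.stable W \<and> full.contains W G \<and> (\<forall>a b. N' a b \<subseteq> W a b)"
        then have "full.stable W" "full.contains W G" "\<And>a b. N2 a b \<subseteq> W a b" using sup by blast+
        then show "N1 a b \<subseteq> W a b" by (rule full.generated_leastD[OF G(2)])
      qed
      show "killed N1 N'" using kill sup unfolding killed_def by blast
      show "Xf ((f(j := \<alpha> H)) i) v \<in> N' (Suc a) b" if "i \<in> insert j I" "v \<in> N1 a b" for i a b v
      proof (cases "i = j")
        case True
        then show ?thesis using that(2) unfolding N'_def by (auto intro: image_family_Xf)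
      next
        case False
        then show ?thesis using kf[of i v a b] that sup by auto
      qed
    qed
    ultimately have "mixed_rational l ((hs N1 - hs N') + (hs N' - hs N2))"
      by (intro mixed_rational_add)
    then show ?case by simp
  qed
  have "finite B" using finite_A by (simp add: B_def)
  then obtain Bs where Bs: "set Bs = B" using finite_list by blast
  \<comment> \<open>The product over \<open>B\<close> of the forms with their multiplicities. A
    hyperplane outside \<open>B\<close> has a form vanishing at every u_j with j outside I, so this
    product times d/du_j is logarithmic for all these j.\<close>
  define Hs where "Hs = concat (map (\<lambda>H. replicate (m H) H) Bs)"
  have Hs: "set Hs \<subseteq> B" using Bs by (auto simp: Hs_def)
  have cnt: "m H \<le> count (mset Hs) H" if "H \<in> B" for H
  proof -
    have "H \<in> set Bs \<Longrightarrow> m H \<le> count (mset (concat (map (\<lambda>H. replicate (m H) H) Bs))) H"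
      by (induction Bs) (auto simp: trans_le_add2)
    then show ?thesis using that Bs by (simp add: Hs_def)
  qed
  show ?case
  proof (rule inner[OF Hs less.prems(1-5) less.prems(8,9)])
    fix j a b v assume j: "j < l" "j \<notin> I" and v: "v \<in> N1 a b"
    have "admissible Hs (u j)"
      unfolding admissible_def using Hs cnt j by (auto simp: B_def)
    then show "Xl Hs (Yf (u j) v) \<in> N2 (a + length Hs) (Suc b)"
      using less.prems(9) v unfolding killed_def by blast
  qed
qed

end

section \<open>Polynomials in several variables\<close>

lemma poly_mapping_sum_singles: "f = (\<Sum>k\<in>Poly_Mapping.keys f. Poly_Mapping.single k (Poly_Mapping.lookup f k))"
proof (rule poly_mapping_eqI)
  fix k
  show "Poly_Mapping.lookup f k = Poly_Mapping.lookup (\<Sum>k\<in>Poly_Mapping.keys f. Poly_Mapping.single k (Poly_Mapping.lookup f k)) k"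
    by (simp add: lookup_sum lookup_single when_def in_keys_iff)
qed

lemma poly_mapping_single_induct [case_names single add]:
  assumes "\<And>k c. P (Poly_Mapping.single k c)" "\<And>f g. P f \<Longrightarrow> P g \<Longrightarrow> P (f + g)"
  shows "P (f :: 'a \<Rightarrow>\<^sub>0 'b::comm_monoid_add)"
proof -
  have "finite K \<Longrightarrow> P (\<Sum>k\<in>K. Poly_Mapping.single k (Poly_Mapping.lookup f k))" for K
  proof (induction K rule: finite_induct)
    case empty
    show ?case using assms(1)[of undefined 0] by simp
  qed (auto intro: assms)
  then show ?thesis using poly_mapping_sum_singles[of f] by (metis finite_keys)
qed

lemma const_0 [simp]: "const 0 = 0" by (simp add: const_def)
lemma const_1 [simp]: "const 1 = 1" by (simp add: const_def)
lemma const_add: "const (a + b) = const a + const b" by (simp add: const_def single_add)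
lemma const_mult: "const (a * b) = const a * const (b :: 'a::comm_semiring_1)" by (simp add: const_def mult_single)
lemma const_uminus: "const (- a) = - const (a :: 'a::ab_group_add)" by (simp add: const_def single_uminus)
lemma const_eq_0_iff [simp]: "const c = 0 \<longleftrightarrow> c = 0"
  by (metis const_def lookup_single_eq lookup_zero single_zero)

lemma keys_plus_nat: "Poly_Mapping.keys (m + n :: 'a \<Rightarrow>\<^sub>0 nat) = Poly_Mapping.keys m \<union> Poly_Mapping.keys n"
  by (auto simp: in_keys_iff lookup_add)

lemma mdeg_eq_sum: "finite I \<Longrightarrow> Poly_Mapping.keys m \<subseteq> I \<Longrightarrow> mdeg m = (\<Sum>i\<in>I. Poly_Mapping.lookup m i)"
  unfolding mdeg_def by (rule sum.mono_neutral_left) (auto simp: in_keys_iff)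

lemma mdeg_add: "mdeg (m + n) = mdeg m + mdeg n"
  using mdeg_eq_sum[of "Poly_Mapping.keys m \<union> Poly_Mapping.keys n"]
  by (simp add: keys_plus_nat lookup_add sum.distrib)

lemma mdeg_0 [simp]: "mdeg 0 = 0" by (simp add: mdeg_def)
lemma mdeg_single [simp]: "mdeg (Poly_Mapping.single i k) = k" by (simp add: mdeg_def)

lemma mdeg_nonzeroD:
  assumes "mdeg m \<noteq> 0"
  obtains i where "i \<in> Poly_Mapping.keys m"
proof -
  have "Poly_Mapping.keys m \<noteq> {}" using assms by (auto simp: mdeg_def)
  then show ?thesis using that by blast
qed

lemma exponent_split:
  assumes "i \<in> Poly_Mapping.keys m"
  obtains m' where "m = Poly_Mapping.single i (1::nat) + m'"
proof
  show "m = Poly_Mapping.single i 1 + (m - Poly_Mapping.single i 1)"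
  proof (rule poly_mapping_eqI)
    fix k
    show "Poly_Mapping.lookup m k = Poly_Mapping.lookup (Poly_Mapping.single i 1 + (m - Poly_Mapping.single i 1)) k"
      using assms by (cases "k = i") (simp_all add: lookup_add lookup_minus lookup_single in_keys_iff)
  qed
qed

lemma Svars_0 [simp]: "0 \<in> Svars l" by (simp add: Svars_def)

lemma Svars_const [simp]: "const c \<in> Svars l" by (auto simp: Svars_def const_def)

lemma Svars_1 [simp]: "1 \<in> Svars l" by (metis Svars_const const_1)

lemma Svars_var: "i < l \<Longrightarrow> var i \<in> Svars l" by (auto simp: Svars_def var_def split: if_splits)

lemma Svars_var_iff: "(var i :: 'k::zero_neq_one mpoly) \<in> Svars l \<longleftrightarrow> i < l"
  by (auto simp: Svars_def var_def)

lemma Svars_add: "f \<in> Svars l \<Longrightarrow> g \<in> Svars l \<Longrightarrow> f + g \<in> Svars l"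
  unfolding Svars_def using keys_add[of f g] by blast

lemma Svars_mult: "f \<in> Svars l \<Longrightarrow> g \<in> Svars l \<Longrightarrow> f * g \<in> Svars l"
  unfolding Svars_def using keys_mult[of f g] by (fastforce simp: keys_plus_nat)

lemma Svars_uminus: "f \<in> Svars l \<Longrightarrow> - (f :: 'k::ab_group_add mpoly) \<in> Svars l"
  by (auto simp: Svars_def in_keys_iff)

lemma Svars_diff: "f \<in> Svars l \<Longrightarrow> g \<in> Svars l \<Longrightarrow> f - (g :: 'k::ab_group_add mpoly) \<in> Svars l"
  using Svars_add[of f l "- g"] Svars_uminus[of g l] by simp

lemma Svars_sum: "(\<And>i. i \<in> I \<Longrightarrow> f i \<in> Svars l) \<Longrightarrow> sum f I \<in> Svars l"
  by (induction I rule: infinite_finite_induct) (auto intro: Svars_add)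

lemma Svars_power: "f \<in> Svars l \<Longrightarrow> f ^ n \<in> Svars l"
  by (induction n) (auto intro: Svars_mult)

lemma homog_0 [simp]: "homog d 0" by (simp add: homog_def)

lemma homog_add: "homog d f \<Longrightarrow> homog d g \<Longrightarrow> homog d (f + g)"
  unfolding homog_def using keys_add[of f g] by blast

lemma homog_mult: "homog d f \<Longrightarrow> homog e g \<Longrightarrow> homog (d + e) (f * g)"
  unfolding homog_def using keys_mult[of f g] by (fastforce simp: mdeg_add)

lemma homog_const [simp]: "homog 0 (const c)" by (auto simp: homog_def const_def)

lemma homog_const_mult: "homog d f \<Longrightarrow> homog d (const c * f)"
  using homog_mult[OF homog_const, of d f c] by simp

lemma homog_var [simp]: "homog 1 (var i)" by (auto simp: homog_def var_def)

lemma homog_uminus: "homog d f \<Longrightarrow> homog d (- f :: 'k::ab_group_add mpoly)"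
  by (auto simp: homog_def in_keys_iff)

lemma homog_diff: "homog d f \<Longrightarrow> homog d g \<Longrightarrow> homog d (f - g :: 'k::ab_group_add mpoly)"
  using homog_add[of d f "- g"] homog_uminus[of d g] by simp

lemma homog_sum: "(\<And>i. i \<in> I \<Longrightarrow> homog d (f i)) \<Longrightarrow> homog d (sum f I)"
  by (induction I rule: infinite_finite_induct) (auto intro: homog_add)

lemma homog_power: "homog d f \<Longrightarrow> homog (n * d) (f ^ n)"
proof (induction n)
  case 0
  show ?case by (metis homog_const const_1 mult_0 power_0)
next
  case (Suc n)
  then show ?case using homog_mult[of d f "n * d" "f ^ n"] by simp
qed

lemma single_in_closed:
  assumes "\<And>c. P (const c)" "\<And>f i. P f \<Longrightarrow> f \<in> Svars l \<Longrightarrow> i < l \<Longrightarrow> P (var i * f)"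
    "Poly_Mapping.keys m \<subseteq> {..<l}"
  shows "P (Poly_Mapping.single m (c :: 'k::comm_semiring_1))"
  using assms(3)
proof (induction "mdeg m" arbitrary: m)
  case 0
  then have "m = 0" by (auto simp: mdeg_def poly_mapping_eq_iff fun_eq_iff in_keys_iff)
  then show ?case using assms(1)[of c] by (simp add: const_def)
next
  case (Suc d)
  then obtain i where i: "i \<in> Poly_Mapping.keys m" using mdeg_nonzeroD[of m] by auto
  obtain m' where m: "m = Poly_Mapping.single i 1 + m'" using exponent_split[OF i] .
  have sub: "Poly_Mapping.keys m' \<subseteq> {..<l}" using Suc.prems unfolding m by (simp add: keys_plus_nat)
  have "d = mdeg m'" using Suc.hyps(2) unfolding m by (simp add: mdeg_add)
  then have "P (Poly_Mapping.single m' c)" using Suc.hyps(1) sub by blast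
  moreover have "Poly_Mapping.single m' c \<in> Svars l" using sub by (auto simp: Svars_def)
  ultimately have "P (var i * Poly_Mapping.single m' c)"
    using assms(2) i Suc.prems by auto
  then show ?case by (simp add: m var_def mult_single)
qed

text \<open>Tailored to derivations: the product rule is needed only for multiplication by a single
  variable.\<close>

lemma Svars_induct [consumes 1, case_names const add var]:
  assumes "f \<in> Svars l" "\<And>c. P (const c)"
    "\<And>f g. P f \<Longrightarrow> P g \<Longrightarrow> f \<in> Svars l \<Longrightarrow> g \<in> Svars l \<Longrightarrow> P (f + g)"
    "\<And>f i. P f \<Longrightarrow> f \<in> Svars l \<Longrightarrow> i < l \<Longrightarrow> P (var i * f)"
  shows "P (f :: 'k::comm_semiring_1 mpoly)"
proof -
  have "finite K \<Longrightarrow> K \<subseteq> Poly_Mapping.keys f \<Longrightarrow>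
     P (\<Sum>k\<in>K. Poly_Mapping.single k (Poly_Mapping.lookup f k)) \<and> (\<Sum>k\<in>K. Poly_Mapping.single k (Poly_Mapping.lookup f k)) \<in> Svars l" for K
  proof (induction K rule: finite_induct)
    case empty
    show ?case using assms(2)[of 0] by simp
  next
    case (insert k K)
    have k: "Poly_Mapping.keys k \<subseteq> {..<l}" using insert.prems assms(1) by (auto simp: Svars_def)
    have "P (Poly_Mapping.single k (Poly_Mapping.lookup f k))"
      by (rule single_in_closed[of P l, OF assms(2,4) k])
    moreover have "Poly_Mapping.single k (Poly_Mapping.lookup f k) \<in> Svars l"
      using k by (auto simp: Svars_def)
    ultimately show ?case using insert by (auto intro!: assms(3) Svars_add)
  qed
  then show ?thesis using poly_mapping_sum_singles[of f] by (metis finite_keys order_refl)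
qed

section \<open>Linear forms and their coefficients\<close>

definition lin_coeff :: "'k::zero mpoly \<Rightarrow> nat \<Rightarrow> 'k" where
  "lin_coeff f i = Poly_Mapping.lookup f (Poly_Mapping.single i 1)"

lemma mdeg_1D:
  assumes "mdeg m = 1"
  obtains i where "m = Poly_Mapping.single i 1"
proof -
  obtain i where i: "i \<in> Poly_Mapping.keys m" using mdeg_nonzeroD[of m] assms by auto
  obtain m' where m: "m = Poly_Mapping.single i 1 + m'" using exponent_split[OF i] .
  have "mdeg m' = 0" using assms unfolding m by (simp add: mdeg_add)
  then have "m' = 0" by (auto simp: mdeg_def poly_mapping_eq_iff fun_eq_iff in_keys_iff)
  then show ?thesis using m that by simp
qed

lemma linear_form_expand:
  assumes "linear_form l a"
  shows "a = (\<Sum>i<l. const (lin_coeff a i) * var i)"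
proof (rule poly_mapping_eqI)
  fix k
  have R: "Poly_Mapping.lookup (\<Sum>i<l. const (lin_coeff a i) * var i) k = (\<Sum>i<l. lin_coeff a i when Poly_Mapping.single i 1 = k)"
    by (simp add: lookup_sum const_def var_def mult_single lookup_single)
  show "Poly_Mapping.lookup a k = Poly_Mapping.lookup (\<Sum>i<l. const (lin_coeff a i) * var i) k"
  proof (cases "\<exists>i<l. k = Poly_Mapping.single i 1")
    case True
    then obtain i where i: "i < l" "k = Poly_Mapping.single i 1" by blast
    have inj: "Poly_Mapping.single j (1::nat) = Poly_Mapping.single i 1 \<longleftrightarrow> j = i" for j i :: nat
      by (metis keys_single singleton_inject one_neq_zero)
    show ?thesis using i unfolding R by (simp add: lin_coeff_def inj[simplified] when_def)
  next
    case False
    have "k \<notin> Poly_Mapping.keys a"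
    proof
      assume k: "k \<in> Poly_Mapping.keys a"
      then have "mdeg k = 1" using assms by (auto simp: linear_form_def homog_def)
      then obtain i where i: "k = Poly_Mapping.single i 1" by (rule mdeg_1D)
      moreover have "i < l" using assms k i by (auto simp: linear_form_def Svars_def)
      ultimately show False using False by blast
    qed
    moreover have "(\<Sum>i<l. lin_coeff a i when Poly_Mapping.single i 1 = k) = 0"
      using False by (intro sum.neutral) (auto simp: when_def)
    ultimately show ?thesis unfolding R by (simp add: in_keys_iff)
  qed
qed

lemma linear_form_nonzero_coeff:
  assumes "linear_form l a"
  obtains i where "i < l" "lin_coeff a i \<noteq> 0"
proof -
  have "\<exists>i<l. lin_coeff a i \<noteq> 0"
  proof (rule ccontr)
    assume "\<not> ?thesis"
    then have "(\<Sum>i<l. const (lin_coeff a i) * var i) = 0" by (intro sum.neutral) auto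
    then show False using linear_form_expand[OF assms] assms by (simp add: linear_form_def)
  qed
  then show ?thesis using that by blast
qed

lemma lookup_single_mult:
  "Poly_Mapping.lookup (Poly_Mapping.single k c * f) (k + m) = c * Poly_Mapping.lookup (f :: 'k::comm_semiring_1 mpoly) m"
proof (induction f rule: poly_mapping_single_induct)
  case (single k' c')
  show ?case by (simp add: mult_single lookup_single when_def)
qed (simp add: distrib_left lookup_add)

section \<open>Formal partial derivatives\<close>

definition pd :: "nat \<Rightarrow> 'k::comm_semiring_1 mpoly \<Rightarrow> 'k mpoly" where
  "pd i f = Abs_poly_mapping (\<lambda>m. of_nat (Suc (Poly_Mapping.lookup m i)) * Poly_Mapping.lookup f (m + Poly_Mapping.single i 1))"

lemma lookup_pd:
  "Poly_Mapping.lookup (pd i f) m = of_nat (Suc (Poly_Mapping.lookup m i)) * Poly_Mapping.lookup f (m + Poly_Mapping.single i 1)"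
proof -
  have "finite {m. of_nat (Suc (Poly_Mapping.lookup m i)) * Poly_Mapping.lookup f (m + Poly_Mapping.single i 1) \<noteq> 0}"
  proof (rule finite_subset)
    show "{m. of_nat (Suc (Poly_Mapping.lookup m i)) * Poly_Mapping.lookup f (m + Poly_Mapping.single i 1) \<noteq> 0}
        \<subseteq> (\<lambda>m. m + Poly_Mapping.single i 1) -` Poly_Mapping.keys f"
      by (auto simp: in_keys_iff)
    show "finite ((\<lambda>m. m + Poly_Mapping.single i 1) -` Poly_Mapping.keys f)"
      by (intro finite_vimageI) (auto simp: inj_def)
  qed
  then show ?thesis unfolding pd_def by (subst lookup_Abs_poly_mapping) auto
qed

lemma pd_add: "pd i (f + g) = pd i f + pd i g"
  by (rule poly_mapping_eqI) (simp add: lookup_pd lookup_add distrib_left)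

lemma pd_single: "pd i (Poly_Mapping.single m c) = Poly_Mapping.single (m - Poly_Mapping.single i 1) (of_nat (Poly_Mapping.lookup m i) * c)"
proof (rule poly_mapping_eqI)
  fix k
  show "Poly_Mapping.lookup (pd i (Poly_Mapping.single m c)) k =
     Poly_Mapping.lookup (Poly_Mapping.single (m - Poly_Mapping.single i 1) (of_nat (Poly_Mapping.lookup m i) * c)) k"
  proof (cases "m = k + Poly_Mapping.single i 1")
    case True
    then show ?thesis by (simp add: lookup_pd lookup_single lookup_add)
  next
    case False
    have "m - Poly_Mapping.single i 1 \<noteq> k \<or> Poly_Mapping.lookup m i = 0"
    proof (rule ccontr)
      assume A: "\<not> ?thesis"
      have "m = k + Poly_Mapping.single i 1"
      proof (rule poly_mapping_eqI)
        fix j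
        have "Poly_Mapping.lookup (m - Poly_Mapping.single i 1) j = Poly_Mapping.lookup k j" using A by simp
        then show "Poly_Mapping.lookup m j = Poly_Mapping.lookup (k + Poly_Mapping.single i 1) j"
          using A by (auto simp: lookup_minus lookup_add lookup_single when_def split: if_splits)
      qed
      then show False using False by simp
    qed
    then show ?thesis using False by (auto simp: lookup_pd lookup_single when_def)
  qed
qed

lemma pd_mult: "pd i (f * g) = f * pd i g + g * pd i (f :: 'k::comm_semiring_1 mpoly)"
proof (induction f rule: poly_mapping_single_induct)
  case (single a c)
  show ?case
  proof (induction g rule: poly_mapping_single_induct)
    case (single b d)
    \<comment> \<open>Subtraction of exponents is truncated. When \<open>y\<close> does not involve
      x_i the identity can fail, but then both coefficients in \<open>t\<close> are 0.\<close>
    have e: "x + (y - Poly_Mapping.single i 1) = x + y - Poly_Mapping.single i (1::nat)" if "Poly_Mapping.lookup y i \<noteq> 0" for x y :: "nat \<Rightarrow>\<^sub>0 nat"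
    proof (rule poly_mapping_eqI)
      fix k
      show "Poly_Mapping.lookup (x + (y - Poly_Mapping.single i 1)) k = Poly_Mapping.lookup (x + y - Poly_Mapping.single i 1) k"
        using that by (cases "k = i") (simp_all add: lookup_add lookup_minus lookup_single)
    qed
    have t: "Poly_Mapping.single (x + (y - Poly_Mapping.single i 1)) (c * (of_nat (Poly_Mapping.lookup y i) * d)) =
        Poly_Mapping.single (x + y - Poly_Mapping.single i 1) (of_nat (Poly_Mapping.lookup y i) * (c * d))" for x y :: "nat \<Rightarrow>\<^sub>0 nat" and c d :: 'k
      using e[of y x] by (cases "Poly_Mapping.lookup y i = 0") (auto simp: mult_ac)
    have "pd i (Poly_Mapping.single a c * Poly_Mapping.single b d) =
       Poly_Mapping.single (a + b - Poly_Mapping.single i 1) (of_nat (Poly_Mapping.lookup b i) * (c * d)) +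
       Poly_Mapping.single (b + a - Poly_Mapping.single i 1) (of_nat (Poly_Mapping.lookup a i) * (d * c))"
      by (simp add: mult_single pd_single lookup_add single_add[symmetric] distrib_right distrib_left add_ac mult_ac)
    then show ?case by (simp add: mult_single pd_single t[unfolded One_nat_def])
  qed (simp add: pd_add distrib_left distrib_right add_ac)
qed (simp add: pd_add distrib_left distrib_right add_ac)

lemma pd_const [simp]: "pd i (const c) = 0"
  by (simp add: const_def pd_single)

lemma pd_var: "pd i (var j) = (if i = j then 1 else 0)"
  by (auto simp: var_def pd_single lookup_single when_def)

lemma pd_Svars: "f \<in> Svars l \<Longrightarrow> pd i (f :: 'k::comm_semiring_1 mpoly) \<in> Svars l"
  by (induction f rule: Svars_induct) (auto simp: pd_add pd_mult pd_var intro!: Svars_add Svars_mult Svars_var)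

section \<open>Homogeneous components\<close>

definition hcomp :: "nat \<Rightarrow> 'k::zero mpoly \<Rightarrow> 'k mpoly" where
  "hcomp d f = Abs_poly_mapping (\<lambda>m. if mdeg m = d then Poly_Mapping.lookup f m else 0)"

lemma lookup_hcomp: "Poly_Mapping.lookup (hcomp d f) m = (if mdeg m = d then Poly_Mapping.lookup f m else 0)"
proof -
  have "finite {m. (if mdeg m = d then Poly_Mapping.lookup f m else 0) \<noteq> 0}"
    by (rule finite_subset[OF _ finite_keys[of f]]) (auto simp: in_keys_iff split: if_splits)
  then show ?thesis unfolding hcomp_def by (subst lookup_Abs_poly_mapping) auto
qed

lemma hcomp_add: "hcomp d (f + g) = hcomp d f + hcomp d g"
  by (rule poly_mapping_eqI) (simp add: lookup_hcomp lookup_add)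

lemma hcomp_homog: "homog e f \<Longrightarrow> hcomp d f = (if d = e then f else 0)"
  by (rule poly_mapping_eqI) (auto simp: lookup_hcomp homog_def in_keys_iff)

lemma hcomp_mult:
  assumes "homog e g"
  shows "hcomp (e + d) (g * f) = g * hcomp d (f :: 'k::comm_semiring_1 mpoly)"
proof (induction f rule: poly_mapping_single_induct)
  case (single k c)
  have "homog (mdeg k) (Poly_Mapping.single k c)" by (auto simp: homog_def)
  then show ?case
    using hcomp_homog[OF homog_mult[OF assms], of "mdeg k" "Poly_Mapping.single k c" "e + d"]
      hcomp_homog[of "mdeg k" "Poly_Mapping.single k c" d] by simp
qed (simp add: hcomp_add distrib_left)

text \<open>Multiplication by g is injective and shifts homogeneous components by e, so every
  nonzero component of f sits in degree d - e. The alternative f = 0 is the only one left when d <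
  e.\<close>

lemma homog_cancel:
  assumes "homog e g" "g \<noteq> 0" "homog d (g * f)"
  shows "f = 0 \<or> e \<le> d \<and> homog (d - e) (f :: 'k::field mpoly)"
proof -
  have deg: "e + mdeg k = d" if k: "k \<in> Poly_Mapping.keys f" for k
  proof (rule ccontr)
    assume "e + mdeg k \<noteq> d"
    then have "g * hcomp (mdeg k) f = 0"
      using hcomp_mult[OF assms(1), of "mdeg k" f] hcomp_homog[OF assms(3), of "e + mdeg k"] by simp
    then have "hcomp (mdeg k) f = 0" using assms(2) by simp
    then show False using k lookup_hcomp[of "mdeg k" f k] by (simp add: in_keys_iff)
  qed
  show ?thesis
  proof (cases "f = 0")
    case False
    then obtain k where "k \<in> Poly_Mapping.keys f" by (metis keys_eq_empty ex_in_conv)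
    then show ?thesis using deg by (force simp: homog_def)
  qed simp
qed

text \<open>Divisibility by a linear form with nonzero x_j-coefficient is tested on remainders free of x_j.\<close>
definition free_of :: "nat \<Rightarrow> 'k::zero mpoly \<Rightarrow> bool" where
  "free_of j f \<longleftrightarrow> (\<forall>m\<in>Poly_Mapping.keys f. Poly_Mapping.lookup m j = 0)"

lemma free_of_add: "free_of j f \<Longrightarrow> free_of j g \<Longrightarrow> free_of j (f + g)"
  unfolding free_of_def using keys_add[of f g] by blast

lemma free_of_mult: "free_of j f \<Longrightarrow> free_of j g \<Longrightarrow> free_of j (f * g)"
  unfolding free_of_def using keys_mult[of f g] by (fastforce simp: lookup_add)

lemma free_of_const [simp]: "free_of j (const c)"
  by (auto simp: free_of_def const_def)

lemma free_of_sum: "(\<And>i. i \<in> I \<Longrightarrow> free_of j (f i)) \<Longrightarrow> free_of j (sum f I)"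
  by (induction I rule: infinite_finite_induct) (auto intro: free_of_add simp: free_of_def[of j 0])

lemma free_of_var: "i \<noteq> j \<Longrightarrow> free_of j (var i)"
  by (auto simp: free_of_def var_def lookup_single)

lemma linear_form_split:
  assumes "linear_form l a" "j < l"
  obtains r where "a = const (lin_coeff a j) * var j + r" "free_of j r" "r \<in> Svars l"
proof
  let ?r = "\<Sum>i\<in>{..<l} - {j}. const (lin_coeff a i) * var i"
  show "a = const (lin_coeff a j) * var j + ?r"
    using linear_form_expand[OF assms(1)] assms(2) by (simp add: sum.remove)
  show "free_of j ?r"
    by (intro free_of_sum free_of_mult free_of_const free_of_var) auto
  show "?r \<in> Svars l"
    by (intro Svars_sum Svars_mult Svars_const Svars_var) auto
qed

text \<open>Compare degrees in x_j: if q has degree K, then the x_j-term of a produces a monomial of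
  degree K + 1, which the remaining part r q cannot cancel.\<close>

lemma free_of_linear_multiple:
  assumes a: "linear_form l a" "j < l" "lin_coeff a j \<noteq> 0" and f: "free_of j (a * q)"
  shows "(q :: 'k::field mpoly) = 0"
proof (rule ccontr)
  assume q: "q \<noteq> 0"
  obtain r where r: "a = const (lin_coeff a j) * var j + r" "free_of j r"
    using linear_form_split[OF a(1,2)] by blast
  let ?ex = "\<lambda>m. Poly_Mapping.lookup m j"
  have ne: "Poly_Mapping.keys q \<noteq> {}" using q by simp
  define K where "K = Max (?ex ` Poly_Mapping.keys q)"
  have "K \<in> ?ex ` Poly_Mapping.keys q" unfolding K_def using ne by (intro Max_in) auto
  then obtain m where m: "m \<in> Poly_Mapping.keys q" "?ex m = K" by auto
  have K: "?ex m' \<le> K" if "m' \<in> Poly_Mapping.keys q" for m'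
    unfolding K_def using that by (intro Max_ge) auto
  let ?m = "Poly_Mapping.single j 1 + m"
  have exm: "?ex ?m = Suc K" using m by (simp add: lookup_add)
  have "Poly_Mapping.lookup (r * q) ?m = 0"
  proof (rule ccontr)
    assume "\<not> ?thesis"
    then have "?m \<in> Poly_Mapping.keys (r * q)" by (simp add: in_keys_iff)
    then obtain x y where xy: "x \<in> Poly_Mapping.keys r" "y \<in> Poly_Mapping.keys q" "?m = x + y"
      using keys_mult[of r q] by blast
    have "?ex ?m = ?ex x + ?ex y" unfolding xy(3) by (simp add: lookup_add)
    then show False using xy(1,2) r(2) K[of y] exm by (simp add: free_of_def)
  qed
  moreover have "Poly_Mapping.lookup (const (lin_coeff a j) * var j * q) ?m = lin_coeff a j * Poly_Mapping.lookup q m"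
    by (simp add: const_def var_def mult_single lookup_single_mult)
  moreover have "a * q = const (lin_coeff a j) * var j * q + r * q"
    using r(1) by (metis distrib_right)
  ultimately have "Poly_Mapping.lookup (a * q) ?m = lin_coeff a j * Poly_Mapping.lookup q m"
    by (simp add: lookup_add)
  then have "?m \<in> Poly_Mapping.keys (a * q)" using a(3) m(1) by (simp add: in_keys_iff)
  then have "?ex ?m = 0" using f by (simp add: free_of_def)
  then show False using exm by simp
qed

text \<open>The coefficient of x_j in a is invertible, so x_j is a multiple of a plus a remainder
  free of x_j; this is substituted at each multiplication by x_j.\<close>

lemma linear_form_division:
  assumes a: "linear_form l a" "j < l" "lin_coeff a j \<noteq> 0" and f: "f \<in> Svars l"
  shows "\<exists>q r. f = a * q + r \<and> q \<in> Svars l \<and> free_of j (r :: 'k::field mpoly)"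
  using f
proof (induction f rule: Svars_induct)
  case (const c)
  show ?case by (intro exI[of _ 0] exI[of _ "const c"]) auto
next
  case (add f g)
  then obtain q r q' r' where "f = a * q + r" "q \<in> Svars l" "free_of j r" "g = a * q' + r'" "q' \<in> Svars l" "free_of j r'"
    by blast
  then show ?case
    by (intro exI[of _ "q + q'"] exI[of _ "r + r'"]) (auto simp: algebra_simps intro: Svars_add free_of_add)
next
  case (var f i)
  then obtain q r where qr: "f = a * q + r" "q \<in> Svars l" "free_of j r" by blast
  show ?case
  proof (cases "i = j")
    case False
    then show ?thesis using qr var(3)
      by (intro exI[of _ "var i * q"] exI[of _ "var i * r"])
         (auto simp: algebra_simps intro: Svars_mult Svars_var free_of_mult free_of_var)
  next
    case True
    obtain s where s: "a = const (lin_coeff a j) * var j + s" "free_of j s"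
      using linear_form_split[OF a(1,2)] by blast
    let ?c = "const (1 / lin_coeff a j)"
    have c: "?c * const (lin_coeff a j) = 1" using a(3) by (simp add: const_mult[symmetric])
    have "var j = (?c * const (lin_coeff a j)) * var j" by (simp add: c)
    also have "\<dots> = a * ?c + const (- 1) * ?c * s"
      by (subst s(1)) (simp add: algebra_simps const_uminus)
    finally have vj: "var j = a * ?c + const (- 1) * ?c * s" .
    have "r \<in> Svars l"
    proof -
      have "r = f - a * q" using qr(1) by simp
      then show ?thesis using var(2) qr(2) a(1) by (auto simp: linear_form_def intro: Svars_diff Svars_mult)
    qed
    moreover have "var i * f = a * (var j * q + ?c * r) + const (- 1) * ?c * s * r"
    proof -
      have "var i * f = a * (var j * q) + var j * r" by (simp add: True qr(1) algebra_simps)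
      also have "var j * r = a * (?c * r) + const (- 1) * ?c * s * r"
        by (subst vj) (simp add: algebra_simps)
      finally show ?thesis by (simp add: algebra_simps)
    qed
    ultimately show ?thesis
      using qr(2,3) s(2) a(2)
      by (intro exI[of _ "var j * q + ?c * r"] exI[of _ "const (- 1) * ?c * s * r"])
         (auto intro!: Svars_add Svars_mult Svars_var free_of_mult)
  qed
qed

text \<open>A linear form is prime, seen by eliminating x_j. Modulo a, the form b becomes r, nonzero
  because b is not proportional to a, and g becomes r1. Then r r1 is a multiple of a free of x_j,
  hence 0, and so r1 = 0.\<close>

lemma linear_form_coprime_dvd:
  assumes a: "linear_form l a" and b: "linear_form l b" and np: "\<And>c. b \<noteq> const c * a"
    and g: "g \<in> Svars l" and dv: "a * q = b * (g :: 'k::field mpoly)"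
  shows "\<exists>q\<in>Svars l. g = a * q"
proof -
  obtain j where j: "j < l" "lin_coeff a j \<noteq> 0" by (rule linear_form_nonzero_coeff[OF a])
  obtain q1 r1 where g': "g = a * q1 + r1" "q1 \<in> Svars l" "free_of j r1"
    using linear_form_division[OF a j g] by blast
  define c where "c = lin_coeff b j / lin_coeff a j"
  obtain s where s: "a = const (lin_coeff a j) * var j + s" "free_of j s"
    using linear_form_split[OF a j(1)] by blast
  obtain t where t: "b = const (lin_coeff b j) * var j + t" "free_of j t"
    using linear_form_split[OF b j(1)] by blast
  define r where "r = t + const (- c) * s"
  have "const (lin_coeff b j) = const c * const (lin_coeff a j)"
    using j(2) by (simp add: c_def const_mult[symmetric])
  then have "const (lin_coeff b j) * var j = const c * (const (lin_coeff a j) * var j)"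
    by (simp add: mult.assoc)
  also have "\<dots> = const c * (a - s)" using s(1) by (metis add_diff_cancel_right')
  finally have "b = const c * (a - s) + t" using t(1) by metis
  then have b': "b = const c * a + r"
    by (simp add: r_def const_uminus algebra_simps)
  have "r \<noteq> 0" using np[of c] b' by auto
  have fr: "free_of j r" unfolding r_def by (intro free_of_add free_of_mult t s free_of_const)
  have "r * r1 = a * (q - const c * g - r * q1)"
    using dv b' g'(1) by (simp add: algebra_simps)
  then have "free_of j (a * (q - const c * g - r * q1))" using free_of_mult[OF fr g'(3)] by simp
  then have "q - const c * g - r * q1 = 0" by (rule free_of_linear_multiple[OF a j])
  then have "r1 = 0" using \<open>r * r1 = _\<close> \<open>r \<noteq> 0\<close> by simp
  then show ?thesis using g' by auto
qed

text \<open>Two nested reductions to the case of first powers: \<open>one\<close> strips the factors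
  a against a single b, and the outer induction strips the factors b.\<close>

lemma linear_form_power_coprime:
  assumes a: "linear_form l a" and b: "linear_form l b" and np: "\<And>c. b \<noteq> const c * a"
    and g: "g \<in> Svars l" and q: "q \<in> Svars l" and dv: "a ^ k * q = b ^ n * (g :: 'k::field mpoly)"
  shows "\<exists>q\<in>Svars l. g = a ^ k * q"
proof -
  have one: "\<exists>q\<in>Svars l. g = a ^ k * q" if "a ^ k * q = b * g" "g \<in> Svars l" for g q k
    using that
  proof (induction k arbitrary: g)
    case (Suc k)
    have "a * (a ^ k * q) = b * g" using Suc.prems by (simp add: mult.assoc)
    then obtain q1 where q1: "q1 \<in> Svars l" "g = a * q1"
      using linear_form_coprime_dvd[OF a b np Suc.prems(2)] by blast
    have "a * (a ^ k * q) = a * (b * q1)" using Suc.prems(1) q1(2) by (simp add: mult_ac)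
    then have "a ^ k * q = b * q1" using a by (simp add: linear_form_def)
    then obtain q2 where "q2 \<in> Svars l" "q1 = a ^ k * q2" using Suc.IH q1(1) by blast
    then show ?case using q1(2) by (auto simp: mult.assoc)
  qed auto
  show ?thesis using dv g
  proof (induction n arbitrary: g)
    case 0
    then show ?case using q by auto
  next
    case (Suc n)
    have "b * g \<in> Svars l" using b Suc.prems(2) by (auto simp: linear_form_def intro: Svars_mult)
    moreover have "a ^ k * q = b ^ n * (b * g)" using Suc.prems(1) by (simp add: mult_ac)
    ultimately obtain q1 where "b * g = a ^ k * q1" using Suc.IH by metis
    then show ?case using one[of k q1 g] Suc.prems(2) by simp
  qed
qed

text \<open>Applied in contrapositive form: distinct hyperplanes have forms that are not
  proportional.\<close>

lemma kernel_proportional: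
  assumes "c \<noteq> 0"
  shows "kernel l (const c * a) = kernel l (a :: 'k::field mpoly)"
proof -
  have lk: "Poly_Mapping.lookup (const c * a) m = c * Poly_Mapping.lookup a m" for m
    using lookup_single_mult[of 0 c a m] by (simp add: const_def)
  then have "Poly_Mapping.keys (const c * a) = Poly_Mapping.keys a"
    using assms by (auto simp: in_keys_iff)
  then have "mpoly_eval (const c * a) v = c * mpoly_eval a v" for v
    by (simp add: mpoly_eval_def lk sum_distrib_left mult.assoc)
  then show ?thesis using assms by (simp add: kernel_def)
qed

section \<open>Multiderivations\<close>

lemma multider_Svars: "is_multider l p \<theta> \<Longrightarrow> \<theta> fs \<in> Svars l"
  by (simp add: is_multider_def)

lemma multider_outside: "is_multider l p \<theta> \<Longrightarrow> \<not> (length fs = p \<and> set fs \<subseteq> Svars l) \<Longrightarrow> \<theta> fs = 0"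
  unfolding is_multider_def by blast

lemma
  assumes "is_multider l p \<theta>" "length fs = p" "set fs \<subseteq> Svars l" "j < p" "f \<in> Svars l"
  shows multider_add: "g \<in> Svars l \<Longrightarrow> \<theta> (fs[j := f + g]) = \<theta> (fs[j := f]) + \<theta> (fs[j := g])"
    and multider_const: "\<theta> (fs[j := const c * f]) = const c * \<theta> (fs[j := f])"
    and multider_mult: "g \<in> Svars l \<Longrightarrow> \<theta> (fs[j := f * g]) = f * \<theta> (fs[j := g]) + g * \<theta> (fs[j := f])"
  using assms unfolding is_multider_def by blast+

lemma multider_alt:
  "is_multider l p \<theta> \<Longrightarrow> i < j \<Longrightarrow> j < length fs \<Longrightarrow> fs ! i = fs ! j \<Longrightarrow> \<theta> fs = 0"
  unfolding is_multider_def by metis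

lemma multider_not_distinct:
  assumes "is_multider l p \<theta>" "\<not> distinct fs"
  shows "\<theta> fs = 0"
proof -
  obtain i j where "i < length fs" "j < length fs" "i \<noteq> j" "fs ! i = fs ! j"
    using assms(2) by (auto simp: distinct_conv_nth)
  then show ?thesis using multider_alt[OF assms(1), of i j fs] multider_alt[OF assms(1), of j i fs]
    by (metis linorder_neqE_nat)
qed

lemma is_multiderI:
  assumes "\<And>fs. \<theta> fs \<in> Svars l"
    and "\<And>fs. \<not> (length fs = p \<and> set fs \<subseteq> Svars l) \<Longrightarrow> \<theta> fs = 0"
    and "\<And>fs j f g. length fs = p \<Longrightarrow> set fs \<subseteq> Svars l \<Longrightarrow> j < p \<Longrightarrow> f \<in> Svars l \<Longrightarrow> g \<in> Svars l \<Longrightarrow>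
       \<theta> (fs[j := f + g]) = \<theta> (fs[j := f]) + \<theta> (fs[j := g])"
    and "\<And>fs j f c. length fs = p \<Longrightarrow> set fs \<subseteq> Svars l \<Longrightarrow> j < p \<Longrightarrow> f \<in> Svars l \<Longrightarrow>
       \<theta> (fs[j := const c * f]) = const c * \<theta> (fs[j := f])"
    and "\<And>fs j f g. length fs = p \<Longrightarrow> set fs \<subseteq> Svars l \<Longrightarrow> j < p \<Longrightarrow> f \<in> Svars l \<Longrightarrow> g \<in> Svars l \<Longrightarrow>
       \<theta> (fs[j := f * g]) = f * \<theta> (fs[j := g]) + g * \<theta> (fs[j := f])"
    and "\<And>fs i j. length fs = p \<Longrightarrow> set fs \<subseteq> Svars l \<Longrightarrow> i < j \<Longrightarrow> j < p \<Longrightarrow> fs ! i = fs ! j \<Longrightarrow> \<theta> fs = 0"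
  shows "is_multider l p \<theta>"
  unfolding is_multider_def using assms by auto

lemma multider_0: "is_multider l p (\<lambda>_. 0)"
  by (rule is_multiderI) auto

lemma multider_plus:
  assumes "is_multider l p \<theta>" "is_multider l p \<eta>"
  shows "is_multider l p (\<lambda>fs. \<theta> fs + \<eta> fs)"
proof (rule is_multiderI)
  show "\<theta> fs + \<eta> fs \<in> Svars l" for fs by (intro Svars_add multider_Svars[OF assms(1)] multider_Svars[OF assms(2)])
  show "\<theta> (fs[j := const c * f]) + \<eta> (fs[j := const c * f]) = const c * (\<theta> (fs[j := f]) + \<eta> (fs[j := f]))"
    if "length fs = p" "set fs \<subseteq> Svars l" "j < p" "f \<in> Svars l" for fs j f c
    unfolding multider_const[OF assms(1) that] multider_const[OF assms(2) that] by (rule distrib_left[symmetric])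
qed (auto simp: assms[THEN multider_outside] assms[THEN multider_add] assms[THEN multider_mult]
    assms[THEN multider_alt] algebra_simps)

lemma multider_smult:
  assumes "is_multider l p \<theta>" "h \<in> Svars l"
  shows "is_multider l p (\<lambda>fs. h * \<theta> fs)"
proof (rule is_multiderI)
  show "h * \<theta> fs \<in> Svars l" for fs by (intro Svars_mult assms(2) multider_Svars[OF assms(1)])
  show "h * \<theta> (fs[j := const c * f]) = const c * (h * \<theta> (fs[j := f]))"
    if "length fs = p" "set fs \<subseteq> Svars l" "j < p" "f \<in> Svars l" for fs j f c
    unfolding multider_const[OF assms(1) that] by (rule mult.left_commute)
qed (auto simp: multider_outside[OF assms(1)] multider_add[OF assms(1)] multider_mult[OF assms(1)]
    multider_alt[OF assms(1)] algebra_simps)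

lemma multider_contract:
  fixes \<theta> :: "'k::field mpoly list \<Rightarrow> 'k mpoly"
  assumes "is_multider l (Suc p) \<theta>" "f \<in> Svars l"
  shows "is_multider l p (\<lambda>fs. \<theta> (f # fs))"
proof (rule is_multiderI)
  show "\<theta> (f # fs) \<in> Svars l" for fs by (rule multider_Svars[OF assms(1)])
  show "\<theta> (f # fs) = 0" if "\<not> (length fs = p \<and> set fs \<subseteq> Svars l)" for fs
    using multider_outside[OF assms(1), of "f # fs"] that assms(2) by auto
  fix fs :: "'k mpoly list" and j and g h :: "'k mpoly" and c :: 'k assume fs: "length fs = p" "set fs \<subseteq> Svars l" and j: "j < p" and g: "g \<in> Svars l"
  have v: "length (f # fs) = Suc p" "set (f # fs) \<subseteq> Svars l" "Suc j < Suc p" using fs j assms(2) by auto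
  show "\<theta> (f # fs[j := const c * g]) = const c * \<theta> (f # fs[j := g])"
    using multider_const[OF assms(1) v g] by simp
  assume h: "h \<in> Svars l"
  show "\<theta> (f # fs[j := g + h]) = \<theta> (f # fs[j := g]) + \<theta> (f # fs[j := h])"
    using multider_add[OF assms(1) v g h] by simp
  show "\<theta> (f # fs[j := g * h]) = g * \<theta> (f # fs[j := h]) + h * \<theta> (f # fs[j := g])"
    using multider_mult[OF assms(1) v g h] by simp
next
  show "\<theta> (f # fs) = 0" if "length fs = p" "i < j" "j < p" "fs ! i = fs ! j" for fs i j
    using that by (intro multider_alt[OF assms(1), of "Suc i" "Suc j"]) auto
qed

lemma multider_cons_0: "is_multider l 0 \<theta> \<Longrightarrow> \<theta> (f # fs) = 0"
  by (rule multider_outside) auto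

lemma multider_cons_outside:
  assumes "is_multider l p \<theta>" "\<not> (Suc (length fs) = p \<and> set fs \<subseteq> Svars l)"
  shows "\<theta> (f # fs) = 0"
  using multider_outside[OF assms(1), of "f # fs"] assms(2) by auto

lemma
  assumes "is_multider l p \<theta>" "f \<in> Svars l"
  shows multider_cons_add: "g \<in> Svars l \<Longrightarrow> \<theta> ((f + g) # fs) = \<theta> (f # fs) + \<theta> (g # fs)"
    and multider_cons_const: "\<theta> ((const c * f) # fs) = const c * \<theta> (f # fs)"
    and multider_cons_mult: "g \<in> Svars l \<Longrightarrow> \<theta> ((f * g) # fs) = f * \<theta> (g # fs) + g * \<theta> (f # fs)"
proof -
  consider "Suc (length fs) = p" "set fs \<subseteq> Svars l" | "\<not> (Suc (length fs) = p \<and> set fs \<subseteq> Svars l)" by blast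
  then have "(g \<in> Svars l \<longrightarrow> \<theta> ((f + g) # fs) = \<theta> (f # fs) + \<theta> (g # fs)) \<and> \<theta> ((const c * f) # fs) = const c * \<theta> (f # fs)
    \<and> (g \<in> Svars l \<longrightarrow> \<theta> ((f * g) # fs) = f * \<theta> (g # fs) + g * \<theta> (f # fs))"
  proof cases
    case 1
    have v: "length (f # fs) = p" "set (f # fs) \<subseteq> Svars l" "0 < p" using 1 assms(2) by auto
    show ?thesis
      using multider_add[OF assms(1) v assms(2), of g] multider_const[OF assms(1) v assms(2), of c]
        multider_mult[OF assms(1) v assms(2), of g] by simp
  next
    case 2
    then show ?thesis using multider_cons_outside[OF assms(1) 2] by simp
  qed
  then show "g \<in> Svars l \<Longrightarrow> \<theta> ((f + g) # fs) = \<theta> (f # fs) + \<theta> (g # fs)"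
    "\<theta> ((const c * f) # fs) = const c * \<theta> (f # fs)"
    "g \<in> Svars l \<Longrightarrow> \<theta> ((f * g) # fs) = f * \<theta> (g # fs) + g * \<theta> (f # fs)" by blast+
qed

text \<open>Polarisation: the value on the repeated argument f + g vanishes and expands into the two
  mixed terms.\<close>

lemma multider_swap:
  assumes "is_multider l p \<theta>" "f \<in> Svars l" "g \<in> Svars l"
  shows "\<theta> (f # g # fs) = - \<theta> (g # f # fs)"
proof (cases "p = 0")
  case True
  then show ?thesis using multider_cons_0[OF assms(1)[unfolded True]] by simp
next
  case False
  then obtain p' where p: "p = Suc p'" by (cases p) auto
  have fg: "f + g \<in> Svars l" by (intro Svars_add assms)
  have alt: "\<theta> (h # h # fs) = 0" for h
    by (rule multider_not_distinct[OF assms(1)]) simp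
  have lin: "\<theta> (h # (f + g) # fs) = \<theta> (h # f # fs) + \<theta> (h # g # fs)" if "h \<in> Svars l" for h
    using multider_cons_add[OF multider_contract[OF assms(1)[unfolded p] that] assms(2,3)] .
  have "0 = \<theta> ((f + g) # (f + g) # fs)" by (simp add: alt)
  also have "\<dots> = \<theta> (f # (f + g) # fs) + \<theta> (g # (f + g) # fs)"
    by (rule multider_cons_add[OF assms])
  also have "\<dots> = \<theta> (f # g # fs) + \<theta> (g # f # fs)"
    by (simp add: lin assms(2,3) alt)
  finally show ?thesis by (simp add: eq_neg_iff_add_eq_0)
qed

lemma multider_cons_sum:
  assumes "is_multider l p \<theta>" "\<And>i. i \<in> I \<Longrightarrow> f i \<in> Svars l" "finite I"
  shows "\<theta> ((\<Sum>i\<in>I. const (c i) * f i) # fs) = (\<Sum>i\<in>I. const (c i) * \<theta> (f i # fs))"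
  using assms(3,2)
proof (induction I rule: finite_induct)
  case empty
  have "\<theta> ((const 0 * 0) # fs) = const 0 * \<theta> (0 # fs)"
    by (rule multider_cons_const[OF assms(1)]) simp
  then show ?case by simp
next
  case (insert i I)
  have "const (c i) * f i \<in> Svars l" "(\<Sum>i\<in>I. const (c i) * f i) \<in> Svars l"
    using insert.prems by (auto intro!: Svars_sum Svars_mult)
  then have "\<theta> ((const (c i) * f i + (\<Sum>i\<in>I. const (c i) * f i)) # fs) =
     const (c i) * \<theta> (f i # fs) + \<theta> ((\<Sum>i\<in>I. const (c i) * f i) # fs)"
    using multider_cons_add[OF assms(1)] multider_cons_const[OF assms(1)] insert.prems by simp
  then show ?case using insert by simp
qed

text \<open>The Leibniz rule reduces each argument to variables. The slots are treated from left to
  right, with \<open>is\<close> recording those that already hold variables.\<close>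

lemma multider_determined:
  assumes "is_multider l p \<theta>" "\<And>is. \<theta> (map var is) = 0"
  shows "\<theta> fs = 0"
proof -
  have *: "\<theta> (map var is @ gs) = 0" for "is" gs
  proof (induction gs arbitrary: "is")
    case Nil
    then show ?case using assms(2) by simp
  next
    case (Cons g gs)
    show ?case
    proof (cases "length is + Suc (length gs) = p \<and> set (map var is @ g # gs) \<subseteq> Svars l")
      case True
      let ?fs = "\<lambda>x. map var is @ x # gs"
      let ?j = "length is"
      have v: "length (?fs 0) = p" "set (?fs 0) \<subseteq> Svars l" "?j < p" using True by auto
      have up: "(?fs 0)[?j := x] = ?fs x" for x by (simp add: list_update_append)
      note ad = multider_add[OF assms(1) v, unfolded up]
        and co = multider_const[OF assms(1) v, unfolded up]
        and mu = multider_mult[OF assms(1) v, unfolded up]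
      \<comment> \<open>A derivation kills 1 because the Leibniz rule for 1 = 1 * 1 doubles the
        value.\<close>
      have "\<theta> (?fs 1) = \<theta> (?fs 1) + \<theta> (?fs 1)" using mu[of 1 1] by (simp only: Svars_1 mult_1 simp_thms)
      then have one: "\<theta> (?fs 1) = 0" by (metis add_cancel_right_right)
      have "g \<in> Svars l" using True by simp
      then show ?thesis
      proof (induction g rule: Svars_induct)
        case (const c)
        show ?case using co[of 1 c] one by simp
      next
        case (add f h)
        then show ?case using ad by simp
      next
        case (var f i)
        have "\<theta> (?fs (var i)) = 0" using Cons.IH[of "is @ [i]"] by simp
        then show ?case using mu[of "var i" f] var Svars_var[OF var(3)] by simp
      qed
    next
      case False
      then show ?thesis by (intro multider_outside[OF assms(1)]) auto
    qed
  qed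
  show ?thesis using *[of "[]" fs] by simp
qed

text \<open>The exterior product of d with \<eta>: unfolded, it is the sum over k of (-1)^k d(f_k)
  times \<eta> at the list without f_k. The recursion through contraction with the first argument
  avoids both the signs and the degree of \<eta>.\<close>

fun wedge :: "('b \<Rightarrow> 'r::comm_ring_1) \<Rightarrow> ('b list \<Rightarrow> 'r) \<Rightarrow> 'b list \<Rightarrow> 'r" where
  "wedge d \<eta> [] = 0"
| "wedge d \<eta> (f # fs) = d f * \<eta> fs - wedge d (\<lambda>gs. \<eta> (f # gs)) fs"

lemma wedge_zero [simp]: "wedge d (\<lambda>_. 0) fs = 0"
  by (induction fs) auto

lemma wedge_add: "wedge d (\<lambda>gs. \<eta> gs + \<zeta> gs) fs = wedge d \<eta> fs + wedge d \<zeta> fs"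
  by (induction fs arbitrary: \<eta> \<zeta>) (auto simp: algebra_simps)

lemma wedge_mult: "wedge d (\<lambda>gs. h * \<eta> gs) fs = h * wedge d \<eta> fs"
  by (induction fs arbitrary: \<eta>) (auto simp: algebra_simps)

lemma wedge_uminus: "wedge d (\<lambda>gs. - \<eta> gs) fs = - wedge d \<eta> fs"
  using wedge_mult[of d "- 1" \<eta> fs] by simp

lemma wedge_sum: "finite I \<Longrightarrow> wedge d (\<lambda>gs. \<Sum>i\<in>I. \<eta> i gs) fs = (\<Sum>i\<in>I. wedge d (\<eta> i) fs)"
  by (induction I rule: finite_induct) (auto simp: wedge_add)

lemma wedge_map: "wedge d \<eta> (map h is) = wedge (\<lambda>i. d (h i)) (\<lambda>js. \<eta> (map h js)) is"
  by (induction "is" arbitrary: \<eta>) auto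

lemma wedge_Svars:
  assumes "\<And>f. d f \<in> Svars l" "\<And>gs. \<eta> gs \<in> Svars l"
  shows "wedge d \<eta> fs \<in> Svars (l :: nat)"
  using assms(2) by (induction fs arbitrary: \<eta>) (auto intro!: Svars_diff Svars_mult assms(1))

lemma wedge_homog:
  assumes "\<And>f. homog e (d f)" "\<And>gs. homog a (\<eta> gs)"
  shows "homog (e + a) (wedge d \<eta> fs)"
  using assms(2) by (induction fs arbitrary: \<eta>) (auto intro!: homog_diff homog_mult assms(1))

lemma wedge_outside:
  assumes "\<And>f. f \<notin> S \<Longrightarrow> d f = 0" "\<And>gs. \<not> (length gs = p \<and> set gs \<subseteq> S) \<Longrightarrow> \<eta> gs = 0"
    "\<not> (length fs = Suc p \<and> set fs \<subseteq> S)"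
  shows "wedge d \<eta> fs = 0"
  using assms(2,3)
proof (induction fs arbitrary: p \<eta>)
  case (Cons f fs)
  have "d f * \<eta> fs = 0"
  proof (cases "f \<in> S")
    case True
    then have "\<eta> fs = 0" using Cons.prems by auto
    then show ?thesis by simp
  qed (simp add: assms(1))
  moreover have "wedge d (\<lambda>gs. \<eta> (f # gs)) fs = 0"
  proof (cases "f \<in> S \<and> p \<noteq> 0")
    case True
    then obtain p' where p: "p = Suc p'" by (cases p) auto
    show ?thesis
      by (rule Cons.IH[of p']) (use Cons.prems True p in auto)
  next
    case False
    then have "(\<lambda>gs. \<eta> (f # gs)) = (\<lambda>_. 0)" using Cons.prems(1) by (auto simp: fun_eq_iff)
    then show ?thesis by simp
  qed
  ultimately show ?case by simp
qed simp

text \<open>This says that \<open>wedge d \<eta>\<close> vanishes on \<open>f # fs\<close> when f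
  recurs in \<open>fs\<close>: the alternating law for a repeated first argument.\<close>

lemma wedge_contract_mem:
  assumes "is_multider l p \<eta>" "set fs \<subseteq> Svars l" "f \<in> set fs"
  shows "wedge d (\<lambda>gs. \<eta> (f # gs)) fs = d f * \<eta> fs"
  using assms
proof (induction fs arbitrary: p \<eta>)
  case (Cons g fs)
  have S: "f \<in> Svars l" "g \<in> Svars l" using Cons.prems by auto
  show ?case
  proof (cases "g = f")
    case True
    have "(\<lambda>gs. \<eta> (f # g # gs)) = (\<lambda>_. 0)"
      using multider_not_distinct[OF Cons.prems(1)] True by (auto simp: fun_eq_iff)
    then show ?thesis using True by simp
  next
    case False
    then have f: "f \<in> set fs" using Cons.prems by auto
    then have z: "\<eta> (f # fs) = 0" by (intro multider_not_distinct[OF Cons.prems(1)]) simp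
    have sw: "(\<lambda>gs. \<eta> (f # g # gs)) = (\<lambda>gs. - \<eta> (g # f # gs))"
      using multider_swap[OF Cons.prems(1) S] by blast
    show ?thesis
    proof (cases p)
      case 0
      then have "\<And>x xs. \<eta> (x # xs) = 0" using Cons.prems(1) multider_cons_0 by blast
      then show ?thesis by simp
    next
      case (Suc p')
      have "is_multider l p' (\<lambda>gs. \<eta> (g # gs))"
        using multider_contract[OF Cons.prems(1)[unfolded Suc] S(2)] .
      then have "wedge d (\<lambda>gs. \<eta> (g # f # gs)) fs = d f * \<eta> (g # fs)"
        using Cons.IH[of p' "\<lambda>gs. \<eta> (g # gs)"] Cons.prems(2) f by simp
      then show ?thesis by (simp add: z sw wedge_uminus)
    qed
  qed
qed simp

text \<open>Slot laws and alternation both go by induction on the argument list with \<eta>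
  arbitrary, because the recursion replaces \<eta> by its contraction with the first
  argument.\<close>

lemma wedge_multider:
  fixes \<theta> \<eta> :: "'k::field mpoly list \<Rightarrow> 'k mpoly"
  assumes \<theta>: "is_multider l 1 \<theta>" and \<eta>: "is_multider l p \<eta>"
  shows "is_multider l (Suc p) (wedge (\<lambda>f. \<theta> [f]) \<eta>)"
proof -
  let ?d = "\<lambda>f. \<theta> [f]"
  have slots: "(g \<in> Svars l \<longrightarrow> wedge ?d \<eta> (fs[j := f + g]) = wedge ?d \<eta> (fs[j := f]) + wedge ?d \<eta> (fs[j := g])) \<and>
     wedge ?d \<eta> (fs[j := const c * f]) = const c * wedge ?d \<eta> (fs[j := f]) \<and>
     (g \<in> Svars l \<longrightarrow> wedge ?d \<eta> (fs[j := f * g]) = f * wedge ?d \<eta> (fs[j := g]) + g * wedge ?d \<eta> (fs[j := f]))"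
    if "length fs = Suc p" "set fs \<subseteq> Svars l" "j < Suc p" "f \<in> Svars l" "is_multider l p \<eta>" for fs p \<eta> j f g c
    using that
  proof (induction fs arbitrary: p \<eta> j)
    case (Cons h fs)
    note \<eta> = Cons.prems(5) and f = Cons.prems(4)
    have fs: "length fs = p" "set fs \<subseteq> Svars l" "h \<in> Svars l" using Cons.prems by auto
    show ?case
    proof (cases j)
      case 0
      have ad: "(\<lambda>gs. \<eta> ((f + g) # gs)) = (\<lambda>gs. \<eta> (f # gs) + \<eta> (g # gs))" if "g \<in> Svars l"
        using multider_cons_add[OF \<eta> f that] by blast
      have co: "(\<lambda>gs. \<eta> ((const c * f) # gs)) = (\<lambda>gs. const c * \<eta> (f # gs))"
        using multider_cons_const[OF \<eta> f] by blast
      have mu: "(\<lambda>gs. \<eta> ((f * g) # gs)) = (\<lambda>gs. f * \<eta> (g # gs) + g * \<eta> (f # gs))" if "g \<in> Svars l"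
        using multider_cons_mult[OF \<eta> f that] by blast
      have up: "(h # fs)[j := x] = x # fs" for x by (simp add: 0)
      show ?thesis
        unfolding up wedge.simps multider_cons_const[OF \<theta> f, of c "[]"] co wedge_mult
      proof (intro conjI impI)
        assume g: "g \<in> Svars l"
        show "\<theta> [f + g] * \<eta> fs - wedge ?d (\<lambda>gs. \<eta> ((f + g) # gs)) fs =
            \<theta> [f] * \<eta> fs - wedge ?d (\<lambda>gs. \<eta> (f # gs)) fs + (\<theta> [g] * \<eta> fs - wedge ?d (\<lambda>gs. \<eta> (g # gs)) fs)"
          unfolding multider_cons_add[OF \<theta> f g] ad[OF g] wedge_add by (simp add: algebra_simps)
        show "\<theta> [f * g] * \<eta> fs - wedge ?d (\<lambda>gs. \<eta> ((f * g) # gs)) fs =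
            f * (\<theta> [g] * \<eta> fs - wedge ?d (\<lambda>gs. \<eta> (g # gs)) fs) + g * (\<theta> [f] * \<eta> fs - wedge ?d (\<lambda>gs. \<eta> (f # gs)) fs)"
          unfolding multider_cons_mult[OF \<theta> f g] mu[OF g] wedge_add wedge_mult by (simp add: algebra_simps)
      qed (simp add: algebra_simps)
    next
      case (Suc j')
      then have j': "j' < p" using Cons.prems by simp
      then obtain p' where p: "p = Suc p'" by (cases p) auto
      have ct: "is_multider l p' (\<lambda>gs. \<eta> (h # gs))"
        using multider_contract[OF \<eta>[unfolded p] fs(3)] .
      have up: "(h # fs)[j := x] = h # fs[j' := x]" for x by (simp add: Suc)
      note IH = Cons.IH[OF fs(1)[unfolded p] fs(2) j'[unfolded p] f ct]
      have IHc: "wedge ?d (\<lambda>gs. \<eta> (h # gs)) (fs[j' := const c * f]) = const c * wedge ?d (\<lambda>gs. \<eta> (h # gs)) (fs[j' := f])"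
        using IH by blast
      show ?thesis
        unfolding up wedge.simps multider_const[OF \<eta> fs(1,2) j' f, of c] IHc
      proof (intro conjI impI)
        assume g: "g \<in> Svars l"
        have IHa: "wedge ?d (\<lambda>gs. \<eta> (h # gs)) (fs[j' := f + g]) =
            wedge ?d (\<lambda>gs. \<eta> (h # gs)) (fs[j' := f]) + wedge ?d (\<lambda>gs. \<eta> (h # gs)) (fs[j' := g])"
          and IHm: "wedge ?d (\<lambda>gs. \<eta> (h # gs)) (fs[j' := f * g]) =
            f * wedge ?d (\<lambda>gs. \<eta> (h # gs)) (fs[j' := g]) + g * wedge ?d (\<lambda>gs. \<eta> (h # gs)) (fs[j' := f])"
          using IH g by blast+
        show "\<theta> [h] * \<eta> (fs[j' := f + g]) - wedge ?d (\<lambda>gs. \<eta> (h # gs)) (fs[j' := f + g]) =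
            \<theta> [h] * \<eta> (fs[j' := f]) - wedge ?d (\<lambda>gs. \<eta> (h # gs)) (fs[j' := f]) +
            (\<theta> [h] * \<eta> (fs[j' := g]) - wedge ?d (\<lambda>gs. \<eta> (h # gs)) (fs[j' := g]))"
          unfolding multider_add[OF \<eta> fs(1,2) j' f g] IHa by (simp add: algebra_simps)
        show "\<theta> [h] * \<eta> (fs[j' := f * g]) - wedge ?d (\<lambda>gs. \<eta> (h # gs)) (fs[j' := f * g]) =
            f * (\<theta> [h] * \<eta> (fs[j' := g]) - wedge ?d (\<lambda>gs. \<eta> (h # gs)) (fs[j' := g])) +
            g * (\<theta> [h] * \<eta> (fs[j' := f]) - wedge ?d (\<lambda>gs. \<eta> (h # gs)) (fs[j' := f]))"
          unfolding multider_mult[OF \<eta> fs(1,2) j' f g] IHm by (simp add: algebra_simps)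
      qed (simp add: algebra_simps)
    qed
  qed simp
  have alt: "wedge ?d \<eta> fs = 0"
    if "set fs \<subseteq> Svars l" "i < j" "j < length fs" "fs ! i = fs ! j" "is_multider l p \<eta>" for fs p \<eta> i j
    using that
  proof (induction fs arbitrary: p \<eta> i j)
    case (Cons h fs)
    obtain j' where j': "j = Suc j'" using Cons.prems(2) by (cases j) auto
    show ?case
    proof (cases i)
      case 0
      then have "h \<in> set fs" using Cons.prems j' by auto
      then show ?thesis using wedge_contract_mem[OF Cons.prems(5), of fs h] Cons.prems(1) by simp
    next
      case (Suc i')
      then have z: "\<eta> fs = 0" using Cons.prems j' by (intro multider_alt[OF Cons.prems(5), of i' j']) auto
      show ?thesis
      proof (cases p)
        case 0
        then have "\<And>x xs. \<eta> (x # xs) = 0" using Cons.prems(5) multider_cons_0 by blast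
        then show ?thesis using z by simp
      next
        case p: (Suc p')
        have "is_multider l p' (\<lambda>gs. \<eta> (h # gs))"
          using multider_contract[OF Cons.prems(5)[unfolded p]] Cons.prems(1) by simp
        then have "wedge ?d (\<lambda>gs. \<eta> (h # gs)) fs = 0"
          using Cons.IH[of i' j'] Cons.prems j' Suc by simp
        then show ?thesis using z by simp
      qed
    qed
  qed simp
  show ?thesis
  proof (rule is_multiderI)
    show "wedge ?d \<eta> fs \<in> Svars l" for fs
      by (intro wedge_Svars multider_Svars[OF \<theta>] multider_Svars[OF \<eta>])
    show "wedge ?d \<eta> fs = 0" if "\<not> (length fs = Suc p \<and> set fs \<subseteq> Svars l)" for fs
    proof (rule wedge_outside[OF _ _ that])
      show "\<theta> [f] = 0" if "f \<notin> Svars l" for f using multider_outside[OF \<theta>, of "[f]"] that by simp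
      show "\<eta> gs = 0" if "\<not> (length gs = p \<and> set gs \<subseteq> Svars l)" for gs by (rule multider_outside[OF \<eta> that])
    qed
  next
    fix fs :: "'k mpoly list" and j :: nat and f g :: "'k mpoly" and c :: 'k assume "length fs = Suc p" "set fs \<subseteq> Svars l" "j < Suc p" "f \<in> Svars l"
    note sl = slots[OF this \<eta>]
    show "wedge ?d \<eta> (fs[j := const c * f]) = const c * wedge ?d \<eta> (fs[j := f])" using sl by blast
    assume g: "g \<in> Svars l"
    show "wedge ?d \<eta> (fs[j := f + g]) = wedge ?d \<eta> (fs[j := f]) + wedge ?d \<eta> (fs[j := g])"
      "wedge ?d \<eta> (fs[j := f * g]) = f * wedge ?d \<eta> (fs[j := g]) + g * wedge ?d \<eta> (fs[j := f])" using sl g by blast+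
  next
    show "wedge ?d \<eta> fs = 0" if "length fs = Suc p" "set fs \<subseteq> Svars l" "i < j" "j < Suc p" "fs ! i = fs ! j" for fs i j
      by (rule alt[OF _ _ _ _ \<eta>, of fs i j]) (use that in auto)
  qed
qed

lemma wedge_divisible:
  assumes "\<And>f. d f \<in> Svars l" "\<And>gs. \<exists>q\<in>Svars l. \<zeta> gs = a * q"
  shows "\<exists>q\<in>Svars (l :: nat). wedge d \<zeta> fs = a * q"
proof -
  obtain q where q: "\<And>gs. q gs \<in> Svars l" "\<And>gs. \<zeta> gs = a * q gs" using assms(2) by metis
  then have "\<zeta> = (\<lambda>gs. a * q gs)" by blast
  then show ?thesis using wedge_Svars[of d l q fs] assms(1) q(1) by (auto simp: wedge_mult)
qed

section \<open>Logarithmic multiderivations\<close>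

lemma Dp_multider: "\<theta> \<in> Dp l A \<alpha> m p \<Longrightarrow> is_multider l p \<theta>"
  by (simp add: Dp_def)

lemma Dp_divisible:
  assumes "\<theta> \<in> Dp l A \<alpha> m p" "H \<in> A"
  shows "\<exists>q\<in>Svars l. \<theta> (\<alpha> H # fs) = \<alpha> H ^ m H * q"
proof (cases "Suc (length fs) = p \<and> set (\<alpha> H # fs) \<subseteq> Svars l")
  case True
  then have "1 \<le> p" "length (\<alpha> H # fs) = p" "set (\<alpha> H # fs) \<subseteq> Svars l" "(\<alpha> H # fs) ! 0 = \<alpha> H" by auto
  then show ?thesis using assms unfolding Dp_def by blast
next
  case False
  then have "\<theta> (\<alpha> H # fs) = 0" using multider_outside[OF Dp_multider[OF assms(1)], of "\<alpha> H # fs"] by auto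
  then show ?thesis by (intro bexI[of _ 0]) auto
qed

lemma DpI:
  assumes "is_multider l p \<theta>" "\<And>H fs. H \<in> A \<Longrightarrow> \<exists>q\<in>Svars l. \<theta> (\<alpha> H # fs) = \<alpha> H ^ m H * q"
  shows "\<theta> \<in> Dp l A \<alpha> m p"
proof -
  have "\<exists>q\<in>Svars l. \<theta> fs = \<alpha> H ^ m H * q" if "1 \<le> p" "H \<in> A" "length fs = p" "fs ! 0 = \<alpha> H" for H fs
    using that assms(2)[of H "tl fs"] by (cases fs) auto
  then show ?thesis using assms(1) by (simp add: Dp_def)
qed

lemma Dp_0: "(\<lambda>_. 0) \<in> Dp l A \<alpha> m p"
  by (rule DpI[OF multider_0]) (auto intro!: bexI[of _ 0])

lemma Dp_add:
  assumes "\<theta> \<in> Dp l A \<alpha> m p" "\<eta> \<in> Dp l A \<alpha> m p"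
  shows "(\<lambda>fs. \<theta> fs + \<eta> fs) \<in> Dp l A \<alpha> m p"
proof (rule DpI)
  show "is_multider l p (\<lambda>fs. \<theta> fs + \<eta> fs)" by (intro multider_plus assms[THEN Dp_multider])
  fix H fs assume H: "H \<in> A"
  obtain q q' where "q \<in> Svars l" "q' \<in> Svars l" "\<theta> (\<alpha> H # fs) = \<alpha> H ^ m H * q" "\<eta> (\<alpha> H # fs) = \<alpha> H ^ m H * q'"
    using Dp_divisible[OF assms(1) H] Dp_divisible[OF assms(2) H] by metis
  then show "\<exists>q\<in>Svars l. \<theta> (\<alpha> H # fs) + \<eta> (\<alpha> H # fs) = \<alpha> H ^ m H * q"
    by (intro bexI[of _ "q + q'"]) (auto simp: distrib_left intro: Svars_add)
qed

lemma Dp_smult: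
  assumes "\<theta> \<in> Dp l A \<alpha> m p" "h \<in> Svars l"
  shows "(\<lambda>fs. h * \<theta> fs) \<in> Dp l A \<alpha> m p"
proof (rule DpI)
  show "is_multider l p (\<lambda>fs. h * \<theta> fs)" by (intro multider_smult assms Dp_multider[OF assms(1)])
  fix H fs assume H: "H \<in> A"
  obtain q where "q \<in> Svars l" "\<theta> (\<alpha> H # fs) = \<alpha> H ^ m H * q"
    using Dp_divisible[OF assms(1) H] by metis
  then show "\<exists>q\<in>Svars l. h * \<theta> (\<alpha> H # fs) = \<alpha> H ^ m H * q"
    using assms(2) by (intro bexI[of _ "h * q"]) (auto simp: mult_ac intro: Svars_mult)
qed

text \<open>Divisibility is demanded in the first slot only. After the contraction \<alpha> H stands
  second, and a swap brings it to the front.\<close>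

lemma Dp_contract:
  assumes "\<theta> \<in> Dp l A \<alpha> m (Suc p)" "f \<in> Svars l" "\<And>H. H \<in> A \<Longrightarrow> \<alpha> H \<in> Svars l"
  shows "(\<lambda>fs. \<theta> (f # fs)) \<in> Dp l A \<alpha> m p"
proof (rule DpI)
  show "is_multider l p (\<lambda>fs. \<theta> (f # fs))" by (intro multider_contract Dp_multider[OF assms(1)] assms(2))
  fix H fs assume H: "H \<in> A"
  obtain q where "q \<in> Svars l" "\<theta> (\<alpha> H # f # fs) = \<alpha> H ^ m H * q"
    using Dp_divisible[OF assms(1) H] by metis
  moreover have "\<theta> (f # \<alpha> H # fs) = - \<theta> (\<alpha> H # f # fs)"
    by (rule multider_swap[OF Dp_multider[OF assms(1)] assms(2) assms(3)[OF H]])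
  ultimately show "\<exists>q\<in>Svars l. \<theta> (f # \<alpha> H # fs) = \<alpha> H ^ m H * q"
    by (intro bexI[of _ "- q"]) (auto intro: Svars_uminus)
qed

lemma Dp_wedge:
  assumes "\<theta> \<in> Dp l A \<alpha> m 1" "\<eta> \<in> Dp l A \<alpha> m p"
  shows "wedge (\<lambda>f. \<theta> [f]) \<eta> \<in> Dp l A \<alpha> m (Suc p)"
proof (rule DpI)
  show "is_multider l (Suc p) (wedge (\<lambda>f. \<theta> [f]) \<eta>)"
    by (intro wedge_multider assms[THEN Dp_multider])
  fix H fs assume H: "H \<in> A"
  have S: "\<theta> [f] \<in> Svars l" "\<eta> gs \<in> Svars l" for f gs
    using multider_Svars[OF Dp_multider[OF assms(1)]] multider_Svars[OF Dp_multider[OF assms(2)]] by auto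
  obtain q where q: "q \<in> Svars l" "\<theta> [\<alpha> H] = \<alpha> H ^ m H * q"
    using Dp_divisible[OF assms(1) H] by metis
  obtain q' where q': "q' \<in> Svars l" "wedge (\<lambda>f. \<theta> [f]) (\<lambda>gs. \<eta> (\<alpha> H # gs)) fs = \<alpha> H ^ m H * q'"
    using wedge_divisible[of "\<lambda>f. \<theta> [f]" l "\<lambda>gs. \<eta> (\<alpha> H # gs)" "\<alpha> H ^ m H" fs] S Dp_divisible[OF assms(2) H] by metis
  show "\<exists>q\<in>Svars l. wedge (\<lambda>f. \<theta> [f]) \<eta> (\<alpha> H # fs) = \<alpha> H ^ m H * q"
    by (rule bexI[of _ "q * \<eta> fs - q'"]) (use q q' S in \<open>auto simp: algebra_simps intro!: Svars_diff Svars_mult\<close>)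
qed

section \<open>Polynomial multiples of directional derivatives\<close>

definition dir_der :: "nat \<Rightarrow> 'k::comm_ring_1 mpoly \<Rightarrow> (nat \<Rightarrow> 'k) \<Rightarrow> 'k mpoly list \<Rightarrow> 'k mpoly" where
  "dir_der l Q u fs = (if length fs = 1 \<and> set fs \<subseteq> Svars l then Q * (\<Sum>i<l. const (u i) * pd i (hd fs)) else 0)"

lemma dir_der_multider:
  assumes "Q \<in> Svars l"
  shows "is_multider l 1 (dir_der l Q (u :: nat \<Rightarrow> 'k::field))"
proof (rule is_multiderI)
  show "dir_der l Q u fs \<in> Svars l" for fs
  proof (cases fs)
    case (Cons f fs')
    then show ?thesis using assms
      by (auto simp: dir_der_def intro!: Svars_mult Svars_sum pd_Svars)
  qed (auto simp: dir_der_def)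
next
  fix fs :: "'k mpoly list" and j :: nat and f g :: "'k mpoly" and c :: 'k assume "length fs = 1" "j < 1" "f \<in> Svars l"
  then have fs: "fs[j := x] = [x]" for x by (cases fs) auto
  have cf: "const c * f \<in> Svars l" using \<open>f \<in> Svars l\<close> by (intro Svars_mult) auto
  show "dir_der l Q u (fs[j := const c * f]) = const c * dir_der l Q u (fs[j := f])"
    using \<open>f \<in> Svars l\<close> cf by (simp add: fs dir_der_def pd_mult sum_distrib_left mult_ac)
  assume g: "g \<in> Svars l"
  show "dir_der l Q u (fs[j := f + g]) = dir_der l Q u (fs[j := f]) + dir_der l Q u (fs[j := g])"
    using \<open>f \<in> Svars l\<close> g by (simp add: fs dir_der_def pd_add Svars_add sum.distrib distrib_left)
  show "dir_der l Q u (fs[j := f * g]) = f * dir_der l Q u (fs[j := g]) + g * dir_der l Q u (fs[j := f])"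
    using \<open>f \<in> Svars l\<close> g by (simp add: fs dir_der_def pd_mult Svars_mult sum.distrib distrib_left sum_distrib_left mult_ac)
qed (auto simp: dir_der_def)

lemma dir_der_var: "i < l \<Longrightarrow> dir_der l Q u [var i] = Q * const (u i :: 'k::field)"
  by (simp add: dir_der_def Svars_var pd_var if_distrib cong: if_cong)

lemma dir_der_linear:
  assumes "Q \<in> Svars l" "linear_form l a"
  shows "dir_der l Q u [a] = Q * const (\<Sum>i<l. lin_coeff a i * (u i :: 'k::field))"
proof -
  have "dir_der l Q u [a] = dir_der l Q u ((\<Sum>i<l. const (lin_coeff a i) * var i) # [])"
    using linear_form_expand[OF assms(2)] by simp
  also have "\<dots> = (\<Sum>i<l. const (lin_coeff a i) * dir_der l Q u [var i])"
    by (intro multider_cons_sum[OF dir_der_multider[OF assms(1)]]) (auto intro: Svars_var)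
  also have "\<dots> = (\<Sum>i<l. Q * const (lin_coeff a i * u i))"
    by (intro sum.cong) (auto simp: dir_der_var const_mult mult_ac)
  also have "\<dots> = Q * const (\<Sum>i<l. lin_coeff a i * u i)"
    by (simp add: sum_distrib_left[symmetric]) (induction l, auto simp: const_add)
  finally show ?thesis .
qed

lemma prod_list_power_factor:
  assumes "\<And>H. H \<in> set Hs \<Longrightarrow> \<alpha> H \<in> Svars l" "k \<le> count (mset Hs) H"
  shows "\<exists>q\<in>Svars l. prod_list (map \<alpha> Hs) = (\<alpha> H :: 'k::field mpoly) ^ k * q"
  using assms
proof (induction Hs arbitrary: k)
  case (Cons K Hs)
  show ?case
  proof (cases "K = H \<and> k \<noteq> 0")
    case True
    then obtain k' where k: "k = Suc k'" "K = H" by (cases k) auto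
    then obtain q where "q \<in> Svars l" "prod_list (map \<alpha> Hs) = \<alpha> H ^ k' * q"
      using Cons.IH[of k'] Cons.prems by auto
    then show ?thesis using k by (intro bexI[of _ q]) (auto simp: mult_ac)
  next
    case False
    then have "k \<le> count (mset Hs) H" using Cons.prems(2) by (cases "K = H") auto
    then obtain q where "q \<in> Svars l" "prod_list (map \<alpha> Hs) = \<alpha> H ^ k * q"
      using Cons.IH[of k] Cons.prems by auto
    then show ?thesis using Cons.prems(1)[of K] by (intro bexI[of _ "\<alpha> K * q"]) (auto simp: mult_ac intro: Svars_mult)
  qed
qed (auto intro!: bexI[of _ 1])

lemma Svars_prod_list: "(\<And>H. H \<in> set Hs \<Longrightarrow> \<alpha> H \<in> Svars l) \<Longrightarrow> prod_list (map \<alpha> Hs) \<in> Svars l"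
  for \<alpha> :: "'h \<Rightarrow> 'k::comm_semiring_1 mpoly"
  by (induction Hs) (auto intro: Svars_mult)

lemma homog_prod_list:
  fixes \<alpha> :: "'h \<Rightarrow> 'k::comm_semiring_1 mpoly"
  shows "(\<And>H. H \<in> set Hs \<Longrightarrow> homog 1 (\<alpha> H)) \<Longrightarrow> homog (length Hs) (prod_list (map \<alpha> Hs))"
proof (induction Hs)
  case Nil
  show ?case by simp (metis homog_const const_1)
next
  case (Cons H Hs)
  then show ?case using homog_mult[of 1 "\<alpha> H" "length Hs" "prod_list (map \<alpha> Hs)"] by simp
qed

text \<open>The value at \<alpha> H is Q times the scalar \<alpha> H (u): either this scalar is 0,
  or Q contains the factor \<alpha> H at least m H times.\<close>

lemma dir_der_Dp:
  assumes "\<And>H. H \<in> A \<Longrightarrow> linear_form l (\<alpha> H)" "set Hs \<subseteq> A"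
    "\<And>H. H \<in> A \<Longrightarrow> (\<Sum>i<l. lin_coeff (\<alpha> H) i * u i) \<noteq> 0 \<Longrightarrow> m H \<le> count (mset Hs) H"
  shows "dir_der l (prod_list (map \<alpha> Hs)) u \<in> Dp l A \<alpha> m 1"
proof (rule DpI)
  have S: "\<alpha> H \<in> Svars l" if "H \<in> A" for H using assms(1)[OF that] by (simp add: linear_form_def)
  have Q: "prod_list (map \<alpha> Hs) \<in> Svars l" by (intro Svars_prod_list S) (use assms(2) in auto)
  show "is_multider l 1 (dir_der l (prod_list (map \<alpha> Hs)) u)" by (rule dir_der_multider[OF Q])
  fix H fs assume H: "H \<in> A"
  show "\<exists>q\<in>Svars l. dir_der l (prod_list (map \<alpha> Hs)) u (\<alpha> H # fs) = \<alpha> H ^ m H * q"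
  proof (cases "fs = [] \<and> (\<Sum>i<l. lin_coeff (\<alpha> H) i * u i) \<noteq> 0")
    case True
    obtain q where "q \<in> Svars l" "prod_list (map \<alpha> Hs) = \<alpha> H ^ m H * q"
      using prod_list_power_factor[of Hs \<alpha> l "m H" H] S assms(2,3) H True by blast
    then show ?thesis using True dir_der_linear[OF Q assms(1)[OF H], of u]
      by (intro bexI[of _ "q * const (\<Sum>i<l. lin_coeff (\<alpha> H) i * u i)"]) (auto simp: mult.assoc intro: Svars_mult)
  next
    case False
    then have "dir_der l (prod_list (map \<alpha> Hs)) u (\<alpha> H # fs) = 0"
      using dir_der_linear[OF Q assms(1)[OF H], of u] by (auto simp: dir_der_def)
    then show ?thesis by (intro bexI[of _ 0]) auto
  qed
qed

section \<open>The contraction complex\<close>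

text \<open>\<open>dscale\<close> on an arbitrary domain, so that multiderivations, their values on
  variables and cochains share one vector space structure.\<close>

definition fscale :: "'k::field \<Rightarrow> ('x \<Rightarrow> 'k mpoly) \<Rightarrow> 'x \<Rightarrow> 'k mpoly" where
  "fscale c v = (\<lambda>x. const c * v x)"

lemma dscale_eq_fscale: "dscale = fscale"
  by (simp add: fun_eq_iff dscale_def fscale_def)

global_interpretation fs: kspace fscale
  by (unfold_locales) (auto simp: fscale_def fun_eq_iff algebra_simps const_add const_mult)

global_interpretation fs_pair: kspace_pair fscale fscale
  by unfold_locales

lemma fscale_linearI:
  "(\<And>v w. f (v + w) = f v + f w) \<Longrightarrow> (\<And>c v. f (fscale c v) = fscale c (f v)) \<Longrightarrow> Vector_Spaces.linear fscale fscale f"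
  by (auto simp: Vector_Spaces.linear_iff fs.vector_space_axioms)

lemma fscale_subspaceI:
  assumes "(\<lambda>_. 0) \<in> V" "\<And>v w. v \<in> V \<Longrightarrow> w \<in> V \<Longrightarrow> (\<lambda>x. v x + w x) \<in> V" "\<And>c v. v \<in> V \<Longrightarrow> (\<lambda>x. const c * v x) \<in> V"
  shows "fs.subspace V"
  using assms unfolding fs.subspace_def fscale_def plus_fun_def zero_fun_def by blast

lemma fscale_subspaceD:
  assumes "fs.subspace V"
  shows "(\<lambda>_. 0) \<in> V" "\<And>v w. v \<in> V \<Longrightarrow> w \<in> V \<Longrightarrow> (\<lambda>x. v x + w x) \<in> V" "\<And>c v. v \<in> V \<Longrightarrow> (\<lambda>x. const c * v x) \<in> V"
  using assms unfolding fs.subspace_def fscale_def plus_fun_def zero_fun_def by blast+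

text \<open>The value at (W, is) is the coefficient of xi^W, evaluated on the variables with indices
  \<open>is\<close>. Below, \<open>Xop i\<close> multiplies by x_i and \<open>Yop i\<close> by xi_i,
  the latter by a shift of W.\<close>

type_synonym 'k cochain = "nat multiset \<times> nat list \<Rightarrow> 'k mpoly"

definition Xop :: "nat \<Rightarrow> 'k::field cochain \<Rightarrow> 'k cochain" where
  "Xop i v = (\<lambda>q. var i * v q)"

definition Yop :: "nat \<Rightarrow> 'k::field cochain \<Rightarrow> 'k cochain" where
  "Yop i v = (\<lambda>(W, is). if i \<in># W then v (W - {#i#}, is) else 0)"

lemma diff_mset_swap: "i \<in># W \<and> j \<in># W - {#i#} \<longleftrightarrow> j \<in># W \<and> i \<in># W - {#j#}"
  by (metis add_mset_remove_trivial_eq diff_union_swap insert_DiffM insert_noteq_member in_diffD)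

lemma Yop_commute: "Yop i (Yop j v) = Yop j (Yop i v)"
proof -
  have "Yop i (Yop j v) (W, is) = (if i \<in># W \<and> j \<in># W - {#i#} then v (W - {#i#} - {#j#}, is) else 0)" for i j W "is"
    by (simp add: Yop_def)
  then have "Yop i (Yop j v) (W, is) = Yop j (Yop i v) (W, is)" for W "is"
    using diff_mset_swap[of i W j] by (simp add: add_mset_commute)
  then show ?thesis by (simp add: fun_eq_iff)
qed

global_interpretation bg: bigraded fscale Xop Yop l for l
  by (intro bigraded.intro bigraded_axioms.intro fs.kspace_axioms Yop_commute fscale_linearI)
     (auto simp: Xop_def Yop_def fscale_def fun_eq_iff algebra_simps)

locale multiarr =
  fixes l :: nat and A :: "(nat \<Rightarrow> 'k::field) set set"
    and \<alpha> :: "(nat \<Rightarrow> 'k) set \<Rightarrow> 'k mpoly" and m :: "(nat \<Rightarrow> 'k) set \<Rightarrow> nat"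
  assumes ma: "multiarrangement l A \<alpha> m"
begin

lemma linear_form_\<alpha>: "H \<in> A \<Longrightarrow> linear_form l (\<alpha> H)"
  using ma by (simp add: multiarrangement_def)

lemma \<alpha>_Svars: "H \<in> A \<Longrightarrow> \<alpha> H \<in> Svars l"
  using linear_form_\<alpha> by (simp add: linear_form_def)

text \<open>By \<open>multider_determined\<close> no information is lost, and a multiderivation
  becomes finitely many polynomials, whose degrees define its own.\<close>

definition restr :: "('k mpoly list \<Rightarrow> 'k mpoly) \<Rightarrow> nat list \<Rightarrow> 'k mpoly" where
  "restr \<theta> = (\<lambda>is. \<theta> (map var is))"

definition Dfam :: "nat \<Rightarrow> nat \<Rightarrow> (nat list \<Rightarrow> 'k mpoly) set" where
  "Dfam p a = restr ` Dp_deg l A \<alpha> m p a"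

lemma restr_outside:
  assumes "is_multider l p \<theta>" "\<not> (length is = p \<and> set is \<subseteq> {..<l})"
  shows "restr \<theta> is = 0"
  unfolding restr_def by (rule multider_outside[OF assms(1)]) (use assms(2) in \<open>auto simp: Svars_var_iff\<close>)

lemma Dp_deg_homog: 
  assumes "\<theta> \<in> Dp_deg l A \<alpha> m p a"
  shows "homog a (restr \<theta> is)"
proof (cases "length is = p \<and> set is \<subseteq> {..<l}")
  case True
  then show ?thesis using assms by (auto simp: Dp_deg_def restr_def)
next
  case False
  have "restr \<theta> is = 0"
    by (rule restr_outside[OF _ False]) (use assms in \<open>auto simp: Dp_deg_def Dp_def\<close>)
  then show ?thesis by simp
qed

lemma Dp_degI: "\<theta> \<in> Dp l A \<alpha> m p \<Longrightarrow> (\<And>is. homog a (restr \<theta> is)) \<Longrightarrow> \<theta> \<in> Dp_deg l A \<alpha> m p a"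
  by (auto simp: Dp_deg_def restr_def)

lemma Dp_degD: "\<theta> \<in> Dp_deg l A \<alpha> m p a \<Longrightarrow> \<theta> \<in> Dp l A \<alpha> m p"
  by (auto simp: Dp_deg_def)

lemma Dp_deg_multider: "\<theta> \<in> Dp_deg l A \<alpha> m p a \<Longrightarrow> is_multider l p \<theta>"
  by (rule Dp_multider[OF Dp_degD])

lemma subspace_Dp_deg: "fs.subspace (Dp_deg l A \<alpha> m p a)"
proof (rule fscale_subspaceI)
  show "(\<lambda>_. 0) \<in> Dp_deg l A \<alpha> m p a"
    by (rule Dp_degI[OF Dp_0]) (simp add: restr_def)
  fix v w c assume v: "v \<in> Dp_deg l A \<alpha> m p a"
  show "(\<lambda>x. const c * v x) \<in> Dp_deg l A \<alpha> m p a"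
    using Dp_deg_homog[OF v] by (intro Dp_degI Dp_smult Dp_degD[OF v] Svars_const) (auto simp: restr_def intro: homog_const_mult)
  assume w: "w \<in> Dp_deg l A \<alpha> m p a"
  show "(\<lambda>x. v x + w x) \<in> Dp_deg l A \<alpha> m p a"
    using Dp_deg_homog[OF v] Dp_deg_homog[OF w]
    by (intro Dp_degI Dp_add Dp_degD[OF v] Dp_degD[OF w]) (auto simp: restr_def intro: homog_add)
qed

lemma restr_linear: "Vector_Spaces.linear fscale fscale restr"
  by (rule fscale_linearI) (auto simp: restr_def fscale_def fun_eq_iff)

lemma restr_eq_0: "\<theta> \<in> Dp_deg l A \<alpha> m p a \<Longrightarrow> restr \<theta> = 0 \<Longrightarrow> \<theta> = 0"
  using multider_determined[OF Dp_deg_multider] by (auto simp: restr_def fun_eq_iff)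

lemma subspace_Dfam: "fs.subspace (Dfam p a)"
  unfolding Dfam_def by (rule module_hom.subspace_image[OF module_hom_iff_linear[THEN iffD2, OF restr_linear] subspace_Dp_deg])

lemma Dfam_outside: "c \<in> Dfam p a \<Longrightarrow> \<not> (length is = p \<and> set is \<subseteq> {..<l}) \<Longrightarrow> c is = 0"
  unfolding Dfam_def using restr_outside Dp_deg_multider by blast

lemma Dfam_Svars: "c \<in> Dfam p a \<Longrightarrow> c is \<in> Svars l"
  unfolding Dfam_def restr_def using multider_Svars Dp_deg_multider by blast

lemma Dfam_homog: "c \<in> Dfam p a \<Longrightarrow> homog a (c is)"
  unfolding Dfam_def using Dp_deg_homog by blast

lemma Dfam_not_distinct: "c \<in> Dfam p a \<Longrightarrow> \<not> distinct is \<Longrightarrow> c is = 0"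
  using multider_not_distinct[OF Dp_deg_multider, of _ p a "map var is"] by (auto simp: Dfam_def restr_def distinct_map)

lemma Dfam_swap:
  assumes "c \<in> Dfam p a"
  shows "c (i # j # is) = - c (j # i # is)"
proof (cases "i < l \<and> j < l")
  case True
  then show ?thesis using assms multider_swap[OF Dp_deg_multider, of _ p a "var i" "var j" "map var is"]
    by (auto simp: Dfam_def restr_def Svars_var)
next
  case False
  then show ?thesis using Dfam_outside[OF assms, of "i # j # is"] Dfam_outside[OF assms, of "j # i # is"] by auto
qed

text \<open>Among l + 1 indices below l one is repeated, and alternating maps vanish there.\<close>

lemma Dfam_too_long:
  assumes "c \<in> Dfam (Suc l) a"
  shows "c is = 0"
proof (cases "distinct is \<and> length is = Suc l \<and> set is \<subseteq> {..<l}")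
  case True
  then have "card (set is) \<le> card {..<l}" by (intro card_mono) auto
  then show ?thesis using True distinct_card[of "is"] by simp
next
  case False
  then show ?thesis using Dfam_not_distinct[OF assms] Dfam_outside[OF assms] by blast
qed

lemma Dfam_var_mult:
  assumes "c \<in> Dfam p a" "i < l"
  shows "(\<lambda>is. var i * c is) \<in> Dfam p (Suc a)"
proof -
  obtain \<theta> where \<theta>: "\<theta> \<in> Dp_deg l A \<alpha> m p a" "c = restr \<theta>" using assms(1) by (auto simp: Dfam_def)
  have "(\<lambda>fs. var i * \<theta> fs) \<in> Dp_deg l A \<alpha> m p (Suc a)"
    using homog_mult[OF homog_var Dp_deg_homog[OF \<theta>(1)]] assms(2)
    by (intro Dp_degI Dp_smult Dp_degD[OF \<theta>(1)] Svars_var) (auto simp: restr_def)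
  then show ?thesis unfolding Dfam_def \<theta>(2) by (rule rev_image_eqI) (simp add: restr_def)
qed

lemma Dfam_contract:
  assumes "c \<in> Dfam (Suc p) a" "i < l"
  shows "(\<lambda>is. c (i # is)) \<in> Dfam p a"
proof -
  obtain \<theta> where \<theta>: "\<theta> \<in> Dp_deg l A \<alpha> m (Suc p) a" "c = restr \<theta>" using assms(1) by (auto simp: Dfam_def)
  have "(\<lambda>fs. \<theta> (var i # fs)) \<in> Dp_deg l A \<alpha> m p a"
  proof (rule Dp_degI)
    show "(\<lambda>fs. \<theta> (var i # fs)) \<in> Dp l A \<alpha> m p"
      by (rule Dp_contract[OF Dp_degD[OF \<theta>(1)] Svars_var[OF assms(2)] \<alpha>_Svars])
    show "homog a (restr (\<lambda>fs. \<theta> (var i # fs)) is)" for "is"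
      using Dp_deg_homog[OF \<theta>(1), of "i # is"] by (simp add: restr_def)
  qed
  then show ?thesis unfolding Dfam_def \<theta>(2) by (rule rev_image_eqI) (simp add: restr_def)
qed

lemma Dp_deg_wedge:
  assumes "\<theta> \<in> Dp_deg l A \<alpha> m 1 e" "\<eta> \<in> Dp_deg l A \<alpha> m p a"
  shows "wedge (\<lambda>f. \<theta> [f]) \<eta> \<in> Dp_deg l A \<alpha> m (Suc p) (e + a)"
proof (rule Dp_degI)
  show "wedge (\<lambda>f. \<theta> [f]) \<eta> \<in> Dp l A \<alpha> m (Suc p)" by (intro Dp_wedge Dp_degD[OF assms(1)] Dp_degD[OF assms(2)])
  show "homog (e + a) (restr (wedge (\<lambda>f. \<theta> [f]) \<eta>) is)" for "is"
    unfolding restr_def wedge_map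
    using Dp_deg_homog[OF assms(1), of "[_]"] Dp_deg_homog[OF assms(2)] by (intro wedge_homog) (auto simp: restr_def)
qed

sublocale ao: arrangement_operators fscale Xop Yop l A "\<lambda>H. lin_coeff (\<alpha> H)" m
  by unfold_locales (use ma in \<open>auto simp: multiarrangement_def\<close>)

text \<open>Q d/du takes the value Q u_j at x_j, so on index lists the exterior product with it is
  \<open>wedge\<close> with these values.\<close>

lemma Dfam_wedge:
  assumes "ao.admissible Hs u" "c \<in> Dfam p a"
  shows "wedge (\<lambda>j. if j < l then prod_list (map \<alpha> Hs) * const (u j) else 0) c \<in> Dfam (Suc p) (length Hs + a)"
proof -
  obtain \<eta> where \<eta>: "\<eta> \<in> Dp_deg l A \<alpha> m p a" "c = restr \<eta>" using assms(2) by (auto simp: Dfam_def)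
  let ?\<theta> = "dir_der l (prod_list (map \<alpha> Hs)) u"
  have Hs: "set Hs \<subseteq> A" using assms(1) by (simp add: ao.admissible_def)
  have var: "?\<theta> [var j] = (if j < l then prod_list (map \<alpha> Hs) * const (u j) else 0)" for j
    using dir_der_var[of j l] by (auto simp: dir_der_def Svars_var_iff)
  have "?\<theta> \<in> Dp_deg l A \<alpha> m 1 (length Hs)"
  proof (rule Dp_degI)
    show "?\<theta> \<in> Dp l A \<alpha> m 1"
      by (rule dir_der_Dp) (use assms(1) linear_form_\<alpha> in \<open>auto simp: ao.admissible_def\<close>)
    have h: "homog (length Hs) (prod_list (map \<alpha> Hs))"
      by (rule homog_prod_list) (use Hs linear_form_\<alpha> in \<open>auto simp: linear_form_def\<close>)
    show "homog (length Hs) (restr ?\<theta> is)" for "is"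
    proof (cases "is")
      case (Cons j js)
      show ?thesis
      proof (cases "js = []")
        case True
        then show ?thesis using Cons homog_const_mult[OF h] by (simp add: restr_def var mult.commute)
      next
        case False
        then show ?thesis using Cons by (simp add: restr_def dir_der_def)
      qed
    qed (simp add: restr_def dir_der_def)
  qed
  then have mem: "wedge (\<lambda>f. ?\<theta> [f]) \<eta> \<in> Dp_deg l A \<alpha> m (Suc p) (length Hs + a)"
    by (rule Dp_deg_wedge[OF _ \<eta>(1)])
  have "restr (wedge (\<lambda>f. ?\<theta> [f]) \<eta>) = wedge (\<lambda>j. if j < l then prod_list (map \<alpha> Hs) * const (u j) else 0) c"
    by (rule ext) (simp add: restr_def wedge_map var \<eta>(2))
  then show ?thesis unfolding Dfam_def by (rule rev_image_eqI[OF mem sym])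
qed

section \<open>Cochains: polynomials in xi with coefficients in D^p\<close>

definition Wset :: "nat \<Rightarrow> nat multiset set" where
  "Wset b = {W. set_mset W \<subseteq> {..<l} \<and> size W = b}"

lemma finite_Wset: "finite (Wset b)"
  using finite_multisets_of_degree[of "{..<l}" "\<lambda>_. True" b 0] by (simp add: Wset_def xdeg_def sdeg_def)

lemma Wset_add: "i < l \<Longrightarrow> add_mset i W \<in> Wset (Suc b) \<longleftrightarrow> W \<in> Wset b"
  by (auto simp: Wset_def)

lemma Wset_diff: "i < l \<Longrightarrow> i \<in># W \<Longrightarrow> W - {#i#} \<in> Wset b \<longleftrightarrow> W \<in> Wset (Suc b)"
  by (metis Wset_add insert_DiffM)

definition C :: "nat \<Rightarrow> 'k cochain family" where
  "C p a b = {v. \<forall>W. if W \<in> Wset b then (\<lambda>is. v (W, is)) \<in> Dfam p a else (\<forall>is. v (W, is) = 0)}"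

text \<open>The free module over K[x, xi] on the index lists of length p, with neither derivation,
  alternation nor divisibility conditions. It is visibly finitely generated and contains
  \<open>C p\<close>, which gives finite dimension and finite generation of the submodules in
  use.\<close>

definition F :: "nat \<Rightarrow> 'k cochain family" where
  "F p a b = {v. \<forall>W is. if W \<in> Wset b \<and> length is = p \<and> set is \<subseteq> {..<l}
      then v (W, is) \<in> Svars l \<and> homog a (v (W, is)) else v (W, is) = 0}"

lemma F_outside: "v \<in> F p a b \<Longrightarrow> \<not> (W \<in> Wset b \<and> length is = p \<and> set is \<subseteq> {..<l}) \<Longrightarrow> v (W, is) = 0"
  unfolding F_def mem_Collect_eq by (metis (no_types, lifting))

lemma C_slice: "v \<in> C p a b \<Longrightarrow> W \<in> Wset b \<Longrightarrow> (\<lambda>is. v (W, is)) \<in> Dfam p a"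
  unfolding C_def by (auto dest!: spec[of _ W])

lemma C_outside: "v \<in> C p a b \<Longrightarrow> W \<notin> Wset b \<Longrightarrow> v (W, is) = 0"
  unfolding C_def by (auto dest!: spec[of _ W])

lemma C_subset_F: "C p a b \<subseteq> F p a b"
proof
  fix v assume v: "v \<in> C p a b"
  have "if W \<in> Wset b \<and> length is = p \<and> set is \<subseteq> {..<l}
      then v (W, is) \<in> Svars l \<and> homog a (v (W, is)) else v (W, is) = 0" for W "is"
  proof (cases "W \<in> Wset b")
    case True
    note sl = C_slice[OF v True]
    show ?thesis
      using True Dfam_Svars[OF sl, of "is"] Dfam_homog[OF sl, of "is"] Dfam_outside[OF sl, of "is"] by auto
  next
    case False
    then show ?thesis using C_outside[OF v False, of "is"] by simp
  qed
  then show "v \<in> F p a b" by (simp add: F_def)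
qed

lemma C_memI:
  assumes "\<And>W. W \<in> Wset b \<Longrightarrow> (\<lambda>is. v (W, is)) \<in> Dfam p a" "\<And>W is. W \<notin> Wset b \<Longrightarrow> v (W, is) = 0"
  shows "v \<in> C p a b"
  using assms by (simp add: C_def)

lemma subspace_C: "fs.subspace (C p a b)"
proof (rule fscale_subspaceI)
  show "(\<lambda>_. 0) \<in> C p a b" by (rule C_memI) (simp_all add: fscale_subspaceD(1)[OF subspace_Dfam])
  fix v w c assume v: "v \<in> C p a b"
  show "(\<lambda>x. const c * v x) \<in> C p a b"
    by (rule C_memI) (simp_all add: C_outside[OF v] fscale_subspaceD(3)[OF subspace_Dfam C_slice[OF v]])
  assume w: "w \<in> C p a b"
  show "(\<lambda>x. v x + w x) \<in> C p a b"
    by (rule C_memI) (simp_all add: C_outside[OF v] C_outside[OF w] fscale_subspaceD(2)[OF subspace_Dfam C_slice[OF v] C_slice[OF w]])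
qed

lemma stable_C: "bg.full.stable l (C p)"
proof (rule bg.stableI_forms)
  show "bg.full.subspaces (C p)" by (simp add: bg.full.subspaces_def subspace_C)
  fix i a b v assume i: "i < l" and v: "v \<in> C p a b"
  show "Xop i v \<in> C p (Suc a) b"
    by (rule C_memI) (auto simp: Xop_def C_outside[OF v] intro!: Dfam_var_mult[OF C_slice[OF v] i])
  show "Yop i v \<in> C p a (Suc b)"
  proof (rule C_memI)
    fix W assume W: "W \<in> Wset (Suc b)"
    show "(\<lambda>is. Yop i v (W, is)) \<in> Dfam p a"
    proof (cases "i \<in># W")
      case True
      then show ?thesis using C_slice[OF v] Wset_diff[OF i True] W by (simp add: Yop_def)
    next
      case False
      then show ?thesis using fscale_subspaceD(1)[OF subspace_Dfam] by (simp add: Yop_def)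
    qed
  next
    show "Yop i v (W, is) = 0" if "W \<notin> Wset (Suc b)" for W "is"
      using C_outside[OF v, of "W - {#i#}"] Wset_diff[OF i, of W b] that by (simp add: Yop_def)
  qed
qed

definition sg :: "nat multiset \<times> nat list \<Rightarrow> 'k mpoly \<Rightarrow> 'k cochain" where
  "sg q f = (\<lambda>x. if x = q then f else 0)"

definition unit_gens :: "nat \<Rightarrow> ('k cochain \<times> nat \<times> nat) set" where
  "unit_gens p = (\<lambda>is. (sg ({#}, is) 1, 0, 0)) ` {is. set is \<subseteq> {..<l} \<and> length is = p}"

lemma subspace_F: "fs.subspace (F p a b)"
  by (rule fscale_subspaceI) (auto simp: F_def intro!: Svars_add Svars_mult homog_add homog_const_mult)

lemma stable_F: "bg.full.stable l (F p)"
proof (rule bg.stableI_forms)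
  show "bg.full.subspaces (F p)" by (simp add: bg.full.subspaces_def subspace_F)
  fix i a b v assume i: "i < l" and v: "v \<in> F p a b"
  show "Xop i v \<in> F p (Suc a) b"
    unfolding F_def mem_Collect_eq
  proof (intro allI)
    fix W "is"
    have "if W \<in> Wset b \<and> length is = p \<and> set is \<subseteq> {..<l} then v (W, is) \<in> Svars l \<and> homog a (v (W, is)) else v (W, is) = 0"
      using v by (simp add: F_def)
    then show "if W \<in> Wset b \<and> length is = p \<and> set is \<subseteq> {..<l} then Xop i v (W, is) \<in> Svars l \<and> homog (Suc a) (Xop i v (W, is)) else Xop i v (W, is) = 0"
      using homog_mult[OF homog_var, of a "v (W, is)" i] Svars_mult[OF Svars_var[OF i], of "v (W, is)"]
      by (auto simp: Xop_def split: if_splits)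
  qed
  show "Yop i v \<in> F p a (Suc b)"
    using v Wset_diff[OF i] by (auto simp: F_def Yop_def)
qed

text \<open>An element is built from the unit generators by multiplying with monomials in xi, then
  with monomials in x, and by summing over the finitely many pairs (W, is).\<close>

lemma generated_F: "bg.full.generated l (unit_gens p) (F p) (\<lambda>_ _. {0})"
  unfolding bg.full.generated_def
proof (intro conjI allI impI)
  have "homog 0 1" by (metis homog_const const_1)
  then show "bg.full.contains (F p) (unit_gens p)"
    by (auto simp: bg.full.contains_def unit_gens_def F_def sg_def Wset_def)
  show "{0} \<subseteq> F p a b" for a b using fs.subspace_0[OF subspace_F] by simp
  fix V a b assume "bg.full.stable l V \<and> bg.full.contains V (unit_gens p) \<and> (\<forall>a b. {0} \<subseteq> V a b)"
  then have V: "bg.full.stable l V" "bg.full.contains V (unit_gens p)" by auto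
  have subV: "fs.subspace (V a b)" for a b by (rule bg.stable_subspace[OF V(1)])
  have sg0: "sg q 0 \<in> V a b" for q a b
    using fs.subspace_0[OF subV] by (simp add: sg_def zero_fun_def)
  have one: "sg (W, is) 1 \<in> V 0 (size W)" if "set is \<subseteq> {..<l}" "length is = p" "set_mset W \<subseteq> {..<l}" for W "is"
    using that(3)
  proof (induction W)
    case empty
    then show ?case using V(2) that(1,2) by (auto simp: bg.full.contains_def unit_gens_def)
  next
    case (add i W)
    have "Yop i (sg (W, is) 1) \<in> V 0 (Suc (size W))"
      using add V(1) by (auto simp: bg.full_stable_iff)
    moreover have "Yop i (sg (W, is) 1) = sg (add_mset i W, is) 1"
      by (auto simp: Yop_def sg_def fun_eq_iff)
    ultimately show ?case by simp
  qed
  have mono: "homog a f \<longrightarrow> sg (W, is) f \<in> V a (size W)"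
    if q: "set is \<subseteq> {..<l}" "length is = p" "set_mset W \<subseteq> {..<l}" and f: "f = Poly_Mapping.single k c" "Poly_Mapping.keys k \<subseteq> {..<l}" for W "is" a f k c
    unfolding f(1)
  \<comment> \<open>The degree is quantified inside the induction predicate because removing a
    variable lowers it by one.\<close>
  proof (rule spec[of _ a], rule single_in_closed[where l = l, OF _ _ f(2)])
    fix c
    show "\<forall>a. homog a (const c) \<longrightarrow> sg (W, is) (const c) \<in> V a (size W)"
    proof (intro allI impI)
      fix a assume h: "homog a (const c :: 'k mpoly)"
      show "sg (W, is) (const c) \<in> V a (size W)"
      proof (cases "c = 0")
        case False
        then have "a = 0" using h by (auto simp: homog_def const_def)
        moreover have "sg (W, is) (const c) = fscale c (sg (W, is) 1)"
          by (auto simp: sg_def fscale_def)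
        ultimately show ?thesis using one[OF q] fs.subspace_scale[OF subV] by simp
      qed (simp add: sg0)
    qed
  next
    fix f i assume IH: "\<forall>a. homog a f \<longrightarrow> sg (W, is) f \<in> V a (size W)" and i: "i < l"
    show "\<forall>a. homog a (var i * f) \<longrightarrow> sg (W, is) (var i * f) \<in> V a (size W)"
    proof (intro allI impI)
      fix a assume h: "homog a (var i * f)"
      have "var i \<noteq> (0 :: 'k mpoly)" by (metis keys_single keys_zero insert_not_empty var_def zero_neq_one)
      then have "f = 0 \<or> 1 \<le> a \<and> homog (a - 1) f" by (rule homog_cancel[OF homog_var _ h])
      then show "sg (W, is) (var i * f) \<in> V a (size W)"
      proof
        assume "1 \<le> a \<and> homog (a - 1) f"
        then obtain a' where a: "a = Suc a'" "homog a' f" by (cases a) auto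
        have "Xop i (sg (W, is) f) \<in> V a (size W)"
          using IH a i V(1) by (auto simp: bg.full_stable_iff)
        moreover have "Xop i (sg (W, is) f) = sg (W, is) (var i * f)"
          by (auto simp: Xop_def sg_def fun_eq_iff)
        ultimately show ?thesis by simp
      qed (simp add: sg0)
    qed
  qed
  have poly: "sg (W, is) f \<in> V a (size W)"
    if q: "set is \<subseteq> {..<l}" "length is = p" "set_mset W \<subseteq> {..<l}" and f: "f \<in> Svars l" "homog a f" for W "is" a f
  proof -
    have sg_add: "sg q (f + g) = sg q f + sg q g" "sg q 0 = 0" for q f g
      by (auto simp: sg_def fun_eq_iff)
    have "sg (W, is) (\<Sum>k\<in>K. Poly_Mapping.single k (Poly_Mapping.lookup f k)) = (\<Sum>k\<in>K. sg (W, is) (Poly_Mapping.single k (Poly_Mapping.lookup f k)))"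
      if "finite K" for K
      using that by (induction K rule: finite_induct) (simp_all add: sg_add)
    then have "sg (W, is) f = (\<Sum>k\<in>Poly_Mapping.keys f. sg (W, is) (Poly_Mapping.single k (Poly_Mapping.lookup f k)))"
      by (subst poly_mapping_sum_singles[of f]) simp
    also have "\<dots> \<in> V a (size W)"
    proof (rule fs.subspace_sum[OF subV])
      fix k assume k: "k \<in> Poly_Mapping.keys f"
      have "homog a (Poly_Mapping.single k (Poly_Mapping.lookup f k))" using f(2) k by (auto simp: homog_def)
      moreover have "Poly_Mapping.keys k \<subseteq> {..<l}" using f(1) k by (auto simp: Svars_def)
      ultimately show "sg (W, is) (Poly_Mapping.single k (Poly_Mapping.lookup f k)) \<in> V a (size W)"
        using mono[OF q refl, of k a "Poly_Mapping.lookup f k"] by blast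
    qed
    finally show ?thesis .
  qed
  show "F p a b \<subseteq> V a b"
  proof
    fix v assume v: "v \<in> F p a b"
    define Q where "Q = Wset b \<times> {is. set is \<subseteq> {..<l} \<and> length is = p}"
    have fin: "finite Q" unfolding Q_def by (intro finite_cartesian_product finite_Wset finite_lists_length_eq) simp
    have "(\<Sum>q\<in>Q. sg q (v q)) x = v x" for x
    proof -
      have "(\<Sum>q\<in>Q. sg q (v q)) x = (\<Sum>q\<in>Q. sg q (v q) x)"
        using fin by (induction Q rule: finite_induct) auto
      also have "\<dots> = (if x \<in> Q then v x else 0)"
        using fin by (simp add: sg_def)
      also have "\<dots> = v x"
      proof (cases "x \<in> Q")
        case False
        then show ?thesis using F_outside[OF v, of "fst x" "snd x"] by (cases x) (auto simp: Q_def)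
      qed simp
      finally show ?thesis .
    qed
    then have "v = (\<Sum>q\<in>Q. sg q (v q))" by (simp add: fun_eq_iff)
    also have "\<dots> \<in> V a b"
    proof (rule fs.subspace_sum[OF subV])
      fix q assume q: "q \<in> Q"
      obtain W "is" where "q = (W, is)" by (cases q)
      then show "sg q (v q) \<in> V a b"
        using q v poly[of "is" W "v q" a] by (auto simp: Q_def F_def Wset_def)
    qed
    finally show "v \<in> V a b" .
  qed
qed

lemma finite_unit_gens: "finite (unit_gens p)"
  unfolding unit_gens_def by (intro finite_imageI finite_lists_length_eq) simp

lemma findim_F: "fs.findim (F p a b)"
  by (rule bg.full.generated_findim[OF finite_unit_gens stable_F generated_F])

lemma findim_C: "fs.findim (C p a b)"
  by (rule fs.findim_subset[OF findim_F C_subset_F])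

end

text \<open>The terms at (i, j) and (j, i) cancel. The diagonal is assumed to vanish separately,
  since antisymmetry does not force it in characteristic 2.\<close>

lemma antisymmetric_sum_zero:
  fixes g :: "nat \<Rightarrow> nat \<Rightarrow> 'b::ab_group_add"
  assumes "\<And>i j. g i j = - g j i" "\<And>i. g i i = 0"
  shows "(\<Sum>i<n. \<Sum>j<n. g i j) = 0"
proof (induction n)
  case (Suc n)
  have "(\<Sum>i<Suc n. \<Sum>j<Suc n. g i j) = (\<Sum>i<n. \<Sum>j<n. g i j) + (\<Sum>i<n. g i n + g n i) + g n n"
    by (simp add: sum.distrib)
  also have "(\<Sum>i<n. g i n + g n i) = 0"
    by (intro sum.neutral) (metis assms(1) add.left_inverse)
  finally show ?case using Suc assms(2) by simp
qed simp

text \<open>The Hilbert series of K[xi] is 1 / (1-s)^l; with \<open>\<tau>\<close> constantly false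
  every variable counts towards s. In the induction the set of all monomials is its own colon set
  with respect to the last variable.\<close>

lemma count_series_all_multisets:
  "(1 - fps_X) ^ l * count_series (\<lambda>_. False) {U. set_mset U \<subseteq> {..<l}} = 1"
proof (induction l)
  case 0
  have "{U \<in> {U. set_mset U \<subseteq> {..<0::nat}}. xdeg (\<lambda>_. False) U = a \<and> sdeg (\<lambda>_. False) U = b} = (if a = 0 \<and> b = 0 then {{#}} else {})" for a b
    by (auto simp: xdeg_def sdeg_def)
  then have "count_series (\<lambda>_. False) {U. set_mset U \<subseteq> {..<0::nat}} = 1"
    by (auto simp: count_series_def fps_eq_iff)
  then show ?case by simp
next
  case (Suc l)
  let ?D = "\<lambda>l. {U. set_mset U \<subseteq> {..<l}}"
  have "down_closed {..<Suc l} (?D (Suc l))"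
    by (auto simp: down_closed_def dest: mset_subset_eqD)
  then have "count_series (\<lambda>_. False) (?D (Suc l)) = count_series (\<lambda>_. False) {U\<in>?D (Suc l). l \<notin># U} +
     fps_X * count_series (\<lambda>_. False) {U. add_mset l U \<in> ?D (Suc l)}"
    using count_series_split[of "{..<Suc l}" "?D (Suc l)" "\<lambda>_. False" l] by (simp add: zvar_def)
  moreover have "{U\<in>?D (Suc l). l \<notin># U} = ?D l" by (auto simp: less_Suc_eq)
  moreover have "{U. add_mset l U \<in> ?D (Suc l)} = ?D (Suc l)" by auto
  ultimately have "(1 - fps_X) * count_series (\<lambda>_. False) (?D (Suc l)) = count_series (\<lambda>_. False) (?D l)"
    by (simp add: algebra_simps)
  then have "(1 - fps_X) ^ l * ((1 - fps_X) * count_series (\<lambda>_. False) (?D (Suc l))) = 1"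
    using Suc by simp
  then show ?case by (simp add: mult.left_commute mult.assoc)
qed

context multiarr begin

text \<open>A cochain v is the sum of the v (W, _) times xi^W; the differential contracts with the
  tautological one-form, the sum of the xi_i dx_i.\<close>
definition \<delta> :: "'k cochain \<Rightarrow> 'k cochain" where
  "\<delta> v = (\<lambda>(W, is). \<Sum>i<l. if i \<in># W then v (W - {#i#}, i # is) else 0)"

lemma \<delta>_linear: "Vector_Spaces.linear fscale fscale \<delta>"
proof (rule fscale_linearI)
  show "\<delta> (v + w) = \<delta> v + \<delta> w" for v w
    by (auto simp: \<delta>_def fun_eq_iff sum.distrib[symmetric] intro!: sum.cong)
  show "\<delta> (fscale c v) = fscale c (\<delta> v)" for c v
    by (auto simp: \<delta>_def fun_eq_iff fscale_def sum_distrib_left intro!: sum.cong)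
qed

lemma \<delta>_Xop: "\<delta> (Xop i v) = Xop i (\<delta> v)"
  by (auto simp: \<delta>_def Xop_def fun_eq_iff sum_distrib_left intro!: sum.cong)

lemma \<delta>_Yop: "\<delta> (Yop j v) = Yop j (\<delta> v)"
proof -
  have "\<delta> (Yop j v) (W, is) = Yop j (\<delta> v) (W, is)" for W "is"
  proof -
    have "\<delta> (Yop j v) (W, is) = (\<Sum>i<l. if i \<in># W \<and> j \<in># W - {#i#} then v (W - {#i#} - {#j#}, i # is) else 0)"
      by (auto simp: \<delta>_def Yop_def intro!: sum.cong)
    also have "\<dots> = (\<Sum>i<l. if j \<in># W \<and> i \<in># W - {#j#} then v (W - {#j#} - {#i#}, i # is) else 0)"
    proof (rule sum.cong[OF refl])
      fix i
      show "(if i \<in># W \<and> j \<in># W - {#i#} then v (W - {#i#} - {#j#}, i # is) else 0) =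
        (if j \<in># W \<and> i \<in># W - {#j#} then v (W - {#j#} - {#i#}, i # is) else 0)"
        using diff_mset_swap[of i W j] by (simp add: add_mset_commute)
    qed
    also have "\<dots> = Yop j (\<delta> v) (W, is)"
      by (auto simp: \<delta>_def Yop_def intro!: sum.cong)
    finally show ?thesis .
  qed
  then show ?thesis by (simp add: fun_eq_iff)
qed

lemma Dfam_sum: "(\<And>i. i \<in> I \<Longrightarrow> f i \<in> Dfam p a) \<Longrightarrow> (\<lambda>is. \<Sum>i\<in>I. f i is) \<in> Dfam p a"
  by (induction I rule: infinite_finite_induct) (auto intro: fscale_subspaceD[OF subspace_Dfam])

lemma \<delta>_C:
  assumes v: "v \<in> C (Suc p) a b"
  shows "\<delta> v \<in> C p a (Suc b)"
proof (rule C_memI)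
  fix W assume W: "W \<in> Wset (Suc b)"
  have "(\<lambda>is. if i \<in># W then v (W - {#i#}, i # is) else 0) \<in> Dfam p a" if "i < l" for i
  proof (cases "i \<in># W")
    case True
    then show ?thesis using Dfam_contract[OF C_slice[OF v] that] Wset_diff[OF that True] W by simp
  next
    case False
    then show ?thesis using fscale_subspaceD(1)[OF subspace_Dfam] by simp
  qed
  then show "(\<lambda>is. \<delta> v (W, is)) \<in> Dfam p a"
    unfolding \<delta>_def prod.case by (intro Dfam_sum) simp
next
  fix W "is" assume W: "W \<notin> Wset (Suc b)"
  have "(if i \<in># W then v (W - {#i#}, i # is) else 0) = 0" if "i < l" for i
    using C_outside[OF v, of "W - {#i#}"] Wset_diff[OF that, of W b] W by auto
  then show "\<delta> v (W, is) = 0"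
    unfolding \<delta>_def prod.case by (intro sum.neutral) auto
qed

lemma \<delta>_C_0:
  assumes v: "v \<in> C 0 a b"
  shows "\<delta> v = 0"
proof -
  have "v (W, i # is) = 0" for W i "is"
    using C_outside[OF v] Dfam_outside[OF C_slice[OF v], of W "i # is"] by (cases "W \<in> Wset b") auto
  then have "\<delta> v (W, is) = 0" for W "is"
    unfolding \<delta>_def prod.case by (intro sum.neutral) auto
  then show ?thesis by (simp add: fun_eq_iff)
qed

text \<open>In the double contraction the product xi_i xi_j is symmetric in i and j, while the
  values on (x_i, x_j) alternate.\<close>

lemma \<delta>_\<delta>:
  assumes v: "v \<in> C p a b"
  shows "\<delta> (\<delta> v) = 0"
proof -
  have "\<delta> (\<delta> v) (W, is) = 0" for W "is"
  proof -
    define g where "g i j = (if i \<in># W \<and> j \<in># W - {#i#} then v (W - {#i#} - {#j#}, j # i # is) else 0)" for i j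
    have "\<delta> (\<delta> v) (W, is) = (\<Sum>i<l. \<Sum>j<l. g i j)"
      by (auto simp: \<delta>_def g_def intro!: sum.cong)
    also have "\<dots> = 0"
    proof (rule antisymmetric_sum_zero)
      have sw: "v (V, j # i # is) = - v (V, i # j # is)" for V i j
        using C_outside[OF v] Dfam_swap[OF C_slice[OF v], of V j i "is"] by (cases "V \<in> Wset b") auto
      have nd: "v (V, i # i # is) = 0" for V i
        using C_outside[OF v] Dfam_not_distinct[OF C_slice[OF v], of V "i # i # is"] by (cases "V \<in> Wset b") auto
      show "g i j = - g j i" for i j
        using diff_mset_swap[of i W j] sw[of "W - {#i#} - {#j#}" j i] by (simp add: g_def add_mset_commute)
      show "g i i = 0" for i by (simp add: g_def nd)
    qed
    finally show ?thesis .
  qed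
  then show ?thesis by (simp add: fun_eq_iff)
qed

definition Z :: "nat \<Rightarrow> 'k cochain family" where
  "Z p a b = {v\<in>C p a b. \<delta> v = 0}"

text \<open>Boundaries have positive degree in xi. The case b = 0 is separate because the truncated
  \<open>b - 1\<close> would admit an image of the cochains of degree 0.\<close>

definition B :: "nat \<Rightarrow> 'k cochain family" where
  "B p a b = (if b = 0 then {0} else \<delta> ` C (Suc p) a (b - 1))"

lemma module_hom_\<delta>: "module_hom fscale fscale \<delta>"
  using \<delta>_linear by (simp add: module_hom_iff_linear)

lemma stable_Z: "bg.full.stable l (Z p)"
proof (rule bg.stableI_forms)
  have "fs.subspace (Z p a b)" for a b
    using subspace_C[of p a b] unfolding fs.subspace_def Z_def
    by (auto simp: module_hom.add[OF module_hom_\<delta>] module_hom.scale[OF module_hom_\<delta>] module_hom.zero[OF module_hom_\<delta>])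
  then show "bg.full.subspaces (Z p)" by (simp add: bg.full.subspaces_def)
  fix i a b v assume i: "i < l" and v: "v \<in> Z p a b"
  have "Xop i v \<in> C p (Suc a) b" "Yop i v \<in> C p a (Suc b)"
    using stable_C[of p] i v unfolding bg.full_stable_iff Z_def by blast+
  moreover have "Xop i 0 = (0 :: 'k cochain)" "Yop i 0 = (0 :: 'k cochain)"
    by (auto simp: Xop_def Yop_def fun_eq_iff)
  ultimately show "Xop i v \<in> Z p (Suc a) b" "Yop i v \<in> Z p a (Suc b)"
    using v by (auto simp: Z_def \<delta>_Xop \<delta>_Yop)
qed

lemma stable_B: "bg.full.stable l (B p)"
proof (rule bg.stableI_forms)
  have "fs.subspace (B p a b)" for a b
    unfolding B_def by (auto intro: module_hom.subspace_image[OF module_hom_\<delta> subspace_C] fs.subspace_single_0)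
  then show "bg.full.subspaces (B p)" by (simp add: bg.full.subspaces_def)
  fix i a b v assume i: "i < l" and v: "v \<in> B p a b"
  have zero: "Xop i 0 = (0 :: 'k cochain)" "Yop i 0 = (0 :: 'k cochain)"
    by (auto simp: Xop_def Yop_def fun_eq_iff)
  note zero = zero module_hom.zero[OF module_hom_\<delta>]
  have mem: "Xop i w \<in> C (Suc p) (Suc a) b'" "Yop i w \<in> C (Suc p) a (Suc b')" if "w \<in> C (Suc p) a b'" for w b'
    using stable_C[of "Suc p"] i that unfolding bg.full_stable_iff by blast+
  show "Xop i v \<in> B p (Suc a) b"
    using v mem(1) by (auto simp: B_def zero \<delta>_Xop[symmetric] split: if_splits)
  show "Yop i v \<in> B p a (Suc b)"
  proof (cases b)
    case 0
    then have "Yop i v = \<delta> 0" using v zero by (simp add: B_def)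
    then show ?thesis using fs.subspace_0[OF subspace_C] by (auto simp: B_def)
  next
    case (Suc b')
    then show ?thesis using v mem(2) by (auto simp: B_def \<delta>_Yop[symmetric])
  qed
qed

lemma B_subset_Z: "B p a b \<subseteq> Z p a b"
proof (cases b)
  case 0
  then show ?thesis using fs.subspace_0[OF bg.stable_subspace[OF stable_Z]] by (simp add: B_def)
next
  case (Suc b')
  then show ?thesis using \<delta>_C \<delta>_\<delta> by (auto simp: B_def Z_def)
qed

lemma Xf_form: 
  assumes "H \<in> A"
  shows "bg.Xf l (lin_coeff (\<alpha> H)) v = (\<lambda>q. \<alpha> H * v q)"
proof
  fix q
  have "bg.Xf l (lin_coeff (\<alpha> H)) v q = (\<Sum>i<l. const (lin_coeff (\<alpha> H) i) * (var i * v q))"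
    unfolding bg.Xf_def by (induction l) (auto simp: fscale_def Xop_def)
  also have "\<dots> = (\<Sum>i<l. const (lin_coeff (\<alpha> H) i) * var i) * v q"
    by (simp add: sum_distrib_right mult.assoc)
  also have "\<dots> = \<alpha> H * v q"
    using linear_form_expand[OF linear_form_\<alpha>[OF assms]] by simp
  finally show "bg.Xf l (lin_coeff (\<alpha> H)) v q = \<alpha> H * v q" .
qed

lemma Xl_form:
  assumes "set Hs \<subseteq> A"
  shows "ao.Xl Hs v = (\<lambda>q. prod_list (map \<alpha> Hs) * v q)"
  using assms by (induction Hs arbitrary: v) (auto simp: Xf_form mult_ac)

lemma Yf_apply: "bg.Yf l u v (W, is) = (\<Sum>i<l. if i \<in># W then const (u i) * v (W - {#i#}, is) else 0)"
  unfolding bg.Yf_def by (induction l) (auto simp: fscale_def Yop_def)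

text \<open>Wedging with a logarithmic vector field is a contracting homotopy up to its symbol.\<close>
lemma killed_Z_B: "ao.killed (Z p) (B p)"
  unfolding ao.killed_def
proof (intro allI impI ballI)
  fix u Hs a b v assume adm: "ao.admissible Hs u" and v: "v \<in> Z p a b"
  have Hs: "set Hs \<subseteq> A" using adm by (simp add: ao.admissible_def)
  have vC: "v \<in> C p a b" and dv: "\<delta> v = 0" using v by (auto simp: Z_def)
  \<comment> \<open>The values of Q d/du on the variables, with Q the product of the forms in
    \<open>Hs\<close>.\<close>
  define d where "d j = (if j < l then prod_list (map \<alpha> Hs) * const (u j) else 0)" for j
  define w where "w = (\<lambda>(W, is). wedge d (\<lambda>js. v (W, js)) is)"
  have "w \<in> C (Suc p) (a + length Hs) b"
  proof (rule C_memI)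
    show "(\<lambda>is. w (W, is)) \<in> Dfam (Suc p) (a + length Hs)" if "W \<in> Wset b" for W
      using Dfam_wedge[OF adm C_slice[OF vC that]] by (simp add: w_def d_def[abs_def] add.commute)
    show "w (W, is) = 0" if "W \<notin> Wset b" for W "is"
    proof -
      have "(\<lambda>js. v (W, js)) = (\<lambda>_. 0)" using C_outside[OF vC that] by blast
      then show ?thesis by (simp add: w_def)
    qed
  qed
  moreover have "\<delta> w = ao.Xl Hs (bg.Yf l u v)"
  proof -
    have "\<delta> w (W, is) = ao.Xl Hs (bg.Yf l u v) (W, is)" for W "is"
    proof -
      let ?t = "\<lambda>i js. if i \<in># W then v (W - {#i#}, i # js) else 0"
      \<comment> \<open>One step of the \<open>wedge\<close> recursion under the sum over i: the
        first terms add up to Q u(xi) v, the second to the wedge of d with \<delta> v, which is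
        0.\<close>
      have "\<delta> w (W, is) = (\<Sum>i<l. (if i \<in># W then d i * v (W - {#i#}, is) else 0) - wedge d (?t i) is)"
        by (auto simp: \<delta>_def w_def intro!: sum.cong)
      also have "\<dots> = (\<Sum>i<l. if i \<in># W then d i * v (W - {#i#}, is) else 0) - wedge d (\<lambda>js. \<Sum>i<l. ?t i js) is"
        by (simp add: sum_subtractf wedge_sum)
      also have "(\<lambda>js. \<Sum>i<l. ?t i js) = (\<lambda>js. 0)"
        using fun_cong[OF dv, of "(W, _)"] by (simp add: \<delta>_def)
      also have "(\<Sum>i<l. if i \<in># W then d i * v (W - {#i#}, is) else 0) = ao.Xl Hs (bg.Yf l u v) (W, is)"
        by (auto simp: Xl_form[OF Hs] Yf_apply sum_distrib_left d_def mult.assoc intro!: sum.cong)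
      finally show ?thesis by simp
    qed
    then show ?thesis by (simp add: fun_eq_iff)
  qed
  ultimately show "ao.Xl Hs (bg.Yf l u v) \<in> B p (a + length Hs) (Suc b)"
    by (auto simp: B_def intro: image_eqI[OF sym])
qed

text \<open>The devissage starts with I empty and the standard bases. Its finiteness hypothesis
  holds because the cycles lie in the noetherian module \<open>F p\<close>.\<close>

lemma homology_mixed_rational: "mixed_rational l (bg.hs (Z p) - bg.hs (B p))"
proof -
  have ZF: "Z p a b \<subseteq> F p a b" for a b using C_subset_F by (auto simp: Z_def)
  obtain G where G: "finite G" "bg.full.generated l G (Z p) (\<lambda>_ _. {0})"
    using bg.full.noetherian[OF finite_unit_gens stable_F generated_F stable_Z ZF] by blast
  have gen: "bg.full.generated l G (Z p) (B p)"
    unfolding bg.full.generated_def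
  proof (intro conjI allI impI)
    show "bg.full.contains (Z p) G" by (rule bg.full.generated_contains[OF G(2)])
    show "B p a b \<subseteq> Z p a b" for a b by (rule B_subset_Z)
    fix W a b assume W: "bg.full.stable l W \<and> bg.full.contains W G \<and> (\<forall>a b. B p a b \<subseteq> W a b)"
    show "Z p a b \<subseteq> W a b"
      by (rule bg.full.generated_leastD[OF G(2)]) (use W fs.subspace_0[OF bg.stable_subspace] in auto)
  qed
  have dual: "bg.dual l (\<lambda>i a. of_bool (i = a) :: 'k) (\<lambda>i a. of_bool (i = a))"
    unfolding bg.dual_def
  proof (intro allI impI)
    fix a b assume "a < l" "b < l"
    have "(\<Sum>i<l. of_bool (i = a) * of_bool (i = b)) = (\<Sum>i<l. if i = a then of_bool (a = b) else (0 :: 'k))"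
      by (intro sum.cong) auto
    also have "\<dots> = of_bool (a = b)" using \<open>a < l\<close> by simp
    finally show "(\<Sum>i<l. of_bool (i = a) * of_bool (i = b)) = (of_bool (a = b) :: 'k)" .
  qed
  have fd: "fs.findim (Z p a b)" for a b
    by (rule fs.findim_subset[OF findim_F ZF])
  show ?thesis
    by (rule ao.mixed_rational_killed[OF G(1) gen stable_Z stable_B fd empty_subsetI dual _ killed_Z_B]) simp
qed

text \<open>The space is a direct sum of copies of D indexed by Ws; rank and nullity for the
  evaluation at one W splits off one copy at a time.\<close>

lemma dim_slices:
  assumes D: "fs.subspace D" and fin: "finite Ws"
    and fd: "fs.findim {v :: 'k cochain. \<forall>W. if W \<in> Ws then (\<lambda>is. v (W, is)) \<in> D else (\<forall>is. v (W, is) = 0)}"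
  shows "fs.dim {v :: 'k cochain. \<forall>W. if W \<in> Ws then (\<lambda>is. v (W, is)) \<in> D else (\<forall>is. v (W, is) = 0)} = card Ws * fs.dim D"
proof -
  define S where "S Ws = {v :: 'k cochain. \<forall>W. if W \<in> Ws then (\<lambda>is. v (W, is)) \<in> D else (\<forall>is. v (W, is) = 0)}" for Ws
  note D0 = fscale_subspaceD(1)[OF D]
  have Smem: "v \<in> S V \<longleftrightarrow> (\<forall>W\<in>V. (\<lambda>is. v (W, is)) \<in> D) \<and> (\<forall>W is. W \<notin> V \<longrightarrow> v (W, is) = 0)" for v V
    unfolding S_def by auto
  have zs: "(\<lambda>is. v (W, is)) \<in> D" if "\<And>is. v (W, is) = 0" for v :: "'k cochain" and W
    using D0 that by simp
  have "V \<subseteq> Ws \<Longrightarrow> fs.dim (S V) = card V * fs.dim D" if "finite V" for V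
    using that
  proof (induction V rule: finite_induct)
    case empty
    have "S {} = {0}" by (auto simp: Smem fun_eq_iff)
    then show ?case using fs.dim_eq_card[of "{}" "{0}"] by (simp add: fs.independent_empty)
  next
    case (insert W V)
    let ?r = "\<lambda>v :: 'k cochain. (\<lambda>is. v (W, is))"
    have lin: "Vector_Spaces.linear fscale fscale ?r"
      by (rule fscale_linearI) (auto simp: fscale_def fun_eq_iff)
    have sub: "fs.subspace (S (insert W V))"
      by (rule fscale_subspaceI) (auto simp: Smem D0 intro!: fscale_subspaceD[OF D])
    have "S (insert W V) \<subseteq> S Ws"
    proof
      fix v assume v: "v \<in> S (insert W V)"
      have "(\<lambda>is. v (W', is)) \<in> D" for W'
        using v zs[of v W'] by (cases "W' \<in> insert W V") (auto simp: Smem)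
      moreover have "v (W', is) = 0" if "W' \<notin> Ws" for W' "is"
        using v insert.prems that unfolding Smem by blast
      ultimately show "v \<in> S Ws" by (simp add: Smem)
    qed
    then have "fs.findim (S (insert W V))"
      using fd fs.findim_subset unfolding S_def by blast
    from fs_pair.dim_kernel_image[OF lin sub this]
    have "fs.dim (S (insert W V)) = fs.dim {v\<in>S (insert W V). ?r v = 0} + fs.dim (?r ` S (insert W V))" .
    moreover have "{v\<in>S (insert W V). ?r v = 0} = S V"
    proof (intro set_eqI iffI)
      fix v assume v: "v \<in> {v\<in>S (insert W V). ?r v = 0}"
      then have "v (W, is) = 0" for "is" by (simp add: fun_eq_iff)
      then have "v (W', is) = 0" if "W' \<notin> V" for W' "is"
        using v that by (cases "W' = W") (auto simp: Smem)
      then show "v \<in> S V" using v by (auto simp: Smem)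
    next
      fix v assume v: "v \<in> S V"
      have "v (W, is) = 0" for "is" using v insert.hyps(2) by (simp add: Smem)
      then show "v \<in> {v\<in>S (insert W V). ?r v = 0}"
        using v zs[of v W] by (auto simp: Smem zero_fun_def)
    qed
    moreover have "?r ` S (insert W V) = D"
    proof
      show "?r ` S (insert W V) \<subseteq> D" by (auto simp: Smem)
      show "D \<subseteq> ?r ` S (insert W V)"
      proof
        fix c assume c: "c \<in> D"
        have "(\<lambda>(W', is). if W' = W then c is else 0) \<in> S (insert W V)"
          unfolding Smem
        proof (intro conjI ballI allI impI)
          fix W' assume "W' \<in> insert W V"
          show "(\<lambda>is. case (W', is) of (W', is) \<Rightarrow> if W' = W then c is else 0) \<in> D"
            using c D0 by (cases "W' = W") auto
        qed auto
        then show "c \<in> ?r ` S (insert W V)" by (rule rev_image_eqI) simp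
      qed
    qed
    ultimately show ?case using insert by simp
  qed
  then show ?thesis using fin unfolding S_def by blast
qed

lemma dim_C: "fs.dim (C p a b) = card (Wset b) * fs.dim (Dfam p a)"
  unfolding C_def by (rule dim_slices[OF subspace_Dfam finite_Wset]) (use findim_C in \<open>simp add: C_def\<close>)

text \<open>\<open>Dfam p a\<close> is recovered from \<open>C p a 0\<close> as the coefficient of
  the monomial 1 in xi.\<close>

lemma findim_Dfam: "fs.findim (Dfam p a)"
proof -
  let ?r = "\<lambda>v :: 'k cochain. (\<lambda>is. v ({#}, is))"
  have "Vector_Spaces.linear fscale fscale ?r"
    by (rule fscale_linearI) (auto simp: fscale_def fun_eq_iff)
  then have "fs.findim (?r ` C p a 0)" by (rule fs_pair.findim_image[OF _ findim_C])
  moreover have "Dfam p a \<subseteq> ?r ` C p a 0"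
  proof
    fix c assume c: "c \<in> Dfam p a"
    have "(\<lambda>(W, is). if W = {#} then c is else 0) \<in> C p a 0"
      using c by (intro C_memI) (auto simp: Wset_def)
    then show "c \<in> ?r ` C p a 0" by (rule rev_image_eqI) simp
  qed
  ultimately show ?thesis by (rule fs.findim_subset)
qed

lemma findim_Dp_deg: "fs.findim (Dp_deg l A \<alpha> m p a)"
  by (rule fs_pair.findim_of_injective_image[OF restr_linear subspace_Dp_deg _ restr_eq_0])
     (use findim_Dfam in \<open>simp_all add: Dfam_def\<close>)

lemma dim_Dfam: "fs.dim (Dfam p a) = fs.dim (Dp_deg l A \<alpha> m p a)"
  unfolding Dfam_def
  by (rule fs_pair.dim_injective_image[OF restr_linear subspace_Dp_deg findim_Dp_deg restr_eq_0])

section \<open>Hilbert series of the complex and Euler characteristic\<close>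

lemma Hilb_nth: "fps_nth (Hilb l A \<alpha> m p) d = int (fs.dim (Dp_deg l A \<alpha> m p d))"
  by (simp add: Hilb_def dscale_eq_fscale)

lemma hs_C: "bg.hs (C p) = fps_const (Hilb l A \<alpha> m p) * count_series (\<lambda>_. False) {U. set_mset U \<subseteq> {..<l}}"
proof -
  have card: "card {U \<in> {U. set_mset U \<subseteq> {..<l}}. xdeg (\<lambda>_. False) U = a \<and> sdeg (\<lambda>_. False) U = b} = (if a = 0 then card (Wset b) else 0)" for a b
    by (auto simp: Wset_def xdeg_def sdeg_def)
  then have "fps_nth (count_series (\<lambda>_. False) {U. set_mset U \<subseteq> {..<l}}) b = fps_const (int (card (Wset b)))" for b
    by (simp add: count_series_def fps_eq_iff)
  note N = this
  have "fps_nth (bg.hs (C p)) b = fps_nth (fps_const (Hilb l A \<alpha> m p) * count_series (\<lambda>_. False) {U. set_mset U \<subseteq> {..<l}}) b" for b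
    unfolding fps_mult_left_const_nth N by (simp add: fps_eq_iff dim_C dim_Dfam Hilb_nth mult.commute)
  then show ?thesis by (rule fps_ext)
qed

lemma dim_C_split: "fs.dim (C p a b) = fs.dim (Z p a b) + fs.dim (\<delta> ` C p a b)"
  using fs_pair.dim_kernel_image[OF \<delta>_linear subspace_C findim_C] by (simp add: Z_def)

lemma dim_zero: "fs.dim ({0} :: ('x \<Rightarrow> 'k mpoly) set) = 0"
  using fs.dim_eq_card[of "{}" "{0}"] by (simp add: fs.independent_empty)

lemma hs_C_0: "bg.hs (C 0) = bg.hs (Z 0)"
  by (auto simp: Z_def \<delta>_C_0 intro!: arg_cong[where f = hseries] ext arg_cong[where f = "\<lambda>V. int (fs.dim V)"])

text \<open>Rank and nullity for \<delta> in each bidegree. The factor s matches the image of degree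
  b with boundaries of degree b + 1.\<close>

lemma hs_C_Suc: "fps_X * bg.hs (C (Suc p)) = fps_X * bg.hs (Z (Suc p)) + bg.hs (B p)"
  by (auto simp: fps_eq_iff B_def dim_zero dim_C_split)

lemma B_top: "B l a b = {0}"
proof -
  have "C (Suc l) a b = {0}" for b
  proof -
    have "v = 0" if v: "v \<in> C (Suc l) a b" for v
    proof -
      have "v (W, is) = 0" for W "is"
        using C_outside[OF v] Dfam_too_long[OF C_slice[OF v]] by (cases "W \<in> Wset b") auto
      then show ?thesis by (simp add: fun_eq_iff)
    qed
    then show ?thesis using fs.subspace_0[OF subspace_C] by blast
  qed
  then show ?thesis using module_hom.zero[OF module_hom_\<delta>] by (simp add: B_def)
qed

text \<open>The weights (-s)^p compensate the degree shift of \<delta>, so the boundary terms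
  telescope and only that of \<open>B n\<close> remains; it vanishes for n = l.\<close>

lemma euler_characteristic:
  "(\<Sum>p\<le>n. (- fps_X) ^ p * bg.hs (C p)) = (\<Sum>p\<le>n. (- fps_X) ^ p * (bg.hs (Z p) - bg.hs (B p))) + (- fps_X) ^ n * bg.hs (B n)"
proof (induction n)
  case 0
  then show ?case by (simp add: hs_C_0)
next
  case (Suc n)
  have "(- fps_X) ^ Suc n * bg.hs (C (Suc n)) = - ((- fps_X) ^ n * (fps_X * bg.hs (C (Suc n))))" by simp
  also have "\<dots> = (- fps_X) ^ Suc n * bg.hs (Z (Suc n)) - (- fps_X) ^ n * bg.hs (B n)"
    unfolding hs_C_Suc by (simp add: algebra_simps)
  finally show ?case using Suc by (simp add: algebra_simps)
qed

theorem poly_coeffs_psi: "poly_coeffs (psi l A \<alpha> m)"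
  unfolding psi_def
proof (rule poly_coeffs_of_mixed_rational)
  let ?N = "count_series (\<lambda>_. False) {U. set_mset U \<subseteq> {..<l}}"
  define h where "h = (\<Sum>p\<le>l. (- fps_X) ^ p * (bg.hs (Z p) - bg.hs (B p)))"
  have "mixed_rational l (\<Sum>p\<in>P. (- fps_X) ^ p * (bg.hs (Z p) - bg.hs (B p)))" if "finite P" for P
    using that by (induction P rule: finite_induct)
      (auto intro!: mixed_rational_add mixed_rational_mult homology_mixed_rational bipoly_power bipoly_neg_X)
  then show "mixed_rational l h" unfolding h_def by simp
  have "bg.hs (B l) = 0" by (simp add: fps_eq_iff B_top dim_zero)
  then have h: "h = (\<Sum>p\<le>l. (- fps_X) ^ p * (fps_const (Hilb l A \<alpha> m p) * ?N))"
    using euler_characteristic[of l] by (simp add: h_def hs_C)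
  \<comment> \<open>Multiplying by (1-s)^l removes the Hilbert series of K[xi] from every
    term.\<close>
  have "(1 - fps_X) ^ l * h = (\<Sum>p\<le>l. (- fps_X) ^ p * fps_const (Hilb l A \<alpha> m p)) * ((1 - fps_X) ^ l * ?N)"
    unfolding h by (simp add: sum_distrib_left sum_distrib_right mult_ac)
  then show "(\<Sum>p\<le>l. (- fps_X) ^ p * fps_const (Hilb l A \<alpha> m p)) = (1 - fps_X) ^ l * h"
    by (simp add: count_series_all_multisets)
qed

end

section \<open>Splitting off the good summand\<close>

lemma multider_cancel:
  assumes h: "is_multider l p (\<lambda>fs. h * \<eta> fs)" "h \<noteq> 0" and S: "\<And>fs. \<eta> fs \<in> Svars l"
  shows "is_multider l p (\<eta> :: 'k::field mpoly list \<Rightarrow> 'k mpoly)"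
proof (rule is_multiderI)
  show "\<eta> fs \<in> Svars l" for fs by (rule S)
  show "\<eta> fs = 0" if "\<not> (length fs = p \<and> set fs \<subseteq> Svars l)" for fs
    using multider_outside[OF h(1) that] h(2) by simp
  fix fs :: "'k mpoly list" and j :: nat and f g :: "'k mpoly" and c :: 'k
  assume v: "length fs = p" "set fs \<subseteq> Svars l" "j < p" "f \<in> Svars l"
  have "h * \<eta> (fs[j := const c * f]) = h * (const c * \<eta> (fs[j := f]))"
    unfolding multider_const[OF h(1) v] by (rule mult.left_commute)
  then show "\<eta> (fs[j := const c * f]) = const c * \<eta> (fs[j := f])" using h(2) by (simp only: mult_cancel_left) simp
  assume g: "g \<in> Svars l"
  have "h * \<eta> (fs[j := f + g]) = h * (\<eta> (fs[j := f]) + \<eta> (fs[j := g]))"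
    unfolding multider_add[OF h(1) v g] by (rule distrib_left[symmetric])
  then show "\<eta> (fs[j := f + g]) = \<eta> (fs[j := f]) + \<eta> (fs[j := g])" using h(2) by (simp only: mult_cancel_left) simp
  have "h * \<eta> (fs[j := f * g]) = h * (f * \<eta> (fs[j := g]) + g * \<eta> (fs[j := f]))"
    unfolding multider_mult[OF h(1) v g] by (simp only: distrib_left mult.left_commute)
  then show "\<eta> (fs[j := f * g]) = f * \<eta> (fs[j := g]) + g * \<eta> (fs[j := f])" using h(2) by (simp only: mult_cancel_left) simp
next
  show "\<eta> fs = 0" if "length fs = p" "i < j" "j < p" "fs ! i = fs ! j" for fs i j
    using multider_alt[OF h(1), of i j fs] that h(2) by simp
qed

locale good_multiarr = multiarr l A \<alpha> m
  for l :: nat and A :: "(nat \<Rightarrow> 'k::field) set set" and \<alpha> m +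
  fixes H0 :: "(nat \<Rightarrow> 'k) set" and \<theta>0 :: "'k mpoly list \<Rightarrow> 'k mpoly"
  assumes H0: "H0 \<in> A" and good: "good_summand l A \<alpha> m H0 \<theta>0"
begin

definition D0 :: "nat \<Rightarrow> nat \<Rightarrow> ('k mpoly list \<Rightarrow> 'k mpoly) set" where
  "D0 p d = {\<theta>\<in>Dp_deg l A \<alpha> m p d. \<forall>fs. \<theta> (\<alpha> H0 # fs) = 0}"

definition ct :: "('k mpoly list \<Rightarrow> 'k mpoly) \<Rightarrow> 'k mpoly list \<Rightarrow> 'k mpoly" where
  "ct \<theta> = (\<lambda>fs. \<theta> (\<alpha> H0 # fs))"

lemma \<theta>0_deg: "\<theta>0 \<in> Dp_deg l A \<alpha> m 1 (m H0)"
proof -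
  have "homog (m H0) (\<theta>0 (map var is))" if "length is = 1" "\<forall>i\<in>set is. i < l" for "is"
    using good that by (cases "is") (auto simp: good_summand_def)
  then show ?thesis using good by (auto simp: Dp_deg_def good_summand_def)
qed

lemma \<alpha>0_power: "\<alpha> H0 ^ m H0 \<noteq> 0" "homog (m H0) (\<alpha> H0 ^ m H0)" "\<alpha> H0 ^ m H0 \<in> Svars l"
  using linear_form_\<alpha>[OF H0] homog_power[of 1 "\<alpha> H0" "m H0"]
  by (auto simp: linear_form_def intro: Svars_power)

lemma \<alpha>0_not_proportional:
  assumes "H \<in> A" "H \<noteq> H0"
  shows "\<alpha> H0 \<noteq> const c * \<alpha> H"
proof
  assume eq: "\<alpha> H0 = const c * \<alpha> H"
  then have "c \<noteq> 0" using linear_form_\<alpha>[OF H0] by (auto simp: linear_form_def)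
  then have "kernel l (\<alpha> H0) = kernel l (\<alpha> H)" unfolding eq by (rule kernel_proportional)
  moreover have "H = kernel l (\<alpha> H)" "H0 = kernel l (\<alpha> H0)"
    using ma assms(1) H0 unfolding multiarrangement_def by blast+
  ultimately show False using assms(2) by simp
qed

lemma ct_linear: "Vector_Spaces.linear fscale fscale ct"
  by (rule fscale_linearI) (auto simp: ct_def fscale_def fun_eq_iff)

lemma D0_kernel: "D0 p d = {\<theta>\<in>Dp_deg l A \<alpha> m p d. ct \<theta> = 0}"
  by (auto simp: D0_def ct_def fun_eq_iff)

lemma subspace_D0: "fs.subspace (D0 p d)"
proof -
  have hom: "module_hom fscale fscale ct" using ct_linear by (simp add: module_hom_iff_linear)
  show ?thesis
    using subspace_Dp_deg[of p d] unfolding fs.subspace_def D0_kernel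
    by (auto simp: module_hom.add[OF hom] module_hom.scale[OF hom] module_hom.zero[OF hom])
qed

lemma findim_D0: "fs.findim (D0 p d)"
  by (rule fs.findim_subset[OF findim_Dp_deg]) (auto simp: D0_def)

text \<open>For H other than H0 the forms are coprime, so divisibility by \<alpha> H ^ m H survives
  the division by \<alpha> H0 ^ m H0. At H0 itself the quotient vanishes because \<theta> does so on
  the repeated argument.\<close>

lemma ct_quotient:
  assumes \<theta>: "\<theta> \<in> Dp_deg l A \<alpha> m (Suc p) d"
  obtains \<eta> where "\<eta> \<in> Dp l A \<alpha> m p" "\<And>fs. \<theta> (\<alpha> H0 # fs) = \<alpha> H0 ^ m H0 * \<eta> fs" "\<And>fs. \<eta> (\<alpha> H0 # fs) = 0"
proof -
  have "\<forall>fs. \<exists>q\<in>Svars l. \<theta> (\<alpha> H0 # fs) = \<alpha> H0 ^ m H0 * q"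
    using Dp_divisible[OF Dp_degD[OF \<theta>] H0] by blast
  then obtain \<eta> where \<eta>: "\<And>fs. \<eta> fs \<in> Svars l" "\<And>fs. \<theta> (\<alpha> H0 # fs) = \<alpha> H0 ^ m H0 * \<eta> fs"
    by metis
  note md = Dp_deg_multider[OF \<theta>]
  have z: "\<eta> (\<alpha> H0 # fs) = 0" for fs
    using \<eta>(2)[of "\<alpha> H0 # fs"] multider_not_distinct[OF md, of "\<alpha> H0 # \<alpha> H0 # fs"] \<alpha>0_power(1) by auto
  have "\<eta> \<in> Dp l A \<alpha> m p"
  proof (rule DpI)
    have "is_multider l p (\<lambda>fs. \<alpha> H0 ^ m H0 * \<eta> fs)"
      using multider_contract[OF md \<alpha>_Svars[OF H0]] by (simp add: \<eta>(2))
    then show "is_multider l p \<eta>" by (rule multider_cancel[OF _ \<alpha>0_power(1) \<eta>(1)])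
    fix H fs assume H: "H \<in> A"
    show "\<exists>q\<in>Svars l. \<eta> (\<alpha> H # fs) = \<alpha> H ^ m H * q"
    proof (cases "H = H0")
      case True
      then show ?thesis using z by (intro bexI[of _ 0]) auto
    next
      case False
      obtain q where q: "q \<in> Svars l" "\<theta> (\<alpha> H # \<alpha> H0 # fs) = \<alpha> H ^ m H * q"
        using Dp_divisible[OF Dp_degD[OF \<theta>] H] by metis
      have "\<alpha> H ^ m H * (- q) = \<alpha> H0 ^ m H0 * \<eta> (\<alpha> H # fs)"
        using multider_swap[OF md \<alpha>_Svars[OF H0] \<alpha>_Svars[OF H], of fs] q(2) \<eta>(2)[of "\<alpha> H # fs"] by simp
      then show ?thesis
        by (rule linear_form_power_coprime[OF linear_form_\<alpha>[OF H] linear_form_\<alpha>[OF H0]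
              \<alpha>0_not_proportional[OF H False] \<eta>(1) Svars_uminus[OF q(1)]])
    qed
  qed
  then show ?thesis using that \<eta>(2) z by blast
qed

definition mul0 :: "('k mpoly list \<Rightarrow> 'k mpoly) \<Rightarrow> 'k mpoly list \<Rightarrow> 'k mpoly" where
  "mul0 \<eta> = (\<lambda>fs. \<alpha> H0 ^ m H0 * \<eta> fs)"

lemma mul0_linear: "Vector_Spaces.linear fscale fscale mul0"
  by (rule fscale_linearI) (auto simp: mul0_def fscale_def fun_eq_iff distrib_left mult.left_commute)

text \<open>The good summand splits off: contraction with alpha_0 followed by division by its power has
  the section eta |-> theta_0 wedge eta.\<close>
lemma ct_image:
  "ct ` Dp_deg l A \<alpha> m (Suc p) d = (if d < m H0 then {0} else mul0 ` D0 p (d - m H0))"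
proof -
  have sub: "ct \<theta> \<in> (if d < m H0 then {0} else mul0 ` D0 p (d - m H0))"
    if \<theta>: "\<theta> \<in> Dp_deg l A \<alpha> m (Suc p) d" for \<theta>
  proof -
    obtain \<eta> where \<eta>: "\<eta> \<in> Dp l A \<alpha> m p" "\<And>fs. \<theta> (\<alpha> H0 # fs) = \<alpha> H0 ^ m H0 * \<eta> fs" "\<And>fs. \<eta> (\<alpha> H0 # fs) = 0"
      using ct_quotient[OF \<theta>] by blast
    \<comment> \<open>Homogeneity is given on variables only, so \<alpha> H0 is expanded in
      them.\<close>
    have "homog d (\<theta> (\<alpha> H0 # map var is))" for "is"
    proof -
      have "\<theta> (\<alpha> H0 # map var is) = (\<Sum>i<l. const (lin_coeff (\<alpha> H0) i) * \<theta> (var i # map var is))"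
        by (subst linear_form_expand[OF linear_form_\<alpha>[OF H0]])
           (rule multider_cons_sum[OF Dp_deg_multider[OF \<theta>]], auto intro: Svars_var)
      also have "homog d \<dots>"
        using Dp_deg_homog[OF \<theta>, of "_ # is"] by (intro homog_sum homog_const_mult) (simp add: restr_def)
      finally show ?thesis .
    qed
    then have hd: "restr \<eta> is = 0 \<or> m H0 \<le> d \<and> homog (d - m H0) (restr \<eta> is)" for "is"
      using homog_cancel[OF \<alpha>0_power(2,1), of d "restr \<eta> is"] \<eta>(2) by (simp add: restr_def)
    have ct: "ct \<theta> = mul0 \<eta>" by (auto simp: ct_def mul0_def \<eta>(2))
    show ?thesis
    proof (cases "d < m H0")
      case True
      then have "\<eta> (map var is) = 0" for "is" using hd[of "is"] by (auto simp: restr_def)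
      then have "\<eta> fs = 0" for fs by (rule multider_determined[OF Dp_multider[OF \<eta>(1)]])
      then show ?thesis using True ct by (auto simp: mul0_def fun_eq_iff)
    next
      case False
      have "\<eta> \<in> Dp_deg l A \<alpha> m p (d - m H0)"
        by (rule Dp_degI[OF \<eta>(1)]) (use hd in \<open>metis homog_0\<close>)
      then show ?thesis using False ct \<eta>(3) by (auto simp: D0_def)
    qed
  qed
  have sup: "mul0 \<eta> \<in> ct ` Dp_deg l A \<alpha> m (Suc p) d" if "m H0 \<le> d" "\<eta> \<in> D0 p (d - m H0)" for \<eta>
  proof -
    have \<eta>: "\<eta> \<in> Dp_deg l A \<alpha> m p (d - m H0)" "\<And>fs. \<eta> (\<alpha> H0 # fs) = 0" using that(2) by (auto simp: D0_def)
    have "wedge (\<lambda>f. \<theta>0 [f]) \<eta> \<in> Dp_deg l A \<alpha> m (Suc p) d"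
      using Dp_deg_wedge[OF \<theta>0_deg \<eta>(1)] that(1) by simp
    moreover have "mul0 \<eta> = ct (wedge (\<lambda>f. \<theta>0 [f]) \<eta>)"
      using good by (auto simp: ct_def mul0_def \<eta>(2) good_summand_def)
    ultimately show ?thesis by blast
  qed
  have "0 \<in> ct ` Dp_deg l A \<alpha> m (Suc p) d"
    by (rule image_eqI[of _ _ 0]) (auto simp: ct_def fun_eq_iff fs.subspace_0[OF subspace_Dp_deg])
  then show ?thesis using sub sup by (auto simp: not_less)
qed

text \<open>Rank and nullity for \<open>ct\<close>: the kernel is \<open>D0\<close>, and the image
  is a copy of \<open>D0 p (d - m H0)\<close> under the injective \<open>mul0\<close>, or 0 in
  degrees below m H0.\<close>

lemma dim_Dp_deg_split:
  "fs.dim (Dp_deg l A \<alpha> m (Suc p) d) = fs.dim (D0 (Suc p) d) + (if d < m H0 then 0 else fs.dim (D0 p (d - m H0)))"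
proof -
  have "fs.dim (mul0 ` D0 p e) = fs.dim (D0 p e)" for e
    by (rule fs_pair.dim_injective_image[OF mul0_linear subspace_D0 findim_D0])
       (use \<alpha>0_power(1) in \<open>auto simp: mul0_def fun_eq_iff\<close>)
  then show ?thesis
    using fs_pair.dim_kernel_image[OF ct_linear subspace_Dp_deg findim_Dp_deg, of "Suc p" d]
    by (simp add: D0_kernel[symmetric] ct_image dim_zero)
qed

lemma D0_0: "D0 0 d = Dp_deg l A \<alpha> m 0 d"
  using multider_cons_0[OF Dp_deg_multider] by (auto simp: D0_def)

text \<open>Each contraction with a leading index other than i still vanishes with i in front, by a
  swap, so the induction can strip leading indices until i is reached.\<close>

lemma Dfam_vanish:
  assumes "c \<in> Dfam p a" "\<And>js. c (i # js) = 0" "i \<in> set is"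
  shows "c is = 0"
  using assms
proof (induction "is" arbitrary: c p)
  case (Cons j js)
  show ?case
  proof (cases "j = i \<or> j \<ge> l \<or> p = 0")
    case True
    then show ?thesis using Cons.prems Dfam_outside[OF Cons.prems(1), of "j # js"] by auto
  next
    case False
    then obtain p' where p: "p = Suc p'" by (cases p) auto
    have "(\<lambda>ks. c (j # ks)) \<in> Dfam p' a" using Dfam_contract[of c p' a j] Cons.prems(1) p False by simp
    moreover have "c (j # i # ks) = 0" for ks
      using Dfam_swap[OF Cons.prems(1), of j i ks] Cons.prems(2) by simp
    ultimately show ?thesis using Cons.IH[of "\<lambda>ks. c (j # ks)" p'] Cons.prems(3) False by simp
  qed
qed simp

text \<open>In top degree, contraction with a nonzero covector is injective. An index i with nonzero
  coefficient in \<alpha> H0 is placed first; every list of l distinct indices contains it.\<close>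

lemma D0_top: "D0 l d = {0}"
proof -
  have "\<theta> = 0" if \<theta>: "\<theta> \<in> D0 l d" for \<theta>
  proof -
    have deg: "\<theta> \<in> Dp_deg l A \<alpha> m l d" and van: "\<And>fs. \<theta> (\<alpha> H0 # fs) = 0" using \<theta> by (auto simp: D0_def)
    have c: "restr \<theta> \<in> Dfam l d" using deg by (simp add: Dfam_def)
    obtain i where i: "i < l" "lin_coeff (\<alpha> H0) i \<noteq> 0"
      by (rule linear_form_nonzero_coeff[OF linear_form_\<alpha>[OF H0]])
    have full: "set is = {..<l}" if "distinct is" "length is = l" "set is \<subseteq> {..<l}" for "is"
      by (rule card_subset_eq) (use that in \<open>auto simp: distinct_card\<close>)
    have front: "restr \<theta> (i # js) = 0" for js
    proof (cases "distinct (i # js) \<and> length (i # js) = l \<and> set (i # js) \<subseteq> {..<l}")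
      case True
      then have js: "set js = {..<l} - {i}" using full[of "i # js"] by auto
      have "0 = \<theta> ((\<Sum>k<l. const (lin_coeff (\<alpha> H0) k) * var k) # map var js)"
        using van linear_form_expand[OF linear_form_\<alpha>[OF H0]] by metis
      also have "\<dots> = (\<Sum>k<l. const (lin_coeff (\<alpha> H0) k) * restr \<theta> (k # js))"
        unfolding restr_def list.map
        by (rule multider_cons_sum[OF Dp_deg_multider[OF deg]]) (auto intro: Svars_var)
      \<comment> \<open>For k other than i the variable x_k already occurs in \<open>js\<close>, so
        that term vanishes by alternation.\<close>
      also have "\<dots> = (\<Sum>k<l. if k = i then const (lin_coeff (\<alpha> H0) i) * restr \<theta> (i # js) else 0)"
        using Dfam_not_distinct[OF c] js by (intro sum.cong) auto
      also have "\<dots> = const (lin_coeff (\<alpha> H0) i) * restr \<theta> (i # js)" using i(1) by simp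
      finally show ?thesis using i(2) by simp
    next
      case False
      then show ?thesis using Dfam_not_distinct[OF c] Dfam_outside[OF c] by blast
    qed
    have "restr \<theta> is = 0" for "is"
    proof (cases "distinct is \<and> length is = l \<and> set is \<subseteq> {..<l}")
      case True
      then have "i \<in> set is" using full i(1) by auto
      then show ?thesis by (rule Dfam_vanish[OF c front])
    next
      case False
      then show ?thesis using Dfam_not_distinct[OF c] Dfam_outside[OF c] by blast
    qed
    then show "\<theta> = 0" by (intro restr_eq_0[OF deg]) (simp add: fun_eq_iff)
  qed
  then show ?thesis using fs.subspace_0[OF subspace_D0] by blast
qed

section \<open>Factorisation of the series psi\<close>

definition Hilb0 :: "nat \<Rightarrow> int fps" where
  "Hilb0 p = Abs_fps (\<lambda>d. int (fs.dim (D0 p d)))"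

lemma Hilb_0: "Hilb l A \<alpha> m 0 = Hilb0 0"
  by (simp add: fps_eq_iff Hilb_nth Hilb0_def D0_0)

lemma Hilb_Suc: "Hilb l A \<alpha> m (Suc p) = Hilb0 (Suc p) + fps_X ^ m H0 * Hilb0 p"
  by (simp add: fps_eq_iff Hilb_nth Hilb0_def dim_Dp_deg_split fps_X_power_mult_nth)

lemma Hilb0_top: "Hilb0 l = 0"
  by (simp add: fps_eq_iff Hilb0_def D0_top dim_zero)

text \<open>Each \<open>Hilb0 p\<close> enters through D^p with weight y^p and through D^(p+1) with
  weight x^m0 y^(p+1); only the last term lacks its partner.\<close>

lemma psi_split:
  "(\<Sum>p\<le>n. [:Hilb l A \<alpha> m p:] * y ^ p) =
   (\<Sum>p<n. [:Hilb0 p:] * y ^ p) * (1 + [:fps_X ^ m H0:] * y) + [:Hilb0 n:] * y ^ n"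
proof (induction n)
  case 0
  then show ?case by (simp add: Hilb_0)
next
  case (Suc n)
  have "[:Hilb l A \<alpha> m (Suc n):] = [:Hilb0 (Suc n):] + [:fps_X ^ m H0:] * [:Hilb0 n:]"
    by (simp add: Hilb_Suc)
  then have "(\<Sum>p\<le>Suc n. [:Hilb l A \<alpha> m p:] * y ^ p) =
      (\<Sum>p<n. [:Hilb0 p:] * y ^ p) * (1 + [:fps_X ^ m H0:] * y) + [:Hilb0 n:] * y ^ n +
      ([:Hilb0 (Suc n):] + [:fps_X ^ m H0:] * [:Hilb0 n:]) * y ^ Suc n"
    using Suc by (simp only: sum.atMost_Suc)
  also have "\<dots> = (\<Sum>p<Suc n. [:Hilb0 p:] * y ^ p) * (1 + [:fps_X ^ m H0:] * y) + [:Hilb0 (Suc n):] * y ^ Suc n"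
    by (simp only: sum.lessThan_Suc power_Suc) algebra
  finally show ?case .
qed

theorem linear_factor: "[:- int (m H0), 1:] dvd chi l A \<alpha> m"
proof -
  define g :: "int poly" where "g = (\<Sum>i<m H0. [:0, 1:] ^ i)"
  define y :: "int fps poly" where "y = [:-1, fps_X - 1:]"
  \<comment> \<open>The factor 1 + x^m0 y vanishes at x = 1, so its divisor x - 1 is moved into
    \<open>q\<close>; the remaining cofactor becomes t - m0 there.\<close>
  define q where "q = (\<Sum>p<l. [:Hilb0 p:] * y ^ p) * [:fps_X - 1:]"
  have "(fps_X - 1) * fps_of_poly g = fps_X ^ m H0 - (1 :: int fps)"
    by (simp add: g_def fps_of_poly_sum fps_of_poly_power fps_of_poly_fps_X power_diff_1_eq)
  \<comment> \<open>Both sides equal t x^m0 (x-1) + 1 - x^m0, because (x-1) g = x^m0 - 1.\<close>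
  then have "[:fps_X - 1:] * [:fps_of_poly (- g), fps_X ^ m H0:] = 1 + [:fps_X ^ m H0:] * y"
    by (simp add: y_def fps_of_poly_uminus algebra_simps one_pCons)
  then have "psi l A \<alpha> m = (\<Sum>p<l. [:Hilb0 p:] * y ^ p) * ([:fps_X - 1:] * [:fps_of_poly (- g), fps_X ^ m H0:])"
    unfolding psi_def y_def[symmetric] psi_split Hilb0_top by (simp only: pCons_0_0 mult_zero_left add_0_right)
  then have psi: "psi l A \<alpha> m = q * [:fps_of_poly (- g), fps_X ^ m H0:]"
    unfolding q_def by (simp only: mult.assoc)
  have q: "poly_coeffs q"
    using poly_coeffs_psi unfolding psi by (rule poly_coeffs_of_mult)
  have xm: "fps_X ^ m H0 = fps_of_poly (monom 1 (m H0) :: int poly)"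
    by (simp add: fps_of_poly_monom')
  have "fps_at_one (fps_of_poly (- g)) = - int (m H0)"
    by (simp add: fps_at_one_fps_of_poly g_def poly_sum)
  moreover have "fps_at_one (fps_X ^ m H0) = 1"
    unfolding xm fps_at_one_fps_of_poly by (simp add: poly_monom)
  ultimately have "map_poly fps_at_one [:fps_of_poly (- g), fps_X ^ m H0:] = [:- int (m H0), 1:]"
    by (simp add: map_poly_pCons fps_at_one_0)
  moreover have "poly_coeffs [:fps_of_poly (- g), fps_X ^ m H0:]"
    unfolding xm by (rule poly_coeffs_linear)
  ultimately have "map_poly fps_at_one (psi l A \<alpha> m) = map_poly fps_at_one q * [:- int (m H0), 1:]"
    unfolding psi using map_poly_fps_at_one_mult[OF q] by metis
  then have "[:- int (m H0), 1:] dvd map_poly fps_at_one (psi l A \<alpha> m)"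
    by (rule dvdI[of _ _ "map_poly fps_at_one q", OF trans[OF _ mult.commute]])
  then show ?thesis
    unfolding chi_def by (rule dvd_smult)
qed

end

theorem theorem3p8:
  fixes l :: nat and A :: "(nat \<Rightarrow> 'k::field) set set"
    and \<alpha> :: "(nat \<Rightarrow> 'k) set \<Rightarrow> 'k mpoly" and m :: "(nat \<Rightarrow> 'k) set \<Rightarrow> nat"
    and H0 :: "(nat \<Rightarrow> 'k) set" and \<theta>0 :: "'k mpoly list \<Rightarrow> 'k mpoly"
  assumes "multiarrangement l A \<alpha> m"
    and "H0 \<in> A"
    and "good_summand l A \<alpha> m H0 \<theta>0"
  shows "[:- int (m H0), 1:] dvd chi l A \<alpha> m"
proof -
  interpret good_multiarr l A \<alpha> m H0 \<theta>0
    by unfold_locales (use assms in auto)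
  show ?thesis by (rule linear_factor)
qed

end
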